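(* Let $\mathbb X$ be a virtual equipment. Let $j\colon B\to D$, $\ell\colon B\to C$, $r\colon C\to D$ be tight-cells with a relative adjunction $\ell\dashv_j r$, with unit $\eta\colon j\Rightarrow r\ell$, and let $\ell'\colon A\to B$, $j'\colon A\to E$, $r'\colon D\to E$ be tight-cells with a relative adjunction $(j\ell')\dashv_{j'}r'$. Then there is a relative adjunction $(\ell\ell')\dashv_{j'}(r'r)$, and the tight-cell $r$ together with the 2-cell $\eta\ell'\colon j\ell'\Rightarrow r\ell\ell'$ is a left-morphism of $j'$-relative adjunctions from $\big((\ell\ell')\dashv_{j'}(r'r)\big)$ to $\big((j\ell')\dashv_{j'}r'\big)$. Furthermore, for fixed $\ell',j',r'$ and $(j\ell')\dashv_{j'}r'$, the assignment $(\ell\dashv_j r)\mapsto\big((\ell\ell')\dashv_{j'}(r'r)\big)$ extends to functors $\mathbf{RAdj}_L(j)\to\mathbf{RAdj}_L(j')$ and $\mathbf{RAdj}_R(j)\to\mathbf{RAdj}_R(j')$.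
   Context: Virtual equipments. A virtual double category has objects; a category of tight-cells $f\colon A\to B$ (the composite of $f\colon A\to B$ and $g\colon B\to C$ is $gf$); loose-cells $p\colon A\nrightarrow B$; and 2-cells, each having as frame a chain of loose-cells $p_1\colon A_1\nrightarrow A_0,\dots,p_n\colon A_n\nrightarrow A_{n-1}$ ($n\ge 0$; chains are always listed in this order), a loose-cell $q\colon B_n\nrightarrow B_0$, and tight-cells $f_0\colon A_0\to B_0$ (left) and $f_n\colon A_n\to B_n$ (right); 2-cells have identities and associative unital multicategory-style composition. $\phi\colon p_1,\dots,p_n\Rightarrow q$ denotes a 2-cell whose tight-cells are identities. A 2-cell $q_1,\dots,q_m\Rightarrow q$ is opcartesian if every 2-cell (with any tight-cells) with domain $p_1,\dots,p_l,q_1,\dots,q_m,r_1,\dots,r_n$ factors uniquely through it; then $q$ is the loose-composite $q_1\odot\cdots\odot q_m$ (the loose-identity $A(1,1)\colon A\nrightarrow A$ if $m=0$). A unary 2-cell from $p$ to $q$ with left $f$ and right $g$ is cartesian if every 2-cell into $q$ with left $ff'$ and right $gg'$ factors uniquely through it via a 2-cell with left $f'$ and right $g'$; then $p$ is the restriction $q(f,g)$. A virtual equipment has all loose-identities and restrictions. Write $E(f,g):=E(1,1)(f,g)$; for $f\colon D\to E$, $g\colon A\to E$ it is a loose-cell $A\nrightarrow D$. A 2-cell $f\Rightarrow g$ between tight-cells $A\to B$ is equivalently a 2-cell $B(1,f)\Rightarrow B(1,g)$, or $B(g,1)\Rightarrow B(f,1)$, or $()\Rightarrow B(f,g)$; objects,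 tight-cells and these 2-cells form a 2-category. Restriction is functorial in 2-cells (contravariantly in the first argument, covariantly in the second). For $f\colon A\to B$, $\frown_f\colon ()\Rightarrow B(f,f)$ is the 2-cell corresponding to $1_f$. $\phi(f,g)$ denotes the 2-cell obtained from $\phi$ by restricting along $f$ on the left and $g$ on the right; e.g. $\frown_c(\ell,1)\colon C(\ell,1)\Rightarrow C'(c\ell,c)$ is the action of $c\colon C\to C'$. Relative adjunctions. For a tight-cell $j\colon B\to D$ (the root), a $j$-relative adjunction $\ell\dashv_j r$ consists of tight-cells $\ell\colon B\to C$, $r\colon C\to D$ and an isomorphism $\sharp\colon C(\ell,1)\cong D(j,r):\flat$; its unit $\eta\colon j\Rightarrow r\ell$ corresponds to $\sharp(1,\ell)\circ\frown_\ell\colon()\Rightarrow D(j,r\ell)$. A left-morphism from $\ell_1\dashv_j r_1$ (apex $C_1$) to $\ell_2\dashv_j r_2$ (apex $C_2$) is a pair $(c,\lambda)$ of a tight-cell $c\colon C_1\to C_2$ with $r_1=r_2c$ and a 2-cell $\lambda\colon\ell_2\Rightarrow c\ell_1$ such that $\sharp_1=\sharp_2(1,c)\circ C_2(\lambda,c)\circ\frown_c(\ell_1,1)\colon C_1(\ell_1,1)\Rightarrow D(j,r_1)$. A right-morphism is a pair $(c,\rho)$ of a tight-cell $c\colon C_1\to C_2$ with $c\ell_1=\ell_2$ and a 2-cell $\rho\colon r_1\Rightarrow r_2c$ such that $D(j,\rho)\circ\sharp_1=\sharp_2(1,c)\circ\frown_c(\ell_1,1)$. $\mathbf{RAdj}_L(j)$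 and $\mathbf{RAdj}_R(j)$ are the categories of $j$-relative adjunctions with left- and right-morphisms respectively. *)

theory Defs
  imports Main
begin

section \<open>Categories and functors\<close>

record ('o, 'm) cat =
  Ob  :: "'o set"
  Mor :: "'m set"
  src :: "'m \<Rightarrow> 'o"
  tgt :: "'m \<Rightarrow> 'o"
  idt :: "'o \<Rightarrow> 'm"
  cmp :: "'m \<Rightarrow> 'm \<Rightarrow> 'm"  (infixl "\<cdot>\<index>" 70)

text \<open>Composition is written in applicative order: \<open>g \<cdot> f\<close> means first \<open>f\<close>, then \<open>g\<close>.\<close>

definition arrow :: "('o, 'm, 'z) cat_scheme \<Rightarrow> 'm \<Rightarrow> 'o \<Rightarrow> 'o \<Rightarrow> bool" where
  "arrow C f a b \<longleftrightarrow> f \<in> Mor C \<and> src C f = a \<and> tgt C f = b"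

locale category =
  fixes C :: "('o, 'm, 'z) cat_scheme" (structure)
  assumes src_ob: "f \<in> Mor C \<Longrightarrow> src C f \<in> Ob C"
    and tgt_ob: "f \<in> Mor C \<Longrightarrow> tgt C f \<in> Ob C"
    and idt_arrow: "a \<in> Ob C \<Longrightarrow> arrow C (idt C a) a a"
    and cmp_arrow: "arrow C f a b \<Longrightarrow> arrow C g b c \<Longrightarrow> arrow C (g \<cdot> f) a c"
    and cmp_idt_left: "arrow C f a b \<Longrightarrow> idt C b \<cdot> f = f"
    and cmp_idt_right: "arrow C f a b \<Longrightarrow> f \<cdot> idt C a = f"
    and cmp_assoc: "arrow C f a b \<Longrightarrow> arrow C g b c \<Longrightarrow> arrow C h c d \<Longrightarrow> h \<cdot> (g \<cdot> f) = (h \<cdot> g) \<cdot> f"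

locale cat_functor = S: category S + T: category T
  for S :: "('o, 'm, 'y) cat_scheme" and T :: "('p, 'n, 'z) cat_scheme" +
  fixes Fo :: "'o \<Rightarrow> 'p" and Fm :: "'m \<Rightarrow> 'n"
  assumes Fo_ob: "a \<in> Ob S \<Longrightarrow> Fo a \<in> Ob T"
    and Fm_arrow: "arrow S f a b \<Longrightarrow> arrow T (Fm f) (Fo a) (Fo b)"
    and Fm_idt: "a \<in> Ob S \<Longrightarrow> Fm (idt S a) = idt T (Fo a)"
    and Fm_cmp: "arrow S f a b \<Longrightarrow> arrow S g b c \<Longrightarrow> Fm (g \<cdot>\<^bsub>S\<^esub> f) = Fm g \<cdot>\<^bsub>T\<^esub> Fm f"


section \<open>Virtual double categories\<close>

text \<open>
  The underlying category consists of the objects and tight-cells.  A loose-cell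
  \<open>p : A \<nrightarrow> B\<close> has \<open>lsrc p = A\<close> and \<open>ltgt p = B\<close>.  Chains of loose-cells are lists
  \<open>[p\<^sub>1, \<dots>, p\<^sub>n]\<close> with \<open>p\<^sub>i : A\<^sub>i \<nrightarrow> A\<^sub>i\<^sub>-\<^sub>1\<close>, so that they run from the codomain \<open>A\<^sub>0\<close> of \<open>p\<^sub>1\<close>
  to the domain \<open>A\<^sub>n\<close> of \<open>p\<^sub>n\<close>.

  The composite of a 2-cell \<open>\<phi>\<close> with a chain of 2-cells \<open>\<psi>\<^sub>1, \<dots>, \<psi>\<^sub>m\<close> is \<open>ccomp \<phi> f [\<psi>\<^sub>1, \<dots>, \<psi>\<^sub>m]\<close>,
  where \<open>f\<close> is the tight-cell at which the chain of 2-cells starts.  If \<open>m > 0\<close> then \<open>f\<close> is the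
  left tight-cell of \<open>\<psi>\<^sub>1\<close>; if \<open>m = 0\<close> then \<open>f\<close> is not determined by the (empty) list, and
  \<open>ccomp \<phi> f []\<close> is the nullary 2-cell \<open>\<phi>\<close> precomposed with the tight-cell \<open>f\<close>.
\<close>

record ('o, 't, 'l, 'c) vdc = "('o, 't) cat" +
  Loose :: "'l set"
  lsrc  :: "'l \<Rightarrow> 'o"
  ltgt  :: "'l \<Rightarrow> 'o"
  Cell  :: "'c set"
  cdom  :: "'c \<Rightarrow> 'l list"
  ccod  :: "'c \<Rightarrow> 'l"
  lft   :: "'c \<Rightarrow> 't"
  rgt   :: "'c \<Rightarrow> 't"
  cid   :: "'l \<Rightarrow> 'c"
  ccomp :: "'c \<Rightarrow> 't \<Rightarrow> 'c list \<Rightarrow> 'c"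

fun lchain :: "('o, 't, 'l, 'c) vdc \<Rightarrow> 'o \<Rightarrow> 'l list \<Rightarrow> 'o \<Rightarrow> bool" where
  "lchain X a [] b \<longleftrightarrow> a \<in> Ob X \<and> a = b"
| "lchain X a (p # ps) b \<longleftrightarrow> p \<in> Loose X \<and> ltgt X p = a \<and> lchain X (lsrc X p) ps b"

text \<open>\<open>cchain X f \<psi>s g\<close>: the list \<open>\<psi>s\<close> is a horizontally adjacent chain of 2-cells with
  leftmost tight-cell \<open>f\<close> and rightmost tight-cell \<open>g\<close>.\<close>

fun cchain :: "('o, 't, 'l, 'c) vdc \<Rightarrow> 't \<Rightarrow> 'c list \<Rightarrow> 't \<Rightarrow> bool" where
  "cchain X f [] g \<longleftrightarrow> f \<in> Mor X \<and> f = g"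
| "cchain X f (\<psi> # \<psi>s) g \<longleftrightarrow> \<psi> \<in> Cell X \<and> lft X \<psi> = f \<and> cchain X (rgt X \<psi>) \<psi>s g"

text \<open>The composites \<open>\<psi>\<^sub>i \<circ> (\<chi>\<^sub>i\<^sub>,\<^sub>1, \<dots>, \<chi>\<^sub>i\<^sub>,\<^sub>k\<^sub>i)\<close> for a chain of 2-cells \<open>\<psi>\<^sub>i\<close>, where \<open>h\<close> is the tight-cell at
  which the concatenated chain of the \<open>\<chi>\<^sub>i\<^sub>,\<^sub>k\<close> starts.\<close>

fun ccomps :: "('o, 't, 'l, 'c) vdc \<Rightarrow> 't \<Rightarrow> 'c list \<Rightarrow> 'c list list \<Rightarrow> 'c list" where
  "ccomps X h (\<psi> # \<psi>s) (\<chi>s # \<chi>ss) =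
     ccomp X \<psi> h \<chi>s # ccomps X (if \<chi>s = [] then h else rgt X (last \<chi>s)) \<psi>s \<chi>ss"
| "ccomps X h _ _ = []"

definition cell :: "('o, 't, 'l, 'c) vdc \<Rightarrow> 'c \<Rightarrow> 't \<Rightarrow> 'l list \<Rightarrow> 'l \<Rightarrow> 't \<Rightarrow> bool" where
  "cell X \<phi> f ps q g \<longleftrightarrow>
     \<phi> \<in> Cell X \<and> lft X \<phi> = f \<and> cdom X \<phi> = ps \<and> ccod X \<phi> = q \<and> rgt X \<phi> = g"

definition composable :: "('o, 't, 'l, 'c) vdc \<Rightarrow> 'c \<Rightarrow> 't \<Rightarrow> 'c list \<Rightarrow> 't \<Rightarrow> bool" where
  "composable X \<phi> f \<psi>s g \<longleftrightarrow>
     \<phi> \<in> Cell X \<and> cchain X f \<psi>s g \<and> map (ccod X) \<psi>s = cdom X \<phi> \<and> tgt X f = src X (lft X \<phi>)"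

locale virtual_double_category = category X
  for X :: "('o, 't, 'l, 'c) vdc" (structure) +
  assumes lsrc_ob: "p \<in> Loose X \<Longrightarrow> lsrc X p \<in> Ob X"
    and ltgt_ob: "p \<in> Loose X \<Longrightarrow> ltgt X p \<in> Ob X"
    and lft_mor: "\<phi> \<in> Cell X \<Longrightarrow> lft X \<phi> \<in> Mor X"
    and rgt_mor: "\<phi> \<in> Cell X \<Longrightarrow> rgt X \<phi> \<in> Mor X"
    and cdom_chain: "\<phi> \<in> Cell X \<Longrightarrow> lchain X (src X (lft X \<phi>)) (cdom X \<phi>) (src X (rgt X \<phi>))"
    and ccod_loose: "\<phi> \<in> Cell X \<Longrightarrow> ccod X \<phi> \<in> Loose X"
    and ccod_ltgt: "\<phi> \<in> Cell X \<Longrightarrow> ltgt X (ccod X \<phi>) = tgt X (lft X \<phi>)"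
    and ccod_lsrc: "\<phi> \<in> Cell X \<Longrightarrow> lsrc X (ccod X \<phi>) = tgt X (rgt X \<phi>)"
    and cid_cell: "p \<in> Loose X \<Longrightarrow>
          cell X (cid X p) (idt X (ltgt X p)) [p] p (idt X (lsrc X p))"
    and ccomp_cell: "composable X \<phi> f \<psi>s g \<Longrightarrow>
          cell X (ccomp X \<phi> f \<psi>s)
            (lft X \<phi> \<cdot> f) (concat (map (cdom X) \<psi>s)) (ccod X \<phi>) (rgt X \<phi> \<cdot> g)"
    and ccomp_cid_left: "\<phi> \<in> Cell X \<Longrightarrow> ccomp X (cid X (ccod X \<phi>)) (lft X \<phi>) [\<phi>] = \<phi>"
    and ccomp_cid_right: "\<phi> \<in> Cell X \<Longrightarrow>
          ccomp X \<phi> (idt X (src X (lft X \<phi>))) (map (cid X) (cdom X \<phi>)) = \<phi>"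
    and ccomp_assoc: "composable X \<phi> f \<psi>s g \<Longrightarrow>
          list_all2 (\<lambda>\<psi> \<chi>s. map (ccod X) \<chi>s = cdom X \<psi>) \<psi>s \<chi>ss \<Longrightarrow>
          cchain X h (concat \<chi>ss) k \<Longrightarrow> tgt X h = src X f \<Longrightarrow>
          ccomp X (ccomp X \<phi> f \<psi>s) h (concat \<chi>ss) = ccomp X \<phi> (f \<cdot> h) (ccomps X h \<psi>s \<chi>ss)"


section \<open>Virtual equipments\<close>

text \<open>The condition \<open>lchain X (src X (lft X \<phi>)) ps (src X (lft X \<omega>))\<close> says that the segment
  \<open>cdom X \<omega>\<close> sits at the right object; this matters only when that segment is empty.\<close>

definition opcartesian :: "('o, 't, 'l, 'c) vdc \<Rightarrow> 'c \<Rightarrow> bool" where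
  "opcartesian X \<omega> \<longleftrightarrow>
     \<omega> \<in> Cell X \<and>
     lft X \<omega> = idt X (src X (lft X \<omega>)) \<and> rgt X \<omega> = idt X (src X (rgt X \<omega>)) \<and>
     (\<forall>\<phi> ps rs.
        \<phi> \<in> Cell X \<and> cdom X \<phi> = ps @ cdom X \<omega> @ rs \<and>
        lchain X (src X (lft X \<phi>)) ps (src X (lft X \<omega>)) \<longrightarrow>
        (\<exists>!\<chi>. cell X \<chi> (lft X \<phi>) (ps @ [ccod X \<omega>] @ rs) (ccod X \<phi>) (rgt X \<phi>) \<and>
              ccomp X \<chi> (idt X (src X (lft X \<phi>)))
                (map (cid X) ps @ [\<omega>] @ map (cid X) rs) = \<phi>))"

definition cartesian :: "('o, 't, 'l, 'c) vdc \<Rightarrow> 'c \<Rightarrow> bool" where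
  "cartesian X \<kappa> \<longleftrightarrow>
     \<kappa> \<in> Cell X \<and>
     (\<exists>p. cdom X \<kappa> = [p] \<and>
       (\<forall>\<phi> f' g'.
          \<phi> \<in> Cell X \<and> ccod X \<phi> = ccod X \<kappa> \<and>
          f' \<in> Mor X \<and> tgt X f' = src X (lft X \<kappa>) \<and> lft X \<phi> = lft X \<kappa> \<cdot>\<^bsub>X\<^esub> f' \<and>
          g' \<in> Mor X \<and> tgt X g' = src X (rgt X \<kappa>) \<and> rgt X \<phi> = rgt X \<kappa> \<cdot>\<^bsub>X\<^esub> g' \<longrightarrow>
          (\<exists>!\<chi>. cell X \<chi> f' (cdom X \<phi>) p g' \<and> ccomp X \<kappa> f' [\<chi>] = \<phi>)))"

definition is_lid_cell :: "('o, 't, 'l, 'c) vdc \<Rightarrow> 'o \<Rightarrow> 'c \<Rightarrow> bool" where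
  "is_lid_cell X a \<omega> \<longleftrightarrow> opcartesian X \<omega> \<and> cdom X \<omega> = [] \<and> lft X \<omega> = idt X a"

definition is_restr_cell :: "('o, 't, 'l, 'c) vdc \<Rightarrow> 'l \<Rightarrow> 't \<Rightarrow> 't \<Rightarrow> 'c \<Rightarrow> bool" where
  "is_restr_cell X q f g \<kappa> \<longleftrightarrow> cartesian X \<kappa> \<and> ccod X \<kappa> = q \<and> lft X \<kappa> = f \<and> rgt X \<kappa> = g"

locale virtual_equipment = virtual_double_category X
  for X :: "('o, 't, 'l, 'c) vdc" (structure) +
  assumes ex_lid: "a \<in> Ob X \<Longrightarrow> \<exists>\<omega>. is_lid_cell X a \<omega>"
    and ex_restr: "q \<in> Loose X \<Longrightarrow> f \<in> Mor X \<Longrightarrow> g \<in> Mor X \<Longrightarrow>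
          tgt X f = ltgt X q \<Longrightarrow> tgt X g = lsrc X q \<Longrightarrow> \<exists>\<kappa>. is_restr_cell X q f g \<kappa>"

text \<open>Loose-identities and restrictions are unique up to unique isomorphism; fixed but arbitrary
  ones are chosen.\<close>

definition lid_cell :: "('o, 't, 'l, 'c) vdc \<Rightarrow> 'o \<Rightarrow> 'c" where
  "lid_cell X a = (SOME \<omega>. is_lid_cell X a \<omega>)"

definition lid :: "('o, 't, 'l, 'c) vdc \<Rightarrow> 'o \<Rightarrow> 'l" where
  "lid X a = ccod X (lid_cell X a)"

definition restr_cell :: "('o, 't, 'l, 'c) vdc \<Rightarrow> 'l \<Rightarrow> 't \<Rightarrow> 't \<Rightarrow> 'c" where
  "restr_cell X q f g = (SOME \<kappa>. is_restr_cell X q f g \<kappa>)"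

definition restr :: "('o, 't, 'l, 'c) vdc \<Rightarrow> 'l \<Rightarrow> 't \<Rightarrow> 't \<Rightarrow> 'l" where
  "restr X q f g = hd (cdom X (restr_cell X q f g))"

text \<open>\<open>hom X f g\<close> is \<open>E(f,g) = E(1,1)(f,g)\<close>, where \<open>E\<close> is the common codomain of \<open>f\<close> and \<open>g\<close>;
  \<open>hom_cell X f g\<close> is its cartesian 2-cell to \<open>E(1,1)\<close>.\<close>

definition hom_cell :: "('o, 't, 'l, 'c) vdc \<Rightarrow> 't \<Rightarrow> 't \<Rightarrow> 'c" where
  "hom_cell X f g = restr_cell X (lid X (tgt X f)) f g"

definition hom :: "('o, 't, 'l, 'c) vdc \<Rightarrow> 't \<Rightarrow> 't \<Rightarrow> 'l" where
  "hom X f g = restr X (lid X (tgt X f)) f g"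

text \<open>The factorisation of \<open>\<phi>\<close> through a cartesian 2-cell \<open>\<kappa>\<close> by a 2-cell with left \<open>f'\<close> and right \<open>g'\<close>.\<close>

definition cart_fac :: "('o, 't, 'l, 'c) vdc \<Rightarrow> 'c \<Rightarrow> 't \<Rightarrow> 'c \<Rightarrow> 't \<Rightarrow> 'c" where
  "cart_fac X \<kappa> f' \<phi> g' =
     (THE \<chi>. cell X \<chi> f' (cdom X \<phi>) (hd (cdom X \<kappa>)) g' \<and> ccomp X \<kappa> f' [\<chi>] = \<phi>)"

text \<open>The canonical cartesian 2-cell \<open>E(fh,gk) \<Rightarrow> E(f,g)\<close> with left \<open>h\<close> and right \<open>k\<close>, exhibiting
  \<open>E(f,g)(h,k) = E(fh,gk)\<close>.\<close>

definition hom_restr_cell :: "('o, 't, 'l, 'c) vdc \<Rightarrow> 't \<Rightarrow> 't \<Rightarrow> 't \<Rightarrow> 't \<Rightarrow> 'c" where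
  "hom_restr_cell X f g h k =
     cart_fac X (hom_cell X f g) h (hom_cell X (f \<cdot>\<^bsub>X\<^esub> h) (g \<cdot>\<^bsub>X\<^esub> k)) k"

text \<open>If \<open>\<kappa> : p(h,k) \<Rightarrow> p\<close> and \<open>\<kappa>' : q(h,k) \<Rightarrow> q\<close> are cartesian 2-cells with left \<open>h\<close> and right \<open>k\<close>,
  and \<open>\<phi> : p \<Rightarrow> q\<close>, then \<open>restrict_along X \<kappa>' \<phi> \<kappa>\<close> is \<open>\<phi>(h,k) : p(h,k) \<Rightarrow> q(h,k)\<close>, the unique 2-cell
  whose composite with \<open>\<kappa>'\<close> is \<open>\<phi> \<circ> \<kappa>\<close>.\<close>

definition restrict_along :: "('o, 't, 'l, 'c) vdc \<Rightarrow> 'c \<Rightarrow> 'c \<Rightarrow> 'c \<Rightarrow> 'c" where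
  "restrict_along X \<kappa>' \<phi> \<kappa> =
     cart_fac X \<kappa>' (idt X (src X (lft X \<kappa>)))
       (ccomp X \<phi> (lft X \<kappa>) [\<kappa>]) (idt X (src X (rgt X \<kappa>)))"

text \<open>\<open>\<phi>(h,k) : E(ah,bk) \<Rightarrow> E'(a'h,b'k)\<close> for \<open>\<phi> : E(a,b) \<Rightarrow> E'(a',b')\<close>.\<close>

definition hom_restrict ::
  "('o, 't, 'l, 'c) vdc \<Rightarrow> 't \<Rightarrow> 't \<Rightarrow> 't \<Rightarrow> 't \<Rightarrow> 'c \<Rightarrow> 't \<Rightarrow> 't \<Rightarrow> 'c" where
  "hom_restrict X a b a' b' \<phi> h k =
     restrict_along X (hom_restr_cell X a' b' h k) \<phi> (hom_restr_cell X a b h k)"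

text \<open>The composite \<open>\<psi> \<circ> \<phi>\<close> of a unary 2-cell with a 2-cell.\<close>

definition vcomp :: "('o, 't, 'l, 'c) vdc \<Rightarrow> 'c \<Rightarrow> 'c \<Rightarrow> 'c" where
  "vcomp X \<psi> \<phi> = ccomp X \<psi> (lft X \<phi>) [\<phi>]"


section \<open>The 2-category of tight-cells\<close>

text \<open>Throughout, a 2-cell \<open>f \<Rightarrow> g\<close> between parallel tight-cells \<open>A \<rightarrow> B\<close> is represented as a
  2-cell \<open>() \<Rightarrow> B(f,g)\<close>.\<close>

definition tcell :: "('o, 't, 'l, 'c) vdc \<Rightarrow> 'c \<Rightarrow> 't \<Rightarrow> 't \<Rightarrow> bool" where
  "tcell X \<alpha> f g \<longleftrightarrow>
     f \<in> Mor X \<and> g \<in> Mor X \<and> src X f = src X g \<and> tgt X f = tgt X g \<and>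
     cell X \<alpha> (idt X (src X f)) [] (hom X f g) (idt X (src X f))"

text \<open>\<open>\<frown>\<^sub>f : () \<Rightarrow> B(f,f)\<close>, i.e. the identity 2-cell \<open>1\<^sub>f\<close>.\<close>

definition cap :: "('o, 't, 'l, 'c) vdc \<Rightarrow> 't \<Rightarrow> 'c" where
  "cap X f = cart_fac X (hom_cell X f f) (idt X (src X f))
     (ccomp X (lid_cell X (tgt X f)) f []) (idt X (src X f))"

text \<open>The composition 2-cell \<open>A(1,1), A(1,1) \<Rightarrow> A(1,1)\<close>.\<close>

definition lid_mult :: "('o, 't, 'l, 'c) vdc \<Rightarrow> 'o \<Rightarrow> 'c" where
  "lid_mult X a =
     (THE \<mu>. cell X \<mu> (idt X a) [lid X a, lid X a] (lid X a) (idt X a) \<and>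
             ccomp X \<mu> (idt X a) [lid_cell X a, cid X (lid X a)] = cid X (lid X a))"

text \<open>The composition 2-cell \<open>B(f,g), B(g,h) \<Rightarrow> B(f,h)\<close>.\<close>

definition hom_mult :: "('o, 't, 'l, 'c) vdc \<Rightarrow> 't \<Rightarrow> 't \<Rightarrow> 't \<Rightarrow> 'c" where
  "hom_mult X f g h =
     cart_fac X (hom_cell X f h) (idt X (src X f))
       (ccomp X (lid_mult X (tgt X f)) f [hom_cell X f g, hom_cell X g h]) (idt X (src X h))"

text \<open>The composite \<open>\<beta>\<alpha> : f \<Rightarrow> h\<close> of \<open>\<alpha> : f \<Rightarrow> g\<close> and \<open>\<beta> : g \<Rightarrow> h\<close>.\<close>

definition tcomp :: "('o, 't, 'l, 'c) vdc \<Rightarrow> 't \<Rightarrow> 't \<Rightarrow> 't \<Rightarrow> 'c \<Rightarrow> 'c \<Rightarrow> 'c" where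
  "tcomp X f g h \<beta> \<alpha> = ccomp X (hom_mult X f g h) (idt X (src X f)) [\<alpha>, \<beta>]"

text \<open>\<open>\<frown>\<^sub>c\<close> as a unary 2-cell \<open>C(1,1) \<Rightarrow> C'(c,c)\<close>, for \<open>c : C \<rightarrow> C'\<close>.\<close>

definition cap_unary :: "('o, 't, 'l, 'c) vdc \<Rightarrow> 't \<Rightarrow> 'c" where
  "cap_unary X c =
     (THE \<chi>. cell X \<chi> (idt X (src X c)) [lid X (src X c)] (hom X c c) (idt X (src X c)) \<and>
             ccomp X \<chi> (idt X (src X c)) [lid_cell X (src X c)] = cap X c)"

text \<open>\<open>\<frown>\<^sub>c(f,g) : C(f,g) \<Rightarrow> C'(cf,cg)\<close>, the action of \<open>c : C \<rightarrow> C'\<close>.\<close>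

definition act :: "('o, 't, 'l, 'c) vdc \<Rightarrow> 't \<Rightarrow> 't \<Rightarrow> 't \<Rightarrow> 'c" where
  "act X c f g =
     restrict_along X (hom_restr_cell X c c f g) (cap_unary X c) (hom_cell X f g)"

text \<open>Whiskerings \<open>\<alpha>k : fk \<Rightarrow> gk\<close> and \<open>c\<alpha> : cf \<Rightarrow> cg\<close> of \<open>\<alpha> : f \<Rightarrow> g\<close>.\<close>

definition whisker_right :: "('o, 't, 'l, 'c) vdc \<Rightarrow> 't \<Rightarrow> 't \<Rightarrow> 'c \<Rightarrow> 't \<Rightarrow> 'c" where
  "whisker_right X f g \<alpha> k =
     cart_fac X (hom_restr_cell X f g k k) (idt X (src X k)) (ccomp X \<alpha> k []) (idt X (src X k))"

definition whisker_left :: "('o, 't, 'l, 'c) vdc \<Rightarrow> 't \<Rightarrow> 't \<Rightarrow> 't \<Rightarrow> 'c \<Rightarrow> 'c" where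
  "whisker_left X c f g \<alpha> = vcomp X (act X c f g) \<alpha>"

text \<open>Functoriality of restriction in 2-cells: for \<open>\<alpha> : f \<Rightarrow> g\<close>, the 2-cells
  \<open>B(\<alpha>,h) : B(g,h) \<Rightarrow> B(f,h)\<close> and \<open>B(h,\<alpha>) : B(h,f) \<Rightarrow> B(h,g)\<close>.\<close>

definition hom_contra :: "('o, 't, 'l, 'c) vdc \<Rightarrow> 't \<Rightarrow> 't \<Rightarrow> 'c \<Rightarrow> 't \<Rightarrow> 'c" where
  "hom_contra X f g \<alpha> h =
     ccomp X (hom_mult X f g h) (idt X (src X f)) [\<alpha>, cid X (hom X g h)]"

definition hom_co :: "('o, 't, 'l, 'c) vdc \<Rightarrow> 't \<Rightarrow> 't \<Rightarrow> 't \<Rightarrow> 'c \<Rightarrow> 'c" where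
  "hom_co X h f g \<alpha> =
     ccomp X (hom_mult X h f g) (idt X (src X h)) [cid X (hom X h f), \<alpha>]"


section \<open>Relative adjunctions\<close>

record ('t, 'c) relative_adjunction =
  ladj  :: 't
  radj  :: 't
  sharp :: 'c
  flat  :: 'c

abbreviation apex :: "('o, 't, 'l, 'c) vdc \<Rightarrow> ('t, 'c) relative_adjunction \<Rightarrow> 'o" where
  "apex X R \<equiv> tgt X (ladj R)"

definition rel_adj :: "('o, 't, 'l, 'c) vdc \<Rightarrow> 't \<Rightarrow> ('t, 'c) relative_adjunction \<Rightarrow> bool" where
  "rel_adj X j R \<longleftrightarrow>
     (\<exists>B C D. arrow X j B D \<and> arrow X (ladj R) B C \<and> arrow X (radj R) C D \<and>
        (let p = hom X (ladj R) (idt X C); q = hom X j (radj R) in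
           cell X (sharp R) (idt X B) [p] q (idt X C) \<and>
           cell X (flat R) (idt X B) [q] p (idt X C) \<and>
           vcomp X (flat R) (sharp R) = cid X p \<and>
           vcomp X (sharp R) (flat R) = cid X q))"

text \<open>\<open>\<sharp>(1,c) : C(\<ell>,c) \<Rightarrow> D(j,rc)\<close>.\<close>

definition sharp_at :: "('o, 't, 'l, 'c) vdc \<Rightarrow> 't \<Rightarrow> ('t, 'c) relative_adjunction \<Rightarrow> 't \<Rightarrow> 'c" where
  "sharp_at X j R c =
     hom_restrict X (ladj R) (idt X (apex X R)) j (radj R) (sharp R) (idt X (src X j)) c"

definition unit :: "('o, 't, 'l, 'c) vdc \<Rightarrow> 't \<Rightarrow> ('t, 'c) relative_adjunction \<Rightarrow> 'c" where
  "unit X j R = vcomp X (sharp_at X j R (ladj R)) (cap X (ladj R))"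

definition left_mor ::
  "('o, 't, 'l, 'c) vdc \<Rightarrow> 't \<Rightarrow> ('t, 'c) relative_adjunction \<Rightarrow> ('t, 'c) relative_adjunction \<Rightarrow> 't \<times> 'c \<Rightarrow> bool" where
  "left_mor X j R\<^sub>1 R\<^sub>2 = (\<lambda>(c, \<nu>).
     rel_adj X j R\<^sub>1 \<and> rel_adj X j R\<^sub>2 \<and>
     arrow X c (apex X R\<^sub>1) (apex X R\<^sub>2) \<and>
     radj R\<^sub>1 = radj R\<^sub>2 \<cdot>\<^bsub>X\<^esub> c \<and>
     tcell X \<nu> (ladj R\<^sub>2) (c \<cdot>\<^bsub>X\<^esub> ladj R\<^sub>1) \<and>
     sharp R\<^sub>1 = vcomp X (sharp_at X j R\<^sub>2 c)
                 (vcomp X (hom_contra X (ladj R\<^sub>2) (c \<cdot>\<^bsub>X\<^esub> ladj R\<^sub>1) \<nu> c)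
                   (act X c (ladj R\<^sub>1) (idt X (apex X R\<^sub>1)))))"

definition right_mor ::
  "('o, 't, 'l, 'c) vdc \<Rightarrow> 't \<Rightarrow> ('t, 'c) relative_adjunction \<Rightarrow> ('t, 'c) relative_adjunction \<Rightarrow> 't \<times> 'c \<Rightarrow> bool" where
  "right_mor X j R\<^sub>1 R\<^sub>2 = (\<lambda>(c, \<rho>).
     rel_adj X j R\<^sub>1 \<and> rel_adj X j R\<^sub>2 \<and>
     arrow X c (apex X R\<^sub>1) (apex X R\<^sub>2) \<and>
     c \<cdot>\<^bsub>X\<^esub> ladj R\<^sub>1 = ladj R\<^sub>2 \<and>
     tcell X \<rho> (radj R\<^sub>1) (radj R\<^sub>2 \<cdot>\<^bsub>X\<^esub> c) \<and>
     vcomp X (hom_co X j (radj R\<^sub>1) (radj R\<^sub>2 \<cdot>\<^bsub>X\<^esub> c) \<rho>) (sharp R\<^sub>1) =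
       vcomp X (sharp_at X j R\<^sub>2 c) (act X c (ladj R\<^sub>1) (idt X (apex X R\<^sub>1))))"

text \<open>Morphisms are triples \<open>(R\<^sub>1, (c, \<nu>), R\<^sub>2)\<close> recording their domain and codomain.  The composite
  of left-morphisms \<open>(c, \<nu>)\<close> and then \<open>(c', \<nu>')\<close> is \<open>(c'c, c'\<nu> \<circ> \<nu>')\<close>; the composite of right-morphisms
  \<open>(c, \<rho>)\<close> and then \<open>(c', \<rho>')\<close> is \<open>(c'c, \<rho>'c \<circ> \<rho>)\<close>.\<close>

type_synonym ('t, 'c) radj_mor = "('t, 'c) relative_adjunction \<times> ('t \<times> 'c) \<times> ('t, 'c) relative_adjunction"

definition RAdj_L ::
  "('o, 't, 'l, 'c) vdc \<Rightarrow> 't \<Rightarrow> (('t, 'c) relative_adjunction, ('t, 'c) radj_mor) cat" where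
  "RAdj_L X j =
     \<lparr> Ob = {R. rel_adj X j R},
       Mor = {(R\<^sub>1, m, R\<^sub>2). left_mor X j R\<^sub>1 R\<^sub>2 m},
       src = (\<lambda>(R\<^sub>1, m, R\<^sub>2). R\<^sub>1),
       tgt = (\<lambda>(R\<^sub>1, m, R\<^sub>2). R\<^sub>2),
       idt = (\<lambda>R. (R, (idt X (apex X R), cap X (ladj R)), R)),
       cmp = (\<lambda>(R\<^sub>2, (c', \<nu>'), R\<^sub>3) (R\<^sub>1, (c, \<nu>), _).
         (R\<^sub>1,
          (c' \<cdot>\<^bsub>X\<^esub> c,
           tcomp X (ladj R\<^sub>3) (c' \<cdot>\<^bsub>X\<^esub> ladj R\<^sub>2) (c' \<cdot>\<^bsub>X\<^esub> c \<cdot>\<^bsub>X\<^esub> ladj R\<^sub>1)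
             (whisker_left X c' (ladj R\<^sub>2) (c \<cdot>\<^bsub>X\<^esub> ladj R\<^sub>1) \<nu>) \<nu>'),
          R\<^sub>3)) \<rparr>"

definition RAdj_R ::
  "('o, 't, 'l, 'c) vdc \<Rightarrow> 't \<Rightarrow> (('t, 'c) relative_adjunction, ('t, 'c) radj_mor) cat" where
  "RAdj_R X j =
     \<lparr> Ob = {R. rel_adj X j R},
       Mor = {(R\<^sub>1, m, R\<^sub>2). right_mor X j R\<^sub>1 R\<^sub>2 m},
       src = (\<lambda>(R\<^sub>1, m, R\<^sub>2). R\<^sub>1),
       tgt = (\<lambda>(R\<^sub>1, m, R\<^sub>2). R\<^sub>2),
       idt = (\<lambda>R. (R, (idt X (apex X R), cap X (radj R)), R)),
       cmp = (\<lambda>(R\<^sub>2, (c', \<rho>'), R\<^sub>3) (R\<^sub>1, (c, \<rho>), _).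
         (R\<^sub>1,
          (c' \<cdot>\<^bsub>X\<^esub> c,
           tcomp X (radj R\<^sub>1) (radj R\<^sub>2 \<cdot>\<^bsub>X\<^esub> c) (radj R\<^sub>3 \<cdot>\<^bsub>X\<^esub> c' \<cdot>\<^bsub>X\<^esub> c)
             (whisker_right X (radj R\<^sub>2) (radj R\<^sub>3 \<cdot>\<^bsub>X\<^esub> c') \<rho>' c) \<rho>),
          R\<^sub>3)) \<rparr>"

end

theory Submission
  imports Defs
begin

text \<open>
  Since \<open>E(f,g)\<close> is a restriction of \<open>E(1,1)\<close>, every 2-cell occurring here is determined by its
  composite into a loose identity, and on such composites the 2-categorical operations become
  strict.  In these terms \<open>\<sharp> : C(\<ell>,1) \<cong> D(j,r)\<close> is a transposition \<open>S\<close> sending a cell \<open>\<phi>\<close> with left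
  tight-cell \<open>\<ell>u\<close> and right tight-cell \<open>v\<close> to one with \<open>ju\<close> and \<open>rv\<close>; it satisfies \<open>S(\<phi>\<beta>) = S(\<phi>) (r\<beta>)\<close>
  because loose identities are opcartesian.  A left-morphism satisfies
  \<open>S\<^sub>1(\<phi>) = S\<^sub>2(\<lambda> (c\<phi>))\<close>, a right-morphism satisfies \<open>S\<^sub>1(\<phi>) \<rho> = S\<^sub>2(c\<phi>)\<close>.  The composite relative
  adjunction has transposition \<open>S'S\<close>, so left-morphisms are preserved by restricting along \<open>\<ell>'\<close> and
  right-morphisms by applying \<open>r'\<close>.  As \<open>\<eta> = S(1\<^sub>\<ell>)\<close>, naturality gives \<open>S(\<phi>) = \<eta> (r\<phi>)\<close>, which is the
  equation making \<open>(r, \<eta>\<ell>')\<close> a left-morphism.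
\<close>

text \<open>Restrictions are arbitrary choices, so \<open>hom X (f \<cdot> h) (g \<cdot> k)\<close>
  is tied to \<open>hom X f g\<close> only by a canonical cartesian cell, and computing with homs
  directly would carry these comparison cells through every equation. A cell into a loose identity
  has \<open>f\<close> and \<open>g\<close> as its sides instead, and restriction leaves no trace.
  The price is that the left side \<open>ladj R \<cdot> u\<close> of a cell need not determine
  \<open>u\<close>, which is why \<open>transp\<close> takes \<open>u\<close> as a parameter. The
  equations defining morphisms are tested on all cells \<open>\<phi>\<close> rather than on the
  universal one, so that the criterion for one morphism applies to the output of another and
  composition becomes substitution. The factors of \<open>mul\<close> are ordered as in a chain: a
  2-cell of left adjoints stands before \<open>\<phi>\<close>, inside the transposition, whiskered
  along \<open>u\<close>; a 2-cell of right adjoints stands after the transpose, whiskered along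
  \<open>rgt X \<phi>\<close>. Hence preservation of right-morphisms rests on naturality of the
  transposition of the fixed adjunction, preservation of left-morphisms on substitution.\<close>

context category
begin

section \<open>Typing rules and normal forms for tight-cells\<close>

lemma src_in_Ob [simp]: "f \<in> Mor C \<Longrightarrow> src C f \<in> Ob C"
  by (rule src_ob)

lemma tgt_in_Ob [simp]: "f \<in> Mor C \<Longrightarrow> tgt C f \<in> Ob C"
  by (rule tgt_ob)

lemma idt_simps [simp]:
  assumes "a \<in> Ob C"
  shows "idt C a \<in> Mor C" "src C (idt C a) = a" "tgt C (idt C a) = a"
  using idt_arrow[OF assms] by (auto simp: arrow_def)

lemma cmp_simps [simp]:
  assumes "f \<in> Mor C" "g \<in> Mor C" "tgt C f = src C g"
  shows "g \<cdot> f \<in> Mor C" "src C (g \<cdot> f) = src C f" "tgt C (g \<cdot> f) = tgt C g"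
  using cmp_arrow[of f "src C f" "tgt C f" g "tgt C g"] assms by (auto simp: arrow_def)

text \<open>The object is a variable with a side condition, so that the rule also fires when the
  identity is not literally taken at \<open>tgt C f\<close>.\<close>

lemma idt_cmp [simp]: "f \<in> Mor C \<Longrightarrow> tgt C f = a \<Longrightarrow> idt C a \<cdot> f = f"
  using cmp_idt_left by (auto simp: arrow_def)

lemma cmp_idt [simp]: "f \<in> Mor C \<Longrightarrow> src C f = a \<Longrightarrow> f \<cdot> idt C a = f"
  using cmp_idt_right by (auto simp: arrow_def)

text \<open>Simplification nests composites to the right, while unbracketed composites parse to the
  left. The local equations called \<open>e\<close> in later proofs mediate between the two
  forms.\<close>

lemma cmp_assoc_right [simp]:
  "f \<in> Mor C \<Longrightarrow> g \<in> Mor C \<Longrightarrow> h \<in> Mor C \<Longrightarrow> tgt C f = src C g \<Longrightarrow> tgt C g = src C h \<Longrightarrow>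
    (h \<cdot> g) \<cdot> f = h \<cdot> (g \<cdot> f)"
  using cmp_assoc[of f "src C f" "tgt C f" g "tgt C g" h "tgt C h"] by (auto simp: arrow_def)

end


section \<open>Composition of cells\<close>

context virtual_double_category
begin

declare lft_mor [simp] rgt_mor [simp] lsrc_ob [simp] ltgt_ob [simp] ccod_loose [simp]

lemma tgt_lft [simp]: "\<phi> \<in> Cell X \<Longrightarrow> tgt X (lft X \<phi>) = ltgt X (ccod X \<phi>)"
  by (simp add: ccod_ltgt)

lemma tgt_rgt [simp]: "\<phi> \<in> Cell X \<Longrightarrow> tgt X (rgt X \<phi>) = lsrc X (ccod X \<phi>)"
  by (simp add: ccod_lsrc)

lemma cid_simps [simp]:
  assumes "p \<in> Loose X"
  shows "cid X p \<in> Cell X" "lft X (cid X p) = idt X (ltgt X p)" "cdom X (cid X p) = [p]"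
    "ccod X (cid X p) = p" "rgt X (cid X p) = idt X (lsrc X p)"
  using cid_cell[OF assms] by (auto simp: cell_def)

lemma nullary_src: "\<phi> \<in> Cell X \<Longrightarrow> cdom X \<phi> = [] \<Longrightarrow> src X (rgt X \<phi>) = src X (lft X \<phi>)"
  using cdom_chain[of \<phi>] by simp

lemma unary_src:
  assumes "\<phi> \<in> Cell X" "cdom X \<phi> = [p]"
  shows "src X (lft X \<phi>) = ltgt X p" "src X (rgt X \<phi>) = lsrc X p" "p \<in> Loose X"
  using cdom_chain[of \<phi>] assms by auto

lemma binary_src:
  assumes "\<phi> \<in> Cell X" "cdom X \<phi> = [p, q]"
  shows "src X (lft X \<phi>) = ltgt X p" "src X (rgt X \<phi>) = lsrc X q" "lsrc X p = ltgt X q"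
    "p \<in> Loose X" "q \<in> Loose X"
  using cdom_chain[of \<phi>] assms by auto

lemma whisker_simps [simp]:
  assumes "\<phi> \<in> Cell X" "cdom X \<phi> = []" "f \<in> Mor X" "tgt X f = src X (lft X \<phi>)"
  shows "ccomp X \<phi> f [] \<in> Cell X" "lft X (ccomp X \<phi> f []) = lft X \<phi> \<cdot> f"
    "cdom X (ccomp X \<phi> f []) = []" "ccod X (ccomp X \<phi> f []) = ccod X \<phi>"
    "rgt X (ccomp X \<phi> f []) = rgt X \<phi> \<cdot> f"
  using ccomp_cell[of \<phi> f "[]" f] assms by (auto simp: composable_def cell_def)

lemma composable_unary:
  assumes "\<phi> \<in> Cell X" "\<psi> \<in> Cell X" "cdom X \<phi> = [ccod X \<psi>]"
  shows "composable X \<phi> (lft X \<psi>) [\<psi>] (rgt X \<psi>)"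
  using assms unary_src[of \<phi> "ccod X \<psi>"] by (auto simp: composable_def)

lemma composable_nullaryI [simp]:
  "\<phi> \<in> Cell X \<Longrightarrow> cdom X \<phi> = [] \<Longrightarrow> f \<in> Mor X \<Longrightarrow> tgt X f = src X (lft X \<phi>) \<Longrightarrow> composable X \<phi> f [] f"
  by (simp add: composable_def)

lemma composable_unaryI [simp]:
  "\<phi> \<in> Cell X \<Longrightarrow> \<psi> \<in> Cell X \<Longrightarrow> cdom X \<phi> = [ccod X \<psi>] \<Longrightarrow> lft X \<psi> = f \<Longrightarrow> rgt X \<psi> = g \<Longrightarrow>
    composable X \<phi> f [\<psi>] g"
  using composable_unary by blast

lemma vcomp_simps [simp]:
  assumes "\<phi> \<in> Cell X" "\<psi> \<in> Cell X" "cdom X \<phi> = [ccod X \<psi>]"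
  shows "vcomp X \<phi> \<psi> \<in> Cell X" "lft X (vcomp X \<phi> \<psi>) = lft X \<phi> \<cdot> lft X \<psi>"
    "cdom X (vcomp X \<phi> \<psi>) = cdom X \<psi>" "ccod X (vcomp X \<phi> \<psi>) = ccod X \<phi>"
    "rgt X (vcomp X \<phi> \<psi>) = rgt X \<phi> \<cdot> rgt X \<psi>"
  using ccomp_cell[OF composable_unary[OF assms]] by (auto simp: vcomp_def cell_def)

text \<open>The starting tight-cell is read off from the first inner cell, so that only nullary
  composites \<open>ccomp X \<phi> f []\<close> keep it as an explicit argument.\<close>

definition bcomp :: "'c \<Rightarrow> 'c \<Rightarrow> 'c \<Rightarrow> 'c" where
  "bcomp \<phi> \<psi>\<^sub>1 \<psi>\<^sub>2 = ccomp X \<phi> (lft X \<psi>\<^sub>1) [\<psi>\<^sub>1, \<psi>\<^sub>2]"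

lemma composable_binary:
  assumes "\<phi> \<in> Cell X" "\<psi>\<^sub>1 \<in> Cell X" "\<psi>\<^sub>2 \<in> Cell X" "cdom X \<phi> = [ccod X \<psi>\<^sub>1, ccod X \<psi>\<^sub>2]"
    "rgt X \<psi>\<^sub>1 = lft X \<psi>\<^sub>2"
  shows "composable X \<phi> (lft X \<psi>\<^sub>1) [\<psi>\<^sub>1, \<psi>\<^sub>2] (rgt X \<psi>\<^sub>2)"
  using assms binary_src[of \<phi> "ccod X \<psi>\<^sub>1" "ccod X \<psi>\<^sub>2"] by (auto simp: composable_def)

lemma composable_binaryI [simp]:
  "\<phi> \<in> Cell X \<Longrightarrow> \<psi>\<^sub>1 \<in> Cell X \<Longrightarrow> \<psi>\<^sub>2 \<in> Cell X \<Longrightarrow> cdom X \<phi> = [ccod X \<psi>\<^sub>1, ccod X \<psi>\<^sub>2] \<Longrightarrow>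
    rgt X \<psi>\<^sub>1 = lft X \<psi>\<^sub>2 \<Longrightarrow> lft X \<psi>\<^sub>1 = f \<Longrightarrow> rgt X \<psi>\<^sub>2 = g \<Longrightarrow> composable X \<phi> f [\<psi>\<^sub>1, \<psi>\<^sub>2] g"
  using composable_binary by blast

lemma bcomp_simps [simp]:
  assumes "\<phi> \<in> Cell X" "\<psi>\<^sub>1 \<in> Cell X" "\<psi>\<^sub>2 \<in> Cell X" "cdom X \<phi> = [ccod X \<psi>\<^sub>1, ccod X \<psi>\<^sub>2]"
    "rgt X \<psi>\<^sub>1 = lft X \<psi>\<^sub>2"
  shows "bcomp \<phi> \<psi>\<^sub>1 \<psi>\<^sub>2 \<in> Cell X" "lft X (bcomp \<phi> \<psi>\<^sub>1 \<psi>\<^sub>2) = lft X \<phi> \<cdot> lft X \<psi>\<^sub>1"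
    "cdom X (bcomp \<phi> \<psi>\<^sub>1 \<psi>\<^sub>2) = cdom X \<psi>\<^sub>1 @ cdom X \<psi>\<^sub>2" "ccod X (bcomp \<phi> \<psi>\<^sub>1 \<psi>\<^sub>2) = ccod X \<phi>"
    "rgt X (bcomp \<phi> \<psi>\<^sub>1 \<psi>\<^sub>2) = rgt X \<phi> \<cdot> rgt X \<psi>\<^sub>2"
  using ccomp_cell[OF composable_binary[OF assms]] by (auto simp: bcomp_def cell_def)

text \<open>Associativity for an outer chain of length one. The inner chain stays arbitrary because
  the lengths zero, one and two give the rules for whiskering, for \<open>vcomp\<close> and for
  \<open>bcomp\<close>.\<close>

lemma vcomp_ccomp:
  assumes "\<phi> \<in> Cell X" "\<psi> \<in> Cell X" "cdom X \<phi> = [ccod X \<psi>]" "composable X \<psi> h \<chi>s k"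
  shows "ccomp X (vcomp X \<phi> \<psi>) h \<chi>s = vcomp X \<phi> (ccomp X \<psi> h \<chi>s)"
  using ccomp_assoc[OF composable_unary[OF assms(1-3)], of "[\<chi>s]" h k] ccomp_cell[OF assms(4)] assms(4)
  by (auto simp: vcomp_def composable_def cell_def)

lemma vcomp_assoc [simp]:
  assumes "\<phi> \<in> Cell X" "\<psi> \<in> Cell X" "\<chi> \<in> Cell X" "cdom X \<phi> = [ccod X \<psi>]" "cdom X \<psi> = [ccod X \<chi>]"
  shows "vcomp X (vcomp X \<phi> \<psi>) \<chi> = vcomp X \<phi> (vcomp X \<psi> \<chi>)"
  using vcomp_ccomp[OF assms(1,2,4) composable_unary[OF assms(2,3,5)]] by (simp add: vcomp_def)

lemma vcomp_whisker [simp]: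
  assumes "\<phi> \<in> Cell X" "\<psi> \<in> Cell X" "cdom X \<phi> = [ccod X \<psi>]" "cdom X \<psi> = []"
    "h \<in> Mor X" "tgt X h = src X (lft X \<psi>)"
  shows "ccomp X (vcomp X \<phi> \<psi>) h [] = vcomp X \<phi> (ccomp X \<psi> h [])"
  using vcomp_ccomp[OF assms(1-3), of h "[]" h] assms by (simp add: composable_def)

lemma vcomp_bcomp:
  assumes "\<phi> \<in> Cell X" "\<psi> \<in> Cell X" "\<chi>\<^sub>1 \<in> Cell X" "\<chi>\<^sub>2 \<in> Cell X" "cdom X \<phi> = [ccod X \<psi>]"
    "cdom X \<psi> = [ccod X \<chi>\<^sub>1, ccod X \<chi>\<^sub>2]" "rgt X \<chi>\<^sub>1 = lft X \<chi>\<^sub>2"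
  shows "bcomp (vcomp X \<phi> \<psi>) \<chi>\<^sub>1 \<chi>\<^sub>2 = vcomp X \<phi> (bcomp \<psi> \<chi>\<^sub>1 \<chi>\<^sub>2)"
  using vcomp_ccomp[OF assms(1,2,5) composable_binary[OF assms(2,3,4,6,7)]] by (simp add: bcomp_def)

lemma whisker_whisker [simp]:
  assumes "\<phi> \<in> Cell X" "cdom X \<phi> = []" "f \<in> Mor X" "tgt X f = src X (lft X \<phi>)"
    "h \<in> Mor X" "tgt X h = src X f"
  shows "ccomp X (ccomp X \<phi> f []) h [] = ccomp X \<phi> (f \<cdot> h) []"
  using ccomp_assoc[of \<phi> f "[]" f "[]" h h] assms by (simp add: composable_def)

lemma whisker_idt [simp]:
  assumes "\<phi> \<in> Cell X" "cdom X \<phi> = []" "src X (lft X \<phi>) = a"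
  shows "ccomp X \<phi> (idt X a) [] = \<phi>"
  using ccomp_cid_right[OF assms(1)] assms by simp

lemma cid_vcomp [simp]: "\<phi> \<in> Cell X \<Longrightarrow> ccod X \<phi> = p \<Longrightarrow> vcomp X (cid X p) \<phi> = \<phi>"
  using ccomp_cid_left by (auto simp: vcomp_def)

lemma vcomp_cid [simp]: "\<phi> \<in> Cell X \<Longrightarrow> cdom X \<phi> = [p] \<Longrightarrow> vcomp X \<phi> (cid X p) = \<phi>"
  using ccomp_cid_right[of \<phi>] unary_src[of \<phi> p] by (simp add: vcomp_def)

lemma bcomp_cid [simp]: "\<phi> \<in> Cell X \<Longrightarrow> cdom X \<phi> = [p, q] \<Longrightarrow> bcomp \<phi> (cid X p) (cid X q) = \<phi>"
  using ccomp_cid_right[of \<phi>] binary_src[of \<phi> p q] by (simp add: bcomp_def)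

lemma bcomp_ccomp:
  assumes "\<phi> \<in> Cell X" "\<psi>\<^sub>1 \<in> Cell X" "\<psi>\<^sub>2 \<in> Cell X" "cdom X \<phi> = [ccod X \<psi>\<^sub>1, ccod X \<psi>\<^sub>2]"
    "rgt X \<psi>\<^sub>1 = lft X \<psi>\<^sub>2"
    "composable X \<psi>\<^sub>1 h \<chi>s\<^sub>1 k" "composable X \<psi>\<^sub>2 k \<chi>s\<^sub>2 m"
  shows "ccomp X (bcomp \<phi> \<psi>\<^sub>1 \<psi>\<^sub>2) h (\<chi>s\<^sub>1 @ \<chi>s\<^sub>2) = bcomp \<phi> (ccomp X \<psi>\<^sub>1 h \<chi>s\<^sub>1) (ccomp X \<psi>\<^sub>2 k \<chi>s\<^sub>2)"
proof -
  \<comment> \<open>\<open>ccomps\<close> finds the tight-cell at which the second composite starts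
    by a case distinction on the first inner chain. For an adjacent chain the result is its right
    end, also if the chain is empty.\<close>
  have k: "cchain X a \<chi>s b \<Longrightarrow> (if \<chi>s = [] then a else rgt X (last \<chi>s)) = b" for a b \<chi>s
    by (induction \<chi>s arbitrary: a) (auto split: if_splits)
  have app: "cchain X a \<chi>s b \<Longrightarrow> cchain X b \<chi>s' d \<Longrightarrow> cchain X a (\<chi>s @ \<chi>s') d" for a b d \<chi>s \<chi>s'
    by (induction \<chi>s arbitrary: a) auto
  show ?thesis
    using ccomp_assoc[OF composable_binary[OF assms(1-5)], of "[\<chi>s\<^sub>1, \<chi>s\<^sub>2]" h m] assms(6,7)
      ccomp_cell[OF assms(6)] k[of h \<chi>s\<^sub>1 k] app[of h \<chi>s\<^sub>1 k \<chi>s\<^sub>2 m]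
    by (auto simp: bcomp_def composable_def cell_def)
qed

end


section \<open>Loose identities and restrictions\<close>

context virtual_equipment
begin

section \<open>Factorisation and cancellation through cartesian cells\<close>

lemma cartesian_simps:
  assumes "cartesian X \<kappa>"
  shows "\<kappa> \<in> Cell X" "[hd (cdom X \<kappa>)] = cdom X \<kappa>"
  using assms unfolding cartesian_def by force+

lemma cart_fac_cell:
  assumes "cartesian X \<kappa>" "\<phi> \<in> Cell X" "ccod X \<phi> = ccod X \<kappa>"
    "u \<in> Mor X" "tgt X u = src X (lft X \<kappa>)" "lft X \<phi> = lft X \<kappa> \<cdot> u"
    "v \<in> Mor X" "tgt X v = src X (rgt X \<kappa>)" "rgt X \<phi> = rgt X \<kappa> \<cdot> v"
  shows "cell X (cart_fac X \<kappa> u \<phi> v) u (cdom X \<phi>) (hd (cdom X \<kappa>)) v"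
    and "vcomp X \<kappa> (cart_fac X \<kappa> u \<phi> v) = \<phi>"
proof -
  have "\<exists>!\<chi>. cell X \<chi> u (cdom X \<phi>) (hd (cdom X \<kappa>)) v \<and> ccomp X \<kappa> u [\<chi>] = \<phi>"
    using assms unfolding cartesian_def by force
  from theI'[OF this, folded cart_fac_def]
  show "cell X (cart_fac X \<kappa> u \<phi> v) u (cdom X \<phi>) (hd (cdom X \<kappa>)) v"
    and "vcomp X \<kappa> (cart_fac X \<kappa> u \<phi> v) = \<phi>"
    by (auto simp: vcomp_def cell_def)
qed

lemma cartesian_cancel:
  assumes "cartesian X \<kappa>" "\<chi> \<in> Cell X" "\<chi>' \<in> Cell X" "cdom X \<kappa> = [ccod X \<chi>]" "ccod X \<chi>' = ccod X \<chi>"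
    "cdom X \<chi>' = cdom X \<chi>" "lft X \<chi>' = lft X \<chi>" "rgt X \<chi>' = rgt X \<chi>"
    "vcomp X \<kappa> \<chi> = vcomp X \<kappa> \<chi>'"
  shows "\<chi> = \<chi>'"
proof -
  have "\<kappa> \<in> Cell X"
    using assms cartesian_simps by blast
  moreover have "ltgt X (ccod X \<chi>) = src X (lft X \<kappa>)" "lsrc X (ccod X \<chi>) = src X (rgt X \<kappa>)"
    using assms unary_src[of \<kappa> "ccod X \<chi>"] \<open>\<kappa> \<in> Cell X\<close> by auto
  moreover have "\<exists>!\<xi>. cell X \<xi> f' (cdom X \<phi>) (ccod X \<chi>) g' \<and> ccomp X \<kappa> f' [\<xi>] = \<phi>"
    if "\<phi> \<in> Cell X" "ccod X \<phi> = ccod X \<kappa>" "f' \<in> Mor X" "tgt X f' = src X (lft X \<kappa>)"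
      "lft X \<phi> = lft X \<kappa> \<cdot> f'" "g' \<in> Mor X" "tgt X g' = src X (rgt X \<kappa>)" "rgt X \<phi> = rgt X \<kappa> \<cdot> g'"
    for \<phi> f' g'
    using assms(1,4) that unfolding cartesian_def by auto
  \<comment> \<open>The universal property is applied to the common composite, of which both cells
    are factorisations with the same sides.\<close>
  from this[of "vcomp X \<kappa> \<chi>" "lft X \<chi>" "rgt X \<chi>"] calculation
  have "\<exists>!\<xi>. cell X \<xi> (lft X \<chi>) (cdom X (vcomp X \<kappa> \<chi>)) (ccod X \<chi>) (rgt X \<chi>) \<and>
      ccomp X \<kappa> (lft X \<chi>) [\<xi>] = vcomp X \<kappa> \<chi>"
    using assms(2-4) by simp
  moreover have "cell X \<chi> (lft X \<chi>) (cdom X (vcomp X \<kappa> \<chi>)) (ccod X \<chi>) (rgt X \<chi>)"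
    "ccomp X \<kappa> (lft X \<chi>) [\<chi>] = vcomp X \<kappa> \<chi>"
    "cell X \<chi>' (lft X \<chi>) (cdom X (vcomp X \<kappa> \<chi>)) (ccod X \<chi>) (rgt X \<chi>)"
    "ccomp X \<kappa> (lft X \<chi>) [\<chi>'] = vcomp X \<kappa> \<chi>"
    using assms(2-9) \<open>\<kappa> \<in> Cell X\<close> vcomp_simps(3)[of \<kappa> \<chi>] by (simp_all add: cell_def vcomp_def[of X \<kappa>])
  ultimately show ?thesis
    by blast
qed

section \<open>Loose identities as codomains of nullary opcartesian cells\<close>

lemma lid_cell_is_lid: "a \<in> Ob X \<Longrightarrow> is_lid_cell X a (lid_cell X a)"
  unfolding lid_cell_def by (rule someI_ex) (rule ex_lid)

lemma lid_cell_simps [simp]: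
  assumes "a \<in> Ob X"
  shows "lid_cell X a \<in> Cell X" "cdom X (lid_cell X a) = []" "ccod X (lid_cell X a) = lid X a"
    "lft X (lid_cell X a) = idt X a" "rgt X (lid_cell X a) = idt X a"
proof -
  show *: "lid_cell X a \<in> Cell X" "cdom X (lid_cell X a) = []" "ccod X (lid_cell X a) = lid X a"
    "lft X (lid_cell X a) = idt X a"
    using lid_cell_is_lid[OF assms] unfolding is_lid_cell_def opcartesian_def lid_def by blast+
  have "rgt X (lid_cell X a) = idt X (src X (rgt X (lid_cell X a)))"
    using lid_cell_is_lid[OF assms] unfolding is_lid_cell_def opcartesian_def by blast
  moreover have "src X (rgt X (lid_cell X a)) = a"
    using nullary_src[OF *(1,2)] * assms by simp
  ultimately show "rgt X (lid_cell X a) = idt X a"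
    by simp
qed

lemma lid_simps [simp]:
  assumes "a \<in> Ob X"
  shows "lid X a \<in> Loose X" "ltgt X (lid X a) = a" "lsrc X (lid X a) = a"
  using assms ccod_loose[of "lid_cell X a"] ccod_ltgt[of "lid_cell X a"] ccod_lsrc[of "lid_cell X a"]
  by simp_all

lemma lid_cell_opcartesian: "a \<in> Ob X \<Longrightarrow> opcartesian X (lid_cell X a)"
  using lid_cell_is_lid by (simp add: is_lid_cell_def)

text \<open>The domain of the opcartesian cell is empty, so a position in the domain of
  \<open>\<phi>\<close> has to be chosen where the loose identity is inserted: between
  \<open>ps\<close> and \<open>rs\<close>. The chain condition forces the object there to be
  \<open>a\<close>.\<close>

lemma lid_fac:
  assumes "a \<in> Ob X" "\<phi> \<in> Cell X" "cdom X \<phi> = ps @ rs" "lchain X (src X (lft X \<phi>)) ps a"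
  shows "\<exists>!\<chi>. cell X \<chi> (lft X \<phi>) (ps @ [lid X a] @ rs) (ccod X \<phi>) (rgt X \<phi>) \<and>
    ccomp X \<chi> (idt X (src X (lft X \<phi>))) (map (cid X) ps @ [lid_cell X a] @ map (cid X) rs) = \<phi>"
  using lid_cell_opcartesian[OF assms(1), unfolded opcartesian_def, THEN conjunct2, THEN conjunct2,
      THEN conjunct2, THEN spec[of _ \<phi>], THEN spec[of _ ps], THEN spec[of _ rs], THEN mp] assms
  by simp

text \<open>Both cells factor one and the same cell through the unit, so uniqueness applies. The
  bulk of the proof verifies that composing with the unit and identities yields a cell with domain
  \<open>ps @ rs\<close>.\<close>

lemma lid_cancel:
  assumes "a \<in> Ob X" "\<chi> \<in> Cell X" "cdom X \<chi> = ps @ [lid X a] @ rs"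
    "\<chi>' \<in> Cell X" "cdom X \<chi>' = ps @ [lid X a] @ rs" "lft X \<chi>' = lft X \<chi>" "rgt X \<chi>' = rgt X \<chi>"
    "ccod X \<chi>' = ccod X \<chi>"
    "ccomp X \<chi> (idt X (src X (lft X \<chi>))) (map (cid X) ps @ [lid_cell X a] @ map (cid X) rs) =
     ccomp X \<chi>' (idt X (src X (lft X \<chi>))) (map (cid X) ps @ [lid_cell X a] @ map (cid X) rs)"
  shows "\<chi> = \<chi>'"
proof -
  let ?l = "map (cid X) ps @ [lid_cell X a] @ map (cid X) rs"
  let ?\<phi> = "ccomp X \<chi> (idt X (src X (lft X \<chi>))) ?l"
  have ch: "lchain X (src X (lft X \<chi>)) (ps @ [lid X a] @ rs) (src X (rgt X \<chi>))"
    using cdom_chain[of \<chi>] assms by simp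
  have split: "lchain X x (ps @ [lid X a] @ rs) y \<Longrightarrow> lchain X x ps a \<and> lchain X a rs y" for x y
    using assms(1) by (induction ps arbitrary: x) auto
  have ids: "lchain X x qs y \<Longrightarrow> cchain X (idt X x) (map (cid X) qs) (idt X y)" for x qs y
    by (induction qs arbitrary: x) auto
  have app: "cchain X f \<chi>s g \<Longrightarrow> cchain X g \<chi>s' h \<Longrightarrow> cchain X f (\<chi>s @ \<chi>s') h" for f g h \<chi>s \<chi>s'
    by (induction \<chi>s arbitrary: f) auto
  have loose: "lchain X x qs y \<Longrightarrow> set qs \<subseteq> Loose X" for x qs y
    by (induction qs arbitrary: x) auto
  have dom: "set qs \<subseteq> Loose X \<Longrightarrow> map (ccod X) (map (cid X) qs) = qs"
    "set qs \<subseteq> Loose X \<Longrightarrow> concat (map (cdom X) (map (cid X) qs)) = qs" for qs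
    by (induction qs) auto
  note sp = split[OF ch]
  have sets: "set ps \<subseteq> Loose X" "set rs \<subseteq> Loose X"
    using sp loose by blast+
  note doms = dom[OF sets(1)] dom[OF sets(2)]
  have "cchain X (idt X (src X (lft X \<chi>))) ?l (idt X (src X (rgt X \<chi>)))"
    using assms(1) ids sp by (intro app[where g = "idt X a"]) auto
  then have "composable X \<chi> (idt X (src X (lft X \<chi>))) ?l (idt X (src X (rgt X \<chi>)))"
    using assms(1-8) doms by (simp add: composable_def del: map_map)
  from ccomp_cell[OF this] have phi: "cell X ?\<phi> (lft X \<chi>) (ps @ rs) (ccod X \<chi>) (rgt X \<chi>)"
    using assms(1-8) sp doms by (simp del: map_map)
  have "\<exists>!\<xi>. cell X \<xi> (lft X \<chi>) (ps @ [lid X a] @ rs) (ccod X \<chi>) (rgt X \<chi>) \<and>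
      ccomp X \<xi> (idt X (src X (lft X \<chi>))) ?l = ?\<phi>"
    using lid_fac[OF assms(1), of ?\<phi> ps rs] phi sp by (simp add: cell_def)
  moreover have "cell X \<chi> (lft X \<chi>) (ps @ [lid X a] @ rs) (ccod X \<chi>) (rgt X \<chi>)"
    "cell X \<chi>' (lft X \<chi>) (ps @ [lid X a] @ rs) (ccod X \<chi>) (rgt X \<chi>)"
    using assms(2-8) by (simp_all add: cell_def)
  ultimately show ?thesis
    using assms(9) by metis
qed

lemma lid_cancel_unary:
  assumes "a \<in> Ob X" "\<chi> \<in> Cell X" "cdom X \<chi> = [lid X a]"
    "\<chi>' \<in> Cell X" "cdom X \<chi>' = [lid X a]" "lft X \<chi>' = lft X \<chi>" "rgt X \<chi>' = rgt X \<chi>"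
    "ccod X \<chi>' = ccod X \<chi>" "vcomp X \<chi> (lid_cell X a) = vcomp X \<chi>' (lid_cell X a)"
  shows "\<chi> = \<chi>'"
  using lid_cancel[of a \<chi> "[]" "[]" \<chi>'] assms unary_src[of \<chi> "lid X a"] by (simp add: vcomp_def)

lemma lid_cancel_left:
  assumes "a \<in> Ob X" "\<chi> \<in> Cell X" "cdom X \<chi> = [lid X a, q]"
    "\<chi>' \<in> Cell X" "cdom X \<chi>' = [lid X a, q]" "lft X \<chi>' = lft X \<chi>" "rgt X \<chi>' = rgt X \<chi>"
    "ccod X \<chi>' = ccod X \<chi>" "bcomp \<chi> (lid_cell X a) (cid X q) = bcomp \<chi>' (lid_cell X a) (cid X q)"
  shows "\<chi> = \<chi>'"
  using lid_cancel[of a \<chi> "[]" "[q]" \<chi>'] assms binary_src[of \<chi> "lid X a" q] by (simp add: bcomp_def)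

text \<open>Serves the naturality of the transposition, where the unit is inserted to the right of a
  hom.\<close>

lemma lid_cancel_right:
  assumes "a \<in> Ob X" "\<chi> \<in> Cell X" "cdom X \<chi> = [p, lid X a]"
    "\<chi>' \<in> Cell X" "cdom X \<chi>' = [p, lid X a]" "lft X \<chi>' = lft X \<chi>" "rgt X \<chi>' = rgt X \<chi>"
    "ccod X \<chi>' = ccod X \<chi>" "bcomp \<chi> (cid X p) (lid_cell X a) = bcomp \<chi>' (cid X p) (lid_cell X a)"
  shows "\<chi> = \<chi>'"
  using lid_cancel[of a \<chi> "[p]" "[]" \<chi>'] assms binary_src[of \<chi> p "lid X a"] by (simp add: bcomp_def)

section \<open>Restrictions of loose identities\<close>

lemma hom_cell_is_restr:
  assumes "f \<in> Mor X" "g \<in> Mor X" "tgt X g = tgt X f"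
  shows "is_restr_cell X (lid X (tgt X f)) f g (hom_cell X f g)"
  unfolding hom_cell_def restr_cell_def by (rule someI_ex, rule ex_restr) (use assms in simp_all)

lemma hom_cell_cartesian:
  "f \<in> Mor X \<Longrightarrow> g \<in> Mor X \<Longrightarrow> tgt X g = tgt X f \<Longrightarrow> cartesian X (hom_cell X f g)"
  using hom_cell_is_restr by (simp add: is_restr_cell_def)

lemma hom_cell_simps [simp]:
  assumes "f \<in> Mor X" "g \<in> Mor X" "tgt X g = tgt X f"
  shows "hom_cell X f g \<in> Cell X" "cdom X (hom_cell X f g) = [hom X f g]"
    "ccod X (hom_cell X f g) = lid X (tgt X f)"
    "lft X (hom_cell X f g) = f" "rgt X (hom_cell X f g) = g"
  using hom_cell_is_restr[OF assms] cartesian_simps[of "hom_cell X f g"]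
  by (simp_all add: is_restr_cell_def hom_def restr_def hom_cell_cartesian flip: hom_cell_def)

lemma hom_simps [simp]:
  assumes "f \<in> Mor X" "g \<in> Mor X" "tgt X g = tgt X f"
  shows "hom X f g \<in> Loose X" "ltgt X (hom X f g) = src X f" "lsrc X (hom X f g) = src X g"
  using unary_src[of "hom_cell X f g" "hom X f g"] assms by simp_all

lemma hom_fac:
  assumes "f \<in> Mor X" "g \<in> Mor X" "tgt X g = tgt X f" "\<phi> \<in> Cell X" "ccod X \<phi> = lid X (tgt X f)"
    "u \<in> Mor X" "tgt X u = src X f" "lft X \<phi> = f \<cdot> u" "v \<in> Mor X" "tgt X v = src X g" "rgt X \<phi> = g \<cdot> v"
  shows "cell X (cart_fac X (hom_cell X f g) u \<phi> v) u (cdom X \<phi>) (hom X f g) v"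
    and "vcomp X (hom_cell X f g) (cart_fac X (hom_cell X f g) u \<phi> v) = \<phi>"
  using cart_fac_cell[OF hom_cell_cartesian, of f g \<phi> u v] assms by simp_all

lemma hom_cancel:
  assumes "f \<in> Mor X" "g \<in> Mor X" "tgt X g = tgt X f"
    "\<chi> \<in> Cell X" "\<chi>' \<in> Cell X" "ccod X \<chi> = hom X f g" "ccod X \<chi>' = hom X f g"
    "cdom X \<chi>' = cdom X \<chi>" "lft X \<chi>' = lft X \<chi>" "rgt X \<chi>' = rgt X \<chi>"
    "vcomp X (hom_cell X f g) \<chi> = vcomp X (hom_cell X f g) \<chi>'"
  shows "\<chi> = \<chi>'"
  using cartesian_cancel[OF hom_cell_cartesian, of f g \<chi> \<chi>'] assms by simp

end


section \<open>Cells into loose identities\<close>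

context virtual_equipment
begin

lemma hom_fac_simps [simp]:
  assumes "f \<in> Mor X" "g \<in> Mor X" "tgt X g = tgt X f" "\<phi> \<in> Cell X" "ccod X \<phi> = lid X (tgt X f)"
    "u \<in> Mor X" "tgt X u = src X f" "lft X \<phi> = f \<cdot> u" "v \<in> Mor X" "tgt X v = src X g" "rgt X \<phi> = g \<cdot> v"
  shows "cart_fac X (hom_cell X f g) u \<phi> v \<in> Cell X"
    "lft X (cart_fac X (hom_cell X f g) u \<phi> v) = u"
    "cdom X (cart_fac X (hom_cell X f g) u \<phi> v) = cdom X \<phi>"
    "ccod X (cart_fac X (hom_cell X f g) u \<phi> v) = hom X f g"
    "rgt X (cart_fac X (hom_cell X f g) u \<phi> v) = v"
    "vcomp X (hom_cell X f g) (cart_fac X (hom_cell X f g) u \<phi> v) = \<phi>"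
  using hom_fac[OF assms] by (auto simp: cell_def)

section \<open>Iterated restriction\<close>

lemma hom_restr_cell_simps [simp]:
  assumes "f \<in> Mor X" "g \<in> Mor X" "tgt X g = tgt X f" "h \<in> Mor X" "tgt X h = src X f"
    "k \<in> Mor X" "tgt X k = src X g"
  shows "hom_restr_cell X f g h k \<in> Cell X" "lft X (hom_restr_cell X f g h k) = h"
    "cdom X (hom_restr_cell X f g h k) = [hom X (f \<cdot> h) (g \<cdot> k)]"
    "ccod X (hom_restr_cell X f g h k) = hom X f g" "rgt X (hom_restr_cell X f g h k) = k"
    "vcomp X (hom_cell X f g) (hom_restr_cell X f g h k) = hom_cell X (f \<cdot> h) (g \<cdot> k)"
  unfolding hom_restr_cell_def using assms by simp_all

text \<open>In right-nested normal form the two cells being absorbed are no longer a subterm of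
  their own, so the absorption is stated with a further cell \<open>\<chi>\<close> behind
  them.\<close>

lemma hom_restr_cell_vcomp [simp]:
  assumes "f \<in> Mor X" "g \<in> Mor X" "tgt X g = tgt X f" "h \<in> Mor X" "tgt X h = src X f"
    "k \<in> Mor X" "tgt X k = src X g" "\<chi> \<in> Cell X" "ccod X \<chi> = hom X (f \<cdot> h) (g \<cdot> k)"
  shows "vcomp X (hom_cell X f g) (vcomp X (hom_restr_cell X f g h k) \<chi>) =
    vcomp X (hom_cell X (f \<cdot> h) (g \<cdot> k)) \<chi>"
  using vcomp_assoc[of "hom_cell X f g" "hom_restr_cell X f g h k" \<chi>] assms by simp

text \<open>Cancellation for cartesian cells: \<open>hom_cell X f g\<close> is cartesian, and so is
  its composite with the present cell, which is
  \<open>hom_cell X (f \<cdot> h) (g \<cdot> k)\<close>.\<close>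

lemma hom_restr_cell_cartesian:
  assumes "f \<in> Mor X" "g \<in> Mor X" "tgt X g = tgt X f" "h \<in> Mor X" "tgt X h = src X f"
    "k \<in> Mor X" "tgt X k = src X g"
  shows "cartesian X (hom_restr_cell X f g h k)"
  unfolding cartesian_def
proof (intro conjI exI allI impI)
  let ?\<kappa> = "hom_restr_cell X f g h k"
  show "?\<kappa> \<in> Cell X" "cdom X ?\<kappa> = [hom X (f \<cdot> h) (g \<cdot> k)]"
    using assms by simp_all
  fix \<phi> f' g'
  assume "\<phi> \<in> Cell X \<and> ccod X \<phi> = ccod X ?\<kappa> \<and>
    f' \<in> Mor X \<and> tgt X f' = src X (lft X ?\<kappa>) \<and> lft X \<phi> = lft X ?\<kappa> \<cdot> f' \<and>
    g' \<in> Mor X \<and> tgt X g' = src X (rgt X ?\<kappa>) \<and> rgt X \<phi> = rgt X ?\<kappa> \<cdot> g'"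
  then have phi: "\<phi> \<in> Cell X" "ccod X \<phi> = hom X f g" "f' \<in> Mor X" "tgt X f' = src X h"
    "lft X \<phi> = h \<cdot> f'" "g' \<in> Mor X" "tgt X g' = src X k" "rgt X \<phi> = k \<cdot> g'"
    using assms by simp_all
  let ?P = "\<lambda>\<chi>. cell X \<chi> f' (cdom X \<phi>) (hom X (f \<cdot> h) (g \<cdot> k)) g' \<and> ccomp X ?\<kappa> f' [\<chi>] = \<phi>"
  \<comment> \<open>To factor \<open>\<phi>\<close> it is first pushed on to the loose identity and
    then factored through the composite cartesian cell.\<close>
  let ?\<chi> = "cart_fac X (hom_cell X (f \<cdot> h) (g \<cdot> k)) f' (vcomp X (hom_cell X f g) \<phi>) g'"
  have "vcomp X ?\<kappa> ?\<chi> = \<phi>"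
    by (rule hom_cancel[of f g]) (use assms phi in simp_all)
  then have "?P ?\<chi>"
    using assms phi by (simp add: cell_def vcomp_def[of X ?\<kappa>])
  moreover have "\<chi> = ?\<chi>" if "?P \<chi>" for \<chi>
  proof -
    have chi: "\<chi> \<in> Cell X" "lft X \<chi> = f'" "rgt X \<chi> = g'" "cdom X \<chi> = cdom X \<phi>"
      "ccod X \<chi> = hom X (f \<cdot> h) (g \<cdot> k)" "vcomp X ?\<kappa> \<chi> = \<phi>"
      using that by (auto simp: cell_def vcomp_def)
    have *: "vcomp X (hom_cell X (f \<cdot> h) (g \<cdot> k)) \<chi> = vcomp X (hom_cell X f g) \<phi>"
      using hom_restr_cell_vcomp[of f g h k \<chi>] assms chi by simp
    show ?thesis
      by (rule hom_cancel[of "f \<cdot> h" "g \<cdot> k"]) (use assms phi chi * in simp_all)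
  qed
  ultimately show "\<exists>!\<chi>. ?P \<chi>"
    by (rule ex1I)
qed

section \<open>Restriction of cells between homs\<close>

lemma restrict_along_cell:
  assumes "cartesian X \<kappa>'" "\<kappa> \<in> Cell X" "\<phi> \<in> Cell X" "cdom X \<phi> = [ccod X \<kappa>]" "ccod X \<phi> = ccod X \<kappa>'"
    "lft X \<phi> = idt X (tgt X (lft X \<kappa>))" "rgt X \<phi> = idt X (tgt X (rgt X \<kappa>))"
    "lft X \<kappa>' = lft X \<kappa>" "rgt X \<kappa>' = rgt X \<kappa>"
  shows "cell X (restrict_along X \<kappa>' \<phi> \<kappa>) (idt X (src X (lft X \<kappa>))) (cdom X \<kappa>) (hd (cdom X \<kappa>'))
      (idt X (src X (rgt X \<kappa>)))"
    and "vcomp X \<kappa>' (restrict_along X \<kappa>' \<phi> \<kappa>) = vcomp X \<phi> \<kappa>"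
  using cart_fac_cell[OF assms(1), of "vcomp X \<phi> \<kappa>" "idt X (src X (lft X \<kappa>))" "idt X (src X (rgt X \<kappa>))"] assms(2-)
  by (simp_all add: restrict_along_def flip: vcomp_def)

lemma hom_restrict_simps [simp]:
  assumes "a \<in> Mor X" "b \<in> Mor X" "tgt X b = tgt X a" "a' \<in> Mor X" "b' \<in> Mor X" "tgt X b' = tgt X a'"
    "h \<in> Mor X" "tgt X h = src X a" "src X a' = src X a" "k \<in> Mor X" "tgt X k = src X b" "src X b' = src X b"
    "\<phi> \<in> Cell X" "cdom X \<phi> = [hom X a b]" "ccod X \<phi> = hom X a' b'"
    "lft X \<phi> = idt X (src X a)" "rgt X \<phi> = idt X (src X b)"
  shows "hom_restrict X a b a' b' \<phi> h k \<in> Cell X"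
    "lft X (hom_restrict X a b a' b' \<phi> h k) = idt X (src X h)"
    "cdom X (hom_restrict X a b a' b' \<phi> h k) = [hom X (a \<cdot> h) (b \<cdot> k)]"
    "ccod X (hom_restrict X a b a' b' \<phi> h k) = hom X (a' \<cdot> h) (b' \<cdot> k)"
    "rgt X (hom_restrict X a b a' b' \<phi> h k) = idt X (src X k)"
  using restrict_along_cell(1)[OF hom_restr_cell_cartesian[of a' b' h k], of "hom_restr_cell X a b h k" \<phi>] assms
  by (simp_all add: hom_restrict_def cell_def)

lemma hom_restrict_restr_cell:
  assumes "a \<in> Mor X" "b \<in> Mor X" "tgt X b = tgt X a" "a' \<in> Mor X" "b' \<in> Mor X" "tgt X b' = tgt X a'"
    "h \<in> Mor X" "tgt X h = src X a" "src X a' = src X a" "k \<in> Mor X" "tgt X k = src X b" "src X b' = src X b"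
    "\<phi> \<in> Cell X" "cdom X \<phi> = [hom X a b]" "ccod X \<phi> = hom X a' b'"
    "lft X \<phi> = idt X (src X a)" "rgt X \<phi> = idt X (src X b)"
  shows "vcomp X (hom_restr_cell X a' b' h k) (hom_restrict X a b a' b' \<phi> h k) =
      vcomp X \<phi> (hom_restr_cell X a b h k)"
  using restrict_along_cell(2)[OF hom_restr_cell_cartesian[of a' b' h k], of "hom_restr_cell X a b h k" \<phi>] assms
  by (simp add: hom_restrict_def)

lemma hom_restrict_hom_cell:
  assumes "a \<in> Mor X" "b \<in> Mor X" "tgt X b = tgt X a" "a' \<in> Mor X" "b' \<in> Mor X" "tgt X b' = tgt X a'"
    "h \<in> Mor X" "tgt X h = src X a" "src X a' = src X a" "k \<in> Mor X" "tgt X k = src X b" "src X b' = src X b"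
    "\<phi> \<in> Cell X" "cdom X \<phi> = [hom X a b]" "ccod X \<phi> = hom X a' b'"
    "lft X \<phi> = idt X (src X a)" "rgt X \<phi> = idt X (src X b)"
  shows "vcomp X (hom_cell X (a' \<cdot> h) (b' \<cdot> k)) (hom_restrict X a b a' b' \<phi> h k) =
      vcomp X (hom_cell X a' b') (vcomp X \<phi> (hom_restr_cell X a b h k))"
  using hom_restr_cell_vcomp[of a' b' h k "hom_restrict X a b a' b' \<phi> h k"] hom_restrict_restr_cell[OF assms] assms
  by simp

text \<open>Functoriality of restriction, in the instance of a one-sided inverse. Applied once more
  with the two cells exchanged, it transports isomorphisms.\<close>

lemma hom_restrict_inverse:
  assumes "a \<in> Mor X" "b \<in> Mor X" "tgt X b = tgt X a" "a' \<in> Mor X" "b' \<in> Mor X" "tgt X b' = tgt X a'"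
    "h \<in> Mor X" "tgt X h = src X a" "src X a' = src X a" "k \<in> Mor X" "tgt X k = src X b" "src X b' = src X b"
    "\<phi> \<in> Cell X" "cdom X \<phi> = [hom X a b]" "ccod X \<phi> = hom X a' b'"
    "lft X \<phi> = idt X (src X a)" "rgt X \<phi> = idt X (src X b)"
    "\<psi> \<in> Cell X" "cdom X \<psi> = [hom X a' b']" "ccod X \<psi> = hom X a b"
    "lft X \<psi> = idt X (src X a)" "rgt X \<psi> = idt X (src X b)"
    "vcomp X \<psi> \<phi> = cid X (hom X a b)"
  shows "vcomp X (hom_restrict X a' b' a b \<psi> h k) (hom_restrict X a b a' b' \<phi> h k) =
    cid X (hom X (a \<cdot> h) (b \<cdot> k))"
proof (rule hom_cancel[of "a \<cdot> h" "b \<cdot> k"])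
  let ?\<kappa> = "hom_restr_cell X a b h k" and ?\<kappa>' = "hom_restr_cell X a' b' h k"
  let ?\<phi> = "hom_restrict X a b a' b' \<phi> h k" and ?\<psi> = "hom_restrict X a' b' a b \<psi> h k"
  have \<phi>: "vcomp X ?\<kappa>' ?\<phi> = vcomp X \<phi> ?\<kappa>"
    by (rule hom_restrict_restr_cell) (use assms in simp_all)
  have \<psi>: "vcomp X (hom_cell X (a \<cdot> h) (b \<cdot> k)) ?\<psi> = vcomp X (hom_cell X a b) (vcomp X \<psi> ?\<kappa>')"
    by (rule hom_restrict_hom_cell) (use assms in simp_all)
  have "vcomp X (hom_cell X (a \<cdot> h) (b \<cdot> k)) (vcomp X ?\<psi> ?\<phi>) =
    vcomp X (vcomp X (hom_cell X (a \<cdot> h) (b \<cdot> k)) ?\<psi>) ?\<phi>"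
    by (rule vcomp_assoc[symmetric]) (use assms in simp_all)
  \<comment> \<open>The restricted cells are replaced one after the other by the original ones; the
    restriction cell moves to the right each time until \<open>\<psi>\<close> meets
    \<open>\<phi>\<close>.\<close>
  also have "\<dots> = vcomp X (hom_cell X a b) (vcomp X \<psi> (vcomp X ?\<kappa>' ?\<phi>))"
    unfolding \<psi> using assms(1-22) by simp
  also have "\<dots> = vcomp X (hom_cell X a b) (vcomp X (vcomp X \<psi> \<phi>) ?\<kappa>)"
    unfolding \<phi> using assms(1-22) by simp
  also have "\<dots> = hom_cell X (a \<cdot> h) (b \<cdot> k)"
    unfolding assms(23) using assms(1-22) by simp
  finally show "vcomp X (hom_cell X (a \<cdot> h) (b \<cdot> k)) (vcomp X ?\<psi> ?\<phi>) =
      vcomp X (hom_cell X (a \<cdot> h) (b \<cdot> k)) (cid X (hom X (a \<cdot> h) (b \<cdot> k)))"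
    using assms(1-22) by simp
qed (use assms in simp_all)

section \<open>The multiplication on a loose identity\<close>

text \<open>The multiplication is the factorisation of the identity cell through a unit inserted on
  the left. Thus the left unit law holds by construction, whereas the right one and associativity
  have to be derived from uniqueness.\<close>

lemma lid_mult_simps [simp]:
  assumes "a \<in> Ob X"
  shows "lid_mult X a \<in> Cell X" "lft X (lid_mult X a) = idt X a"
    "cdom X (lid_mult X a) = [lid X a, lid X a]" "ccod X (lid_mult X a) = lid X a"
    "rgt X (lid_mult X a) = idt X a"
    "bcomp (lid_mult X a) (lid_cell X a) (cid X (lid X a)) = cid X (lid X a)"
proof -
  have "\<exists>!\<mu>. cell X \<mu> (idt X a) [lid X a, lid X a] (lid X a) (idt X a) \<and>
      ccomp X \<mu> (idt X a) [lid_cell X a, cid X (lid X a)] = cid X (lid X a)"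
    using lid_fac[of a "cid X (lid X a)" "[]" "[lid X a]"] assms by simp
  from theI'[OF this, folded lid_mult_def]
  show "lid_mult X a \<in> Cell X" "lft X (lid_mult X a) = idt X a"
    "cdom X (lid_mult X a) = [lid X a, lid X a]" "ccod X (lid_mult X a) = lid X a"
    "rgt X (lid_mult X a) = idt X a"
    "bcomp (lid_mult X a) (lid_cell X a) (cid X (lid X a)) = cid X (lid X a)"
    using assms by (auto simp: cell_def bcomp_def)
qed

text \<open>A cell into \<open>E(f,g)\<close> amounts to a cell into \<open>E(1,1)\<close>; on the latter, pasting along a common
  tight-cell is a strictly associative and unital multiplication.\<close>

definition mul :: "'o \<Rightarrow> 'c \<Rightarrow> 'c \<Rightarrow> 'c" where
  "mul a \<phi> \<psi> = bcomp (lid_mult X a) \<phi> \<psi>"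

lemma mul_simps [simp]:
  assumes "a \<in> Ob X" "\<phi> \<in> Cell X" "ccod X \<phi> = lid X a" "\<psi> \<in> Cell X" "ccod X \<psi> = lid X a"
    "rgt X \<phi> = lft X \<psi>"
  shows "mul a \<phi> \<psi> \<in> Cell X" "lft X (mul a \<phi> \<psi>) = lft X \<phi>" "rgt X (mul a \<phi> \<psi>) = rgt X \<psi>"
    "cdom X (mul a \<phi> \<psi>) = cdom X \<phi> @ cdom X \<psi>" "ccod X (mul a \<phi> \<psi>) = lid X a"
  unfolding mul_def using assms by simp_all

text \<open>Interchange with arbitrary inner chains. The rules that follow are its instances
  according to whether each factor is nullary or unary.\<close>

lemma mul_ccomp:
  assumes "a \<in> Ob X" "\<phi> \<in> Cell X" "ccod X \<phi> = lid X a" "\<psi> \<in> Cell X" "ccod X \<psi> = lid X a"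
    "rgt X \<phi> = lft X \<psi>" "composable X \<phi> h \<chi>s k" "composable X \<psi> k \<chi>s' m"
  shows "ccomp X (mul a \<phi> \<psi>) h (\<chi>s @ \<chi>s') = mul a (ccomp X \<phi> h \<chi>s) (ccomp X \<psi> k \<chi>s')"
  using bcomp_ccomp[of "lid_mult X a" \<phi> \<psi>] assms by (simp add: mul_def)

lemma mul_whisker [simp]:
  assumes "a \<in> Ob X" "\<phi> \<in> Cell X" "ccod X \<phi> = lid X a" "\<psi> \<in> Cell X" "ccod X \<psi> = lid X a"
    "rgt X \<phi> = lft X \<psi>" "cdom X \<phi> = []" "cdom X \<psi> = []" "f \<in> Mor X" "tgt X f = src X (lft X \<phi>)"
  shows "ccomp X (mul a \<phi> \<psi>) f [] = mul a (ccomp X \<phi> f []) (ccomp X \<psi> f [])"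
  using mul_ccomp[of a \<phi> \<psi> f "[]" f "[]" f] assms nullary_src[of \<phi>] by simp

text \<open>The nullary factor has no domain that could receive \<open>\<chi>\<close>; it is
  whiskered along the tight-cell where \<open>\<chi>\<close> begins. If it stands on the right, it
  is whiskered along the tight-cell where \<open>\<chi>\<close> ends.\<close>

lemma mul_vcomp_nullary_left:
  assumes "a \<in> Ob X" "\<phi> \<in> Cell X" "ccod X \<phi> = lid X a" "\<psi> \<in> Cell X" "ccod X \<psi> = lid X a"
    "rgt X \<phi> = lft X \<psi>" "cdom X \<phi> = []" "\<chi> \<in> Cell X" "cdom X \<psi> = [ccod X \<chi>]"
  shows "vcomp X (mul a \<phi> \<psi>) \<chi> = mul a (ccomp X \<phi> (lft X \<chi>) []) (vcomp X \<psi> \<chi>)"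
  using mul_ccomp[of a \<phi> \<psi> "lft X \<chi>" "[]" "lft X \<chi>" "[\<chi>]" "rgt X \<chi>"]
    assms nullary_src[of \<phi>] unary_src[of \<psi> "ccod X \<chi>"] by (simp add: vcomp_def)

lemma mul_vcomp_nullary_right:
  assumes "a \<in> Ob X" "\<phi> \<in> Cell X" "ccod X \<phi> = lid X a" "\<psi> \<in> Cell X" "ccod X \<psi> = lid X a"
    "rgt X \<phi> = lft X \<psi>" "cdom X \<psi> = []" "\<chi> \<in> Cell X" "cdom X \<phi> = [ccod X \<chi>]"
  shows "vcomp X (mul a \<phi> \<psi>) \<chi> = mul a (vcomp X \<phi> \<chi>) (ccomp X \<psi> (rgt X \<chi>) [])"
proof -
  have "tgt X (rgt X \<chi>) = src X (lft X \<psi>)"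
    using assms unary_src[of \<phi> "ccod X \<chi>"] by simp
  then show ?thesis
    using mul_ccomp[of a \<phi> \<psi> "lft X \<chi>" "[\<chi>]" "rgt X \<chi>" "[]" "rgt X \<chi>"] assms by (simp add: vcomp_def)
qed

lemma mul_bcomp:
  assumes "a \<in> Ob X" "\<phi> \<in> Cell X" "ccod X \<phi> = lid X a" "\<psi> \<in> Cell X" "ccod X \<psi> = lid X a"
    "rgt X \<phi> = lft X \<psi>" "\<chi> \<in> Cell X" "cdom X \<phi> = [ccod X \<chi>]" "\<chi>' \<in> Cell X" "cdom X \<psi> = [ccod X \<chi>']"
    "rgt X \<chi> = lft X \<chi>'"
  shows "bcomp (mul a \<phi> \<psi>) \<chi> \<chi>' = mul a (vcomp X \<phi> \<chi>) (vcomp X \<psi> \<chi>')"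
  using mul_ccomp[of a \<phi> \<psi> "lft X \<chi>" "[\<chi>]" "rgt X \<chi>" "[\<chi>']" "rgt X \<chi>'"] assms
  by (simp add: vcomp_def bcomp_def)

text \<open>The law for the identity cell of the loose identity is the defining property of
  \<open>lid_mult\<close>; precomposing it with \<open>\<phi>\<close> gives the general
  case.\<close>

lemma mul_unit_left [simp]:
  assumes "a \<in> Ob X" "\<phi> \<in> Cell X" "ccod X \<phi> = lid X a" "lft X \<phi> = f"
  shows "mul a (ccomp X (lid_cell X a) f []) \<phi> = \<phi>"
proof -
  have "mul a (ccomp X (lid_cell X a) f []) (vcomp X (cid X (lid X a)) \<phi>) =
      vcomp X (mul a (lid_cell X a) (cid X (lid X a))) \<phi>"
    using mul_vcomp_nullary_left[of a "lid_cell X a" "cid X (lid X a)" \<phi>] assms by simp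
  also have "\<dots> = \<phi>"
    using assms by (simp add: mul_def)
  finally show ?thesis
    using assms by simp
qed

text \<open>Inserting one more unit makes both factors equal to \<open>lid_cell X a\<close>. There
  the left unit law can be used, so the right unit law follows by cancelling the inserted
  unit.\<close>

lemma mul_cid_lid_cell:
  assumes "a \<in> Ob X"
  shows "mul a (cid X (lid X a)) (lid_cell X a) = cid X (lid X a)"
proof (rule lid_cancel_unary[OF assms])
  have "vcomp X (mul a (cid X (lid X a)) (lid_cell X a)) (lid_cell X a) =
      mul a (lid_cell X a) (lid_cell X a)"
    using mul_vcomp_nullary_right[of a "cid X (lid X a)" "lid_cell X a" "lid_cell X a"] assms by simp
  then show "vcomp X (mul a (cid X (lid X a)) (lid_cell X a)) (lid_cell X a) =
      vcomp X (cid X (lid X a)) (lid_cell X a)"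
    using mul_unit_left[of a "lid_cell X a" "idt X a"] assms by simp
qed (use assms in simp_all)

lemma mul_unit_right [simp]:
  assumes "a \<in> Ob X" "\<phi> \<in> Cell X" "ccod X \<phi> = lid X a" "rgt X \<phi> = f"
  shows "mul a \<phi> (ccomp X (lid_cell X a) f []) = \<phi>"
proof -
  have "mul a (vcomp X (cid X (lid X a)) \<phi>) (ccomp X (lid_cell X a) f []) =
      vcomp X (mul a (cid X (lid X a)) (lid_cell X a)) \<phi>"
    using mul_vcomp_nullary_right[of a "cid X (lid X a)" "lid_cell X a" \<phi>] assms by simp
  also have "\<dots> = \<phi>"
    using assms by (simp add: mul_cid_lid_cell)
  finally show ?thesis
    using assms by simp
qed

text \<open>Associativity in its universal form, for cells out of three loose identities. A unit in
  the leftmost slot reduces both sides to \<open>lid_mult X a\<close>, by the left unit law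
  alone.\<close>

lemma mul_lid_mult:
  assumes "a \<in> Ob X"
  shows "mul a (lid_mult X a) (cid X (lid X a)) = mul a (cid X (lid X a)) (lid_mult X a)"
proof (rule lid_cancel[of a _ "[]" "[lid X a, lid X a]"])
  let ?l = "lid X a" and ?\<mu> = "lid_mult X a" and ?e = "lid_cell X a" and ?i = "cid X (lid X a)"
  \<comment> \<open>The chain of one unit and two identities is split as two and one, to match the
    factors \<open>?\<mu>\<close> and \<open>?i\<close>; for the other side the same chain is split
    as one and two.\<close>
  have "ccomp X (mul a ?\<mu> ?i) (idt X a) ([?e, ?i] @ [?i]) = mul a (bcomp ?\<mu> ?e ?i) (vcomp X ?i ?i)"
    using mul_ccomp[of a ?\<mu> ?i "idt X a" "[?e, ?i]" "idt X a" "[?i]" "idt X a"] assms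
    by (simp add: bcomp_def vcomp_def)
  also have "\<dots> = ?\<mu>"
    using assms by (simp add: mul_def)
  also have "\<dots> = mul a (vcomp X ?i ?e) (bcomp ?\<mu> ?i ?i)"
    using mul_unit_left[of a ?\<mu> "idt X a"] assms by simp
  also have "\<dots> = ccomp X (mul a ?i ?\<mu>) (idt X a) ([?e] @ [?i, ?i])"
    using mul_ccomp[of a ?i ?\<mu> "idt X a" "[?e]" "idt X a" "[?i, ?i]" "idt X a"] assms
    by (simp add: bcomp_def vcomp_def)
  finally show "ccomp X (mul a ?\<mu> ?i) (idt X (src X (lft X (mul a ?\<mu> ?i))))
      (map (cid X) [] @ [?e] @ map (cid X) [?l, ?l]) =
    ccomp X (mul a ?i ?\<mu>) (idt X (src X (lft X (mul a ?\<mu> ?i))))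
      (map (cid X) [] @ [?e] @ map (cid X) [?l, ?l])"
    using assms by simp
qed (use assms in simp_all)

lemma mul_assoc [simp]:
  assumes "a \<in> Ob X" "\<phi> \<in> Cell X" "ccod X \<phi> = lid X a" "\<psi> \<in> Cell X" "ccod X \<psi> = lid X a"
    "\<chi> \<in> Cell X" "ccod X \<chi> = lid X a" "rgt X \<phi> = lft X \<psi>" "rgt X \<psi> = lft X \<chi>"
  shows "mul a (mul a \<phi> \<psi>) \<chi> = mul a \<phi> (mul a \<psi> \<chi>)"
proof -
  let ?\<mu> = "lid_mult X a" and ?i = "cid X (lid X a)"
  have "mul a (mul a \<phi> \<psi>) \<chi> = ccomp X (mul a ?\<mu> ?i) (lft X \<phi>) ([\<phi>, \<psi>] @ [\<chi>])"
    using mul_ccomp[of a ?\<mu> ?i "lft X \<phi>" "[\<phi>, \<psi>]" "lft X \<chi>" "[\<chi>]" "rgt X \<chi>"] assms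
    by (simp add: mul_def bcomp_def flip: vcomp_def)
  also have "\<dots> = ccomp X (mul a ?i ?\<mu>) (lft X \<phi>) ([\<phi>] @ [\<psi>, \<chi>])"
    using assms by (simp add: mul_lid_mult)
  also have "\<dots> = mul a \<phi> (mul a \<psi> \<chi>)"
    using mul_ccomp[of a ?i ?\<mu> "lft X \<phi>" "[\<phi>]" "lft X \<psi>" "[\<psi>, \<chi>]" "rgt X \<chi>"] assms
    by (simp add: mul_def bcomp_def flip: vcomp_def)
  finally show ?thesis .
qed

end


section \<open>The 2-category of tight-cells\<close>

context virtual_equipment
begin

section \<open>Identity 2-cells and the action of a tight-cell\<close>

lemma cap_simps [simp]:
  assumes "f \<in> Mor X"
  shows "cap X f \<in> Cell X" "lft X (cap X f) = idt X (src X f)" "cdom X (cap X f) = []"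
    "ccod X (cap X f) = hom X f f" "rgt X (cap X f) = idt X (src X f)"
    "vcomp X (hom_cell X f f) (cap X f) = ccomp X (lid_cell X (tgt X f)) f []"
  unfolding cap_def using assms by simp_all

lemma cap_unary_simps [simp]:
  assumes "c \<in> Mor X"
  shows "cap_unary X c \<in> Cell X" "lft X (cap_unary X c) = idt X (src X c)"
    "cdom X (cap_unary X c) = [lid X (src X c)]"
    "ccod X (cap_unary X c) = hom X c c" "rgt X (cap_unary X c) = idt X (src X c)"
    "vcomp X (cap_unary X c) (lid_cell X (src X c)) = cap X c"
proof -
  have "\<exists>!\<chi>. cell X \<chi> (idt X (src X c)) [lid X (src X c)] (hom X c c) (idt X (src X c)) \<and>
      ccomp X \<chi> (idt X (src X c)) [lid_cell X (src X c)] = cap X c"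
    using lid_fac[of "src X c" "cap X c" "[]" "[]"] assms by simp
  from theI'[OF this, folded cap_unary_def]
  show "cap_unary X c \<in> Cell X" "lft X (cap_unary X c) = idt X (src X c)"
    "cdom X (cap_unary X c) = [lid X (src X c)]"
    "ccod X (cap_unary X c) = hom X c c" "rgt X (cap_unary X c) = idt X (src X c)"
    "vcomp X (cap_unary X c) (lid_cell X (src X c)) = cap X c"
    using assms by (auto simp: cell_def vcomp_def)
qed

text \<open>The action of \<open>c\<close> on loose identities, as a cell with \<open>c\<close> on
  both sides; it is \<open>cap_unary X c\<close> with its codomain carried on to the loose identity.
  Postcomposition with it is the strict form of \<open>act\<close>.\<close>

definition lid_map :: "'t \<Rightarrow> 'c" where
  "lid_map c = vcomp X (hom_cell X c c) (cap_unary X c)"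

lemma lid_map_simps [simp]:
  assumes "c \<in> Mor X"
  shows "lid_map c \<in> Cell X" "lft X (lid_map c) = c" "cdom X (lid_map c) = [lid X (src X c)]"
    "ccod X (lid_map c) = lid X (tgt X c)" "rgt X (lid_map c) = c"
  unfolding lid_map_def using assms by simp_all

lemma lid_map_lid_cell [simp]:
  assumes "c \<in> Mor X" "src X c = a"
  shows "vcomp X (lid_map c) (lid_cell X a) = ccomp X (lid_cell X (tgt X c)) c []"
  unfolding lid_map_def using assms by auto

lemma lid_map_unit [simp]:
  assumes "c \<in> Mor X" "f \<in> Mor X" "src X c = a" "tgt X f = a"
  shows "vcomp X (lid_map c) (ccomp X (lid_cell X a) f []) = ccomp X (lid_cell X (tgt X c)) (c \<cdot> f) []"
proof -
  have "vcomp X (lid_map c) (ccomp X (lid_cell X a) f []) =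
      ccomp X (vcomp X (lid_map c) (lid_cell X a)) f []"
    using assms by (intro vcomp_whisker[symmetric]) auto
  then show ?thesis
    using assms by auto
qed

lemma lid_map_idt [simp]:
  assumes "a \<in> Ob X"
  shows "lid_map (idt X a) = cid X (lid X a)"
  by (rule lid_cancel_unary[OF assms]) (use assms in simp_all)

text \<open>Both sides carry the unit to the unit of the last object whiskered along the composite,
  and a cell out of a loose identity is determined by its value on the unit.\<close>

lemma lid_map_cmp:
  assumes "c \<in> Mor X" "c' \<in> Mor X" "tgt X c = src X c'"
  shows "lid_map (c' \<cdot> c) = vcomp X (lid_map c') (lid_map c)"
  by (rule lid_cancel_unary[of "src X c"]) (use assms in simp_all)

text \<open>The universal case is the cell \<open>lid_mult X a\<close>: with a unit in its left slot
  both sides become \<open>lid_map c\<close>. Precomposition with \<open>\<phi>\<close> and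
  \<open>\<psi>\<close> gives the rest.\<close>

lemma lid_map_mul:
  assumes "c \<in> Mor X" "src X c = a" "\<phi> \<in> Cell X" "ccod X \<phi> = lid X a" "\<psi> \<in> Cell X" "ccod X \<psi> = lid X a"
    "rgt X \<phi> = lft X \<psi>"
  shows "vcomp X (lid_map c) (mul a \<phi> \<psi>) = mul (tgt X c) (vcomp X (lid_map c) \<phi>) (vcomp X (lid_map c) \<psi>)"
proof -
  let ?b = "tgt X c"
  have a: "a \<in> Ob X"
    using assms by auto
  have "vcomp X (lid_map c) (lid_mult X a) = mul ?b (lid_map c) (lid_map c)"
  proof (rule lid_cancel_left[OF a])
    have "bcomp (vcomp X (lid_map c) (lid_mult X a)) (lid_cell X a) (cid X (lid X a)) = lid_map c"
      using vcomp_bcomp[of "lid_map c" "lid_mult X a" "lid_cell X a" "cid X (lid X a)"] a assms by simp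
    moreover have "bcomp (mul ?b (lid_map c) (lid_map c)) (lid_cell X a) (cid X (lid X a)) = lid_map c"
      using mul_ccomp[of ?b "lid_map c" "lid_map c" "idt X a" "[lid_cell X a]" "idt X a" "[cid X (lid X a)]" "idt X a"]
        lid_map_lid_cell[of c a] vcomp_cid[of "lid_map c" "lid X a"] a assms
      by (simp add: bcomp_def vcomp_def)
    ultimately show "bcomp (vcomp X (lid_map c) (lid_mult X a)) (lid_cell X a) (cid X (lid X a)) =
      bcomp (mul ?b (lid_map c) (lid_map c)) (lid_cell X a) (cid X (lid X a))"
      by simp
  qed (use assms a in simp_all)
  then have "bcomp (vcomp X (lid_map c) (lid_mult X a)) \<phi> \<psi> = mul ?b (vcomp X (lid_map c) \<phi>) (vcomp X (lid_map c) \<psi>)"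
    using mul_bcomp[of ?b "lid_map c" "lid_map c" \<phi> \<psi>] assms by simp
  then show ?thesis
    using vcomp_bcomp[of "lid_map c" "lid_mult X a" \<phi> \<psi>] a assms by (simp add: mul_def)
qed

text \<open>The last equation trades \<open>act\<close>, which is built from restriction cells, for
  \<open>lid_map c\<close>. Later arguments use \<open>act\<close> only through its frame and this
  equation.\<close>

lemma act_simps [simp]:
  assumes "c \<in> Mor X" "f \<in> Mor X" "g \<in> Mor X" "tgt X f = src X c" "tgt X g = src X c"
  shows "act X c f g \<in> Cell X" "lft X (act X c f g) = idt X (src X f)" "cdom X (act X c f g) = [hom X f g]"
    "ccod X (act X c f g) = hom X (c \<cdot> f) (c \<cdot> g)" "rgt X (act X c f g) = idt X (src X g)"
    "vcomp X (hom_cell X (c \<cdot> f) (c \<cdot> g)) (act X c f g) = vcomp X (lid_map c) (hom_cell X f g)"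
proof -
  note r = restrict_along_cell[OF hom_restr_cell_cartesian[of c c f g], of "hom_cell X f g" "cap_unary X c", folded act_def]
  show *: "act X c f g \<in> Cell X" "lft X (act X c f g) = idt X (src X f)" "cdom X (act X c f g) = [hom X f g]"
    "ccod X (act X c f g) = hom X (c \<cdot> f) (c \<cdot> g)" "rgt X (act X c f g) = idt X (src X g)"
    using r(1) assms by (simp_all add: cell_def)
  have "vcomp X (hom_cell X (c \<cdot> f) (c \<cdot> g)) (act X c f g) =
      vcomp X (hom_cell X c c) (vcomp X (hom_restr_cell X c c f g) (act X c f g))"
    using * assms by simp
  also have "vcomp X (hom_restr_cell X c c f g) (act X c f g) = vcomp X (cap_unary X c) (hom_cell X f g)"
    using r(2) assms by simp
  finally show "vcomp X (hom_cell X (c \<cdot> f) (c \<cdot> g)) (act X c f g) = vcomp X (lid_map c) (hom_cell X f g)"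
    using assms by (simp add: lid_map_def)
qed

section \<open>Composition of homs\<close>

lemma hom_mult_simps [simp]:
  assumes "f \<in> Mor X" "g \<in> Mor X" "h \<in> Mor X" "tgt X g = tgt X f" "tgt X h = tgt X f"
  shows "hom_mult X f g h \<in> Cell X" "lft X (hom_mult X f g h) = idt X (src X f)"
    "cdom X (hom_mult X f g h) = [hom X f g, hom X g h]" "ccod X (hom_mult X f g h) = hom X f h"
    "rgt X (hom_mult X f g h) = idt X (src X h)"
    "vcomp X (hom_cell X f h) (hom_mult X f g h) = mul (tgt X f) (hom_cell X f g) (hom_cell X g h)"
proof -
  have "ccomp X (lid_mult X (tgt X f)) f [hom_cell X f g, hom_cell X g h] = mul (tgt X f) (hom_cell X f g) (hom_cell X g h)"
    using assms by (simp add: mul_def bcomp_def)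
  then show "hom_mult X f g h \<in> Cell X" "lft X (hom_mult X f g h) = idt X (src X f)"
    "cdom X (hom_mult X f g h) = [hom X f g, hom X g h]" "ccod X (hom_mult X f g h) = hom X f h"
    "rgt X (hom_mult X f g h) = idt X (src X h)"
    "vcomp X (hom_cell X f h) (hom_mult X f g h) = mul (tgt X f) (hom_cell X f g) (hom_cell X g h)"
    unfolding hom_mult_def using assms by simp_all
qed

lemma hom_mult_bcomp:
  assumes "f \<in> Mor X" "g \<in> Mor X" "h \<in> Mor X" "tgt X g = tgt X f" "tgt X h = tgt X f"
    "\<alpha> \<in> Cell X" "ccod X \<alpha> = hom X f g" "\<beta> \<in> Cell X" "ccod X \<beta> = hom X g h" "rgt X \<alpha> = lft X \<beta>"
  shows "vcomp X (hom_cell X f h) (bcomp (hom_mult X f g h) \<alpha> \<beta>) =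
    mul (tgt X f) (vcomp X (hom_cell X f g) \<alpha>) (vcomp X (hom_cell X g h) \<beta>)"
  using vcomp_bcomp[of "hom_cell X f h" "hom_mult X f g h" \<alpha> \<beta>]
    mul_bcomp[of "tgt X f" "hom_cell X f g" "hom_cell X g h" \<alpha> \<beta>] assms by simp

text \<open>For a 2-cell from \<open>f\<close> to \<open>g\<close>, given as a nullary cell into
  \<open>hom X f g\<close>, this is the same 2-cell as a nullary cell into the loose identity with
  sides \<open>f\<close> and \<open>g\<close>. In this form composability is an equality of sides,
  as \<open>mul\<close> requires.\<close>

definition paste :: "'t \<Rightarrow> 't \<Rightarrow> 'c \<Rightarrow> 'c" where
  "paste f g \<alpha> = vcomp X (hom_cell X f g) \<alpha>"

lemma tcell_simps:
  assumes "tcell X \<alpha> f g"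
  shows "\<alpha> \<in> Cell X" "lft X \<alpha> = idt X (src X f)" "cdom X \<alpha> = []" "ccod X \<alpha> = hom X f g"
    "rgt X \<alpha> = idt X (src X f)" "f \<in> Mor X" "g \<in> Mor X" "tgt X g = tgt X f" "src X g = src X f"
  using assms by (auto simp: tcell_def cell_def)

lemma paste_simps:
  assumes "tcell X \<alpha> f g"
  shows "paste f g \<alpha> \<in> Cell X" "lft X (paste f g \<alpha>) = f" "cdom X (paste f g \<alpha>) = []"
    "ccod X (paste f g \<alpha>) = lid X (tgt X f)" "rgt X (paste f g \<alpha>) = g"
  unfolding paste_def using tcell_simps[OF assms] by simp_all

lemma paste_cancel:
  assumes "tcell X \<alpha> f g" "tcell X \<beta> f g" "paste f g \<alpha> = paste f g \<beta>"
  shows "\<alpha> = \<beta>"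
  by (rule hom_cancel[of f g]) (use assms tcell_simps[OF assms(1)] tcell_simps[OF assms(2)] in \<open>simp_all add: paste_def\<close>)

lemma tcell_cap: "f \<in> Mor X \<Longrightarrow> tcell X (cap X f) f f"
  by (simp add: tcell_def cell_def)

lemma paste_cap: "f \<in> Mor X \<Longrightarrow> paste f f (cap X f) = ccomp X (lid_cell X (tgt X f)) f []"
  by (simp add: paste_def)

text \<open>The factors change places: \<open>tcomp\<close> is written in applicative order, while
  \<open>mul\<close> follows the chain from left to right.\<close>

lemma tcell_tcomp:
  assumes "tcell X \<alpha> f g" "tcell X \<beta> g h"
  shows "tcell X (tcomp X f g h \<beta> \<alpha>) f h"
    and "paste f h (tcomp X f g h \<beta> \<alpha>) = mul (tgt X f) (paste f g \<alpha>) (paste g h \<beta>)"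
proof -
  note s = tcell_simps[OF assms(1)] tcell_simps[OF assms(2)]
  have *: "tcomp X f g h \<beta> \<alpha> = bcomp (hom_mult X f g h) \<alpha> \<beta>"
    using s by (simp add: tcomp_def bcomp_def)
  show "tcell X (tcomp X f g h \<beta> \<alpha>) f h"
    using s by (simp add: * tcell_def cell_def)
  show "paste f h (tcomp X f g h \<beta> \<alpha>) = mul (tgt X f) (paste f g \<alpha>) (paste g h \<beta>)"
    unfolding * paste_def by (rule hom_mult_bcomp) (use s in simp_all)
qed

text \<open>The restriction cell in the definition is absorbed by pasting, and what remains is
  nullary precomposition with \<open>k\<close>. Dually, whiskering by \<open>c\<close> on the other
  side becomes postcomposition with \<open>lid_map c\<close>.\<close>

lemma tcell_whisker_right:
  assumes "tcell X \<alpha> f g" "k \<in> Mor X" "tgt X k = src X f"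
  shows "tcell X (whisker_right X f g \<alpha> k) (f \<cdot> k) (g \<cdot> k)"
    and "paste (f \<cdot> k) (g \<cdot> k) (whisker_right X f g \<alpha> k) = ccomp X (paste f g \<alpha>) k []"
proof -
  note s = tcell_simps[OF assms(1)]
  note r = cart_fac_cell[OF hom_restr_cell_cartesian[of f g k k], of "ccomp X \<alpha> k []"
    "idt X (src X k)" "idt X (src X k)", folded whisker_right_def]
  have *: "cell X (whisker_right X f g \<alpha> k) (idt X (src X k)) [] (hom X (f \<cdot> k) (g \<cdot> k)) (idt X (src X k))"
    using r(1) s assms by simp
  then show "tcell X (whisker_right X f g \<alpha> k) (f \<cdot> k) (g \<cdot> k)"
    using s assms by (simp add: tcell_def)
  have **: "vcomp X (hom_restr_cell X f g k k) (whisker_right X f g \<alpha> k) = ccomp X \<alpha> k []"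
    using r(2) s assms by simp
  have "paste (f \<cdot> k) (g \<cdot> k) (whisker_right X f g \<alpha> k) =
      vcomp X (hom_cell X f g) (vcomp X (hom_restr_cell X f g k k) (whisker_right X f g \<alpha> k))"
    using * s assms by (simp add: paste_def cell_def)
  then show "paste (f \<cdot> k) (g \<cdot> k) (whisker_right X f g \<alpha> k) = ccomp X (paste f g \<alpha>) k []"
    unfolding ** using s assms by (simp add: paste_def)
qed

lemma tcell_whisker_left:
  assumes "tcell X \<alpha> f g" "c \<in> Mor X" "tgt X f = src X c"
  shows "tcell X (whisker_left X c f g \<alpha>) (c \<cdot> f) (c \<cdot> g)"
    and "paste (c \<cdot> f) (c \<cdot> g) (whisker_left X c f g \<alpha>) = vcomp X (lid_map c) (paste f g \<alpha>)"
proof -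
  note s = tcell_simps[OF assms(1)]
  show "tcell X (whisker_left X c f g \<alpha>) (c \<cdot> f) (c \<cdot> g)"
    using s assms by (simp add: tcell_def cell_def whisker_left_def)
  have "paste (c \<cdot> f) (c \<cdot> g) (whisker_left X c f g \<alpha>) =
      vcomp X (vcomp X (hom_cell X (c \<cdot> f) (c \<cdot> g)) (act X c f g)) \<alpha>"
    unfolding paste_def whisker_left_def by (rule vcomp_assoc[symmetric]) (use s assms in simp_all)
  also have "vcomp X (hom_cell X (c \<cdot> f) (c \<cdot> g)) (act X c f g) = vcomp X (lid_map c) (hom_cell X f g)"
    using s assms by simp
  finally show "paste (c \<cdot> f) (c \<cdot> g) (whisker_left X c f g \<alpha>) = vcomp X (lid_map c) (paste f g \<alpha>)"
    using s assms by (simp add: paste_def)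
qed

end


section \<open>Relative adjunctions and their morphisms\<close>

context virtual_equipment
begin

lemma rel_adj_simps:
  assumes "rel_adj X j R"
  shows "j \<in> Mor X" "ladj R \<in> Mor X" "radj R \<in> Mor X" "src X (ladj R) = src X j"
    "src X (radj R) = apex X R" "tgt X (radj R) = tgt X j"
    "sharp R \<in> Cell X" "lft X (sharp R) = idt X (src X j)" "cdom X (sharp R) = [hom X (ladj R) (idt X (apex X R))]"
    "ccod X (sharp R) = hom X j (radj R)" "rgt X (sharp R) = idt X (apex X R)"
    "flat R \<in> Cell X" "lft X (flat R) = idt X (src X j)" "cdom X (flat R) = [hom X j (radj R)]"
    "ccod X (flat R) = hom X (ladj R) (idt X (apex X R))" "rgt X (flat R) = idt X (apex X R)"
    "vcomp X (flat R) (sharp R) = cid X (hom X (ladj R) (idt X (apex X R)))"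
    "vcomp X (sharp R) (flat R) = cid X (hom X j (radj R))"
  using assms by (auto simp: rel_adj_def arrow_def cell_def Let_def)

text \<open>The isomorphism \<open>C(\<ell>,1) \<cong> D(j,r)\<close> as a transposition of cells \<open>\<phi>\<close> into \<open>C(1,1)\<close> with left
  tight-cell \<open>\<ell>u\<close> to cells into \<open>D(1,1)\<close> with left tight-cell \<open>ju\<close>.\<close>

definition transp :: "'t \<Rightarrow> ('t, 'c) relative_adjunction \<Rightarrow> 't \<Rightarrow> 'c \<Rightarrow> 'c" where
  "transp j R u \<phi> = vcomp X (vcomp X (hom_cell X j (radj R)) (sharp R))
     (cart_fac X (hom_cell X (ladj R) (idt X (apex X R))) u \<phi> (rgt X \<phi>))"

lemma transp_simps:
  assumes "rel_adj X j R" "\<phi> \<in> Cell X" "ccod X \<phi> = lid X (apex X R)" "u \<in> Mor X" "tgt X u = src X j"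
    "lft X \<phi> = ladj R \<cdot> u"
  shows "transp j R u \<phi> \<in> Cell X" "lft X (transp j R u \<phi>) = j \<cdot> u" "cdom X (transp j R u \<phi>) = cdom X \<phi>"
    "ccod X (transp j R u \<phi>) = lid X (tgt X j)" "rgt X (transp j R u \<phi>) = radj R \<cdot> rgt X \<phi>"
  unfolding transp_def using rel_adj_simps[OF assms(1)] by (simp_all add: assms(2-))

text \<open>The link between the cell \<open>sharp R\<close> and the operation
  \<open>transp\<close>: if the argument is given as a composite with the hom cell, the
  factorisation chosen by \<open>cart_fac\<close> is \<open>\<chi>\<close> itself.\<close>

lemma transp_hom_cell:
  assumes "rel_adj X j R" "\<chi> \<in> Cell X" "ccod X \<chi> = hom X (ladj R) (idt X (apex X R))"
  shows "transp j R (lft X \<chi>) (vcomp X (hom_cell X (ladj R) (idt X (apex X R))) \<chi>) =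
    vcomp X (vcomp X (hom_cell X j (radj R)) (sharp R)) \<chi>"
proof -
  note s = rel_adj_simps[OF assms(1)]
  have "tgt X (rgt X \<chi>) = apex X R" "tgt X (lft X \<chi>) = src X j"
    by (simp_all add: s assms)
  then have "cart_fac X (hom_cell X (ladj R) (idt X (apex X R))) (lft X \<chi>)
      (vcomp X (hom_cell X (ladj R) (idt X (apex X R))) \<chi>) (rgt X \<chi>) = \<chi>"
    using s assms by (intro hom_cancel[of "ladj R" "idt X (apex X R)"
      "cart_fac X (hom_cell X (ladj R) (idt X (apex X R))) (lft X \<chi>)
        (vcomp X (hom_cell X (ladj R) (idt X (apex X R))) \<chi>) (rgt X \<chi>)" \<chi>]) simp_all
  then show ?thesis
    by (simp add: s assms transp_def)
qed

text \<open>To transpose is to factor through a cartesian cell and to postcompose, and both commute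
  with precomposition. Only the parameter \<open>u\<close> has to be updated.\<close>

lemma transp_vcomp:
  assumes "rel_adj X j R" "\<phi> \<in> Cell X" "ccod X \<phi> = lid X (apex X R)" "u \<in> Mor X" "tgt X u = src X j"
    "lft X \<phi> = ladj R \<cdot> u" "\<chi> \<in> Cell X" "cdom X \<phi> = [ccod X \<chi>]"
  shows "vcomp X (transp j R u \<phi>) \<chi> = transp j R (u \<cdot> lft X \<chi>) (vcomp X \<phi> \<chi>)"
proof -
  note s = rel_adj_simps[OF assms(1)]
  let ?f = "cart_fac X (hom_cell X (ladj R) (idt X (apex X R))) u \<phi> (rgt X \<phi>)"
  have f: "?f \<in> Cell X" "lft X ?f = u" "cdom X ?f = [ccod X \<chi>]" "ccod X ?f = hom X (ladj R) (idt X (apex X R))"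
    "vcomp X (hom_cell X (ladj R) (idt X (apex X R))) ?f = \<phi>"
    by (simp_all add: s assms)
  have "vcomp X (transp j R u \<phi>) \<chi> = vcomp X (vcomp X (hom_cell X j (radj R)) (sharp R)) (vcomp X ?f \<chi>)"
    unfolding transp_def by (simp add: s f(1-4) assms(7))
  also have "\<dots> = transp j R (lft X (vcomp X ?f \<chi>)) (vcomp X (hom_cell X (ladj R) (idt X (apex X R))) (vcomp X ?f \<chi>))"
    by (rule transp_hom_cell[OF assms(1), symmetric]) (simp_all add: f(1-4) assms(7))
  also have "vcomp X (hom_cell X (ladj R) (idt X (apex X R))) (vcomp X ?f \<chi>) =
      vcomp X (vcomp X (hom_cell X (ladj R) (idt X (apex X R))) ?f) \<chi>"
    using s f(1-4) assms(7) by (intro vcomp_assoc[symmetric]) auto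
  finally show ?thesis
    by (simp add: f assms(7))
qed

lemma transp_whisker:
  assumes "rel_adj X j R" "\<phi> \<in> Cell X" "ccod X \<phi> = lid X (apex X R)" "u \<in> Mor X" "tgt X u = src X j"
    "lft X \<phi> = ladj R \<cdot> u" "cdom X \<phi> = []" "h \<in> Mor X" "tgt X h = src X u"
  shows "ccomp X (transp j R u \<phi>) h [] = transp j R (u \<cdot> h) (ccomp X \<phi> h [])"
proof -
  note s = rel_adj_simps[OF assms(1)]
  let ?f = "cart_fac X (hom_cell X (ladj R) (idt X (apex X R))) u \<phi> (rgt X \<phi>)"
  have f: "?f \<in> Cell X" "lft X ?f = u" "cdom X ?f = []" "ccod X ?f = hom X (ladj R) (idt X (apex X R))"
    "vcomp X (hom_cell X (ladj R) (idt X (apex X R))) ?f = \<phi>"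
    by (simp_all add: s assms)
  have "ccomp X (transp j R u \<phi>) h [] = vcomp X (vcomp X (hom_cell X j (radj R)) (sharp R)) (ccomp X ?f h [])"
    unfolding transp_def by (simp add: s f(1-4) assms(4,5,8,9))
  also have "\<dots> = transp j R (lft X (ccomp X ?f h [])) (vcomp X (hom_cell X (ladj R) (idt X (apex X R))) (ccomp X ?f h []))"
    by (rule transp_hom_cell[OF assms(1), symmetric]) (simp_all add: f(1-4) assms(8,9))
  also have "vcomp X (hom_cell X (ladj R) (idt X (apex X R))) (ccomp X ?f h []) =
      ccomp X (vcomp X (hom_cell X (ladj R) (idt X (apex X R))) ?f) h []"
    using s f(1-4) assms(8,9) by (intro vcomp_whisker[symmetric]) auto
  finally show ?thesis
    by (simp add: f assms(8,9))
qed

text \<open>Naturality in the right tight-cell.  The loose identity being opcartesian, it suffices to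
  compare both sides after inserting the unit of \<open>C(1,1)\<close>.\<close>

lemma transp_mul:
  assumes "rel_adj X j R" "\<phi> \<in> Cell X" "ccod X \<phi> = lid X (apex X R)" "u \<in> Mor X" "tgt X u = src X j"
    "lft X \<phi> = ladj R \<cdot> u" "\<beta> \<in> Cell X" "ccod X \<beta> = lid X (apex X R)" "rgt X \<phi> = lft X \<beta>"
  shows "transp j R u (mul (apex X R) \<phi> \<beta>) = mul (tgt X j) (transp j R u \<phi>) (vcomp X (lid_map (radj R)) \<beta>)"
proof -
  note s = rel_adj_simps[OF assms(1)]
  let ?C = "apex X R" and ?l = "ladj R" and ?r = "radj R"
  let ?h = "hom_cell X ?l (idt X ?C)" and ?p = "hom X ?l (idt X ?C)"
  let ?i = "cid X (lid X ?C)" and ?e = "lid_cell X ?C"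
  let ?s = "vcomp X (hom_cell X j ?r) (sharp R)"
  let ?f = "cart_fac X ?h u \<phi> (rgt X \<phi>)"
  \<comment> \<open>The right action C(\<ell>,1), C(1,1) \<Rightarrow> C(\<ell>,1), which is the
    universal instance of multiplying a cell into the hom by some \<open>\<beta>\<close> on the
    right.\<close>
  define M where "M = cart_fac X ?h (idt X (src X j)) (mul ?C ?h ?i) (idt X ?C)"
  have M: "M \<in> Cell X" "lft X M = idt X (src X j)" "cdom X M = [?p, lid X ?C]" "ccod X M = ?p"
    "rgt X M = idt X ?C" "vcomp X ?h M = mul ?C ?h ?i"
    unfolding M_def by (simp_all add: s)
  have f: "?f \<in> Cell X" "lft X ?f = u" "cdom X ?f = cdom X \<phi>" "ccod X ?f = ?p" "rgt X ?f = rgt X \<phi>"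
    "vcomp X ?h ?f = \<phi>"
    by (simp_all add: s assms)
  have hM: "vcomp X ?h (bcomp M \<chi> \<chi>') = mul ?C (vcomp X ?h \<chi>) \<chi>'"
    if "\<chi> \<in> Cell X" "ccod X \<chi> = ?p" "\<chi>' \<in> Cell X" "ccod X \<chi>' = lid X ?C" "rgt X \<chi> = lft X \<chi>'" for \<chi> \<chi>'
    using vcomp_bcomp[of ?h M \<chi> \<chi>'] mul_bcomp[of ?C ?h ?i \<chi> \<chi>'] that by (simp add: M s)
  \<comment> \<open>Naturality for the universal instance. The unit is inserted in the second slot,
    where it is neutral for the action on the left-hand side and for \<open>mul\<close> on the
    right-hand side.\<close>
  have sM: "vcomp X ?s M = mul (tgt X j) ?s (lid_map ?r)"
  proof (rule lid_cancel_right[of ?C _ ?p])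
    have "bcomp M (cid X ?p) ?e = cid X ?p"
    proof (rule hom_cancel[of ?l "idt X ?C"])
      have "mul ?C ?h ?e = ?h"
        using mul_unit_right[of ?C ?h "idt X ?C"] by (simp add: s)
      then show "vcomp X ?h (bcomp M (cid X ?p) ?e) = vcomp X ?h (cid X ?p)"
        using hM[of "cid X ?p" ?e] by (simp add: s)
    qed (simp_all add: s M)
    then have "bcomp (vcomp X ?s M) (cid X ?p) ?e = ?s"
      using vcomp_bcomp[of ?s M "cid X ?p" ?e] by (simp add: s M)
    moreover have "bcomp (mul (tgt X j) ?s (lid_map ?r)) (cid X ?p) ?e = ?s"
      using mul_bcomp[of "tgt X j" ?s "lid_map ?r" "cid X ?p" ?e] vcomp_cid[of ?s ?p] mul_unit_right[of "tgt X j" ?s ?r] by (simp add: s)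
    ultimately show "bcomp (vcomp X ?s M) (cid X ?p) ?e = bcomp (mul (tgt X j) ?s (lid_map ?r)) (cid X ?p) ?e"
      by simp
  qed (simp_all add: s M)
  \<comment> \<open>The general case arises by substituting the factorisation of
    \<open>\<phi>\<close> and the cell \<open>\<beta>\<close> into the two slots of
    \<open>M\<close>.\<close>
  have "transp j R u (mul ?C \<phi> \<beta>) = transp j R (lft X (bcomp M ?f \<beta>)) (vcomp X ?h (bcomp M ?f \<beta>))"
    using hM[of ?f \<beta>] M f assms by simp
  also have "\<dots> = vcomp X ?s (bcomp M ?f \<beta>)"
    by (rule transp_hom_cell[OF assms(1)]) (simp_all add: s M assms)
  also have "\<dots> = bcomp (vcomp X ?s M) ?f \<beta>"
    by (rule vcomp_bcomp[symmetric]) (simp_all add: s M assms)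
  also have "\<dots> = mul (tgt X j) (vcomp X ?s ?f) (vcomp X (lid_map ?r) \<beta>)"
    unfolding sM by (rule mul_bcomp) (simp_all add: s M assms)
  finally show ?thesis
    by (simp add: transp_def)
qed

section \<open>Restricted isomorphisms and the unit\<close>

lemma sharp_at_simps:
  assumes "rel_adj X j R" "c \<in> Mor X" "tgt X c = apex X R"
  shows "sharp_at X j R c \<in> Cell X" "lft X (sharp_at X j R c) = idt X (src X j)"
    "cdom X (sharp_at X j R c) = [hom X (ladj R) c]" "ccod X (sharp_at X j R c) = hom X j (radj R \<cdot> c)"
    "rgt X (sharp_at X j R c) = idt X (src X c)"
  unfolding sharp_at_def using rel_adj_simps[OF assms(1)] by (simp_all add: assms(2-))

text \<open>The restriction along \<open>c\<close> disappears under pasting: all the cells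
  \<sharp>(1,c) induce the one operation \<open>transp j R\<close>.\<close>

lemma sharp_at_transp:
  assumes "rel_adj X j R" "c \<in> Mor X" "tgt X c = apex X R" "\<chi> \<in> Cell X" "ccod X \<chi> = hom X (ladj R) c"
  shows "vcomp X (hom_cell X j (radj R \<cdot> c)) (vcomp X (sharp_at X j R c) \<chi>) =
    transp j R (lft X \<chi>) (vcomp X (hom_cell X (ladj R) c) \<chi>)"
proof -
  note s = rel_adj_simps[OF assms(1)] sharp_at_simps[OF assms(1-3)]
  let ?h = "hom_cell X (ladj R) (idt X (apex X R))"
  let ?\<kappa> = "hom_restr_cell X (ladj R) (idt X (apex X R)) (idt X (src X j)) c"
  have \<kappa>: "?\<kappa> \<in> Cell X" "lft X ?\<kappa> = idt X (src X j)" "cdom X ?\<kappa> = [hom X (ladj R) c]"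
    "ccod X ?\<kappa> = hom X (ladj R) (idt X (apex X R))"
    by (simp_all add: s assms)
  have \<chi>: "tgt X (lft X \<chi>) = src X j"
    by (simp add: s assms)
  have *: "vcomp X (hom_cell X (j \<cdot> idt X (src X j)) (radj R \<cdot> c)) (sharp_at X j R c) =
      vcomp X (hom_cell X j (radj R)) (vcomp X (sharp R) ?\<kappa>)"
    unfolding sharp_at_def by (rule hom_restrict_hom_cell) (simp_all add: s assms)
  have "vcomp X (hom_cell X j (radj R \<cdot> c)) (vcomp X (sharp_at X j R c) \<chi>) =
      vcomp X (vcomp X (hom_cell X j (radj R \<cdot> c)) (sharp_at X j R c)) \<chi>"
    by (rule vcomp_assoc[symmetric]) (simp_all add: s assms)
  also have "vcomp X (hom_cell X j (radj R \<cdot> c)) (sharp_at X j R c) =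
      vcomp X (hom_cell X j (radj R)) (vcomp X (sharp R) ?\<kappa>)"
    using * by (simp add: s)
  also have "vcomp X \<dots> \<chi> = vcomp X (vcomp X (hom_cell X j (radj R)) (sharp R)) (vcomp X ?\<kappa> \<chi>)"
    by (simp add: s \<kappa> assms)
  also have "\<dots> = transp j R (lft X (vcomp X ?\<kappa> \<chi>)) (vcomp X ?h (vcomp X ?\<kappa> \<chi>))"
    by (rule transp_hom_cell[OF assms(1), symmetric]) (simp_all add: \<kappa> assms)
  also have "vcomp X ?h (vcomp X ?\<kappa> \<chi>) = vcomp X (hom_cell X (ladj R) c) \<chi>"
    using hom_restr_cell_vcomp[of "ladj R" "idt X (apex X R)" "idt X (src X j)" c \<chi>] by (simp add: s assms)
  finally show ?thesis
    by (simp add: \<kappa> \<chi> assms)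
qed

lemma unit_tcell:
  assumes "rel_adj X j R"
  shows "tcell X (unit X j R) j (radj R \<cdot> ladj R)"
    and "paste j (radj R \<cdot> ladj R) (unit X j R) =
      transp j R (idt X (src X j)) (ccomp X (lid_cell X (apex X R)) (ladj R) [])"
proof -
  note s = rel_adj_simps[OF assms(1)] sharp_at_simps[OF assms(1), of "ladj R"]
  show "tcell X (unit X j R) j (radj R \<cdot> ladj R)"
    by (simp add: s tcell_def cell_def unit_def)
  show "paste j (radj R \<cdot> ladj R) (unit X j R) =
      transp j R (idt X (src X j)) (ccomp X (lid_cell X (apex X R)) (ladj R) [])"
    unfolding paste_def unit_def using sharp_at_transp[OF assms, of "ladj R" "cap X (ladj R)"] by (simp add: s)
qed

section \<open>Transposition criteria for morphisms\<close>

text \<open>A Yoneda argument: the equation between cells out of C(\<ell>,1) is the case where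
  \<open>\<phi>\<close> is the hom cell and \<open>u\<close> an identity, and every other
  \<open>\<phi>\<close> arises from this one by precomposition.\<close>

lemma left_mor_iff:
  "left_mor X j R\<^sub>1 R\<^sub>2 (c, \<nu>) \<longleftrightarrow>
    rel_adj X j R\<^sub>1 \<and> rel_adj X j R\<^sub>2 \<and> arrow X c (apex X R\<^sub>1) (apex X R\<^sub>2) \<and> radj R\<^sub>1 = radj R\<^sub>2 \<cdot> c \<and>
    tcell X \<nu> (ladj R\<^sub>2) (c \<cdot> ladj R\<^sub>1) \<and>
    (\<forall>u \<phi>. \<phi> \<in> Cell X \<and> ccod X \<phi> = lid X (apex X R\<^sub>1) \<and> u \<in> Mor X \<and> tgt X u = src X j \<and>
        lft X \<phi> = ladj R\<^sub>1 \<cdot> u \<longrightarrow>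
      transp j R\<^sub>1 u \<phi> = transp j R\<^sub>2 u (mul (apex X R\<^sub>2)
        (ccomp X (paste (ladj R\<^sub>2) (c \<cdot> ladj R\<^sub>1) \<nu>) u []) (vcomp X (lid_map c) \<phi>)))"
  (is "_ \<longleftrightarrow> ?A \<and> ?B \<and> ?C \<and> ?D \<and> ?E \<and> ?F")
\<comment> \<open>Both sides contain the same frame conditions; once these are granted only the
  final equation is at issue.\<close>
proof (cases "?A \<and> ?B \<and> ?C \<and> ?D \<and> ?E")
  case False
  then show ?thesis by (auto simp: left_mor_def)
next
  case True
  then have A: ?A and B: ?B and C: ?C and D: ?D and E: ?E by auto
  note s = rel_adj_simps[OF A] sharp_at_simps[OF B, of c]
  note t = rel_adj_simps[OF B] C[unfolded arrow_def] tcell_simps[OF E] paste_simps[OF E]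
  let ?l = "ladj R\<^sub>1" and ?m = "ladj R\<^sub>2" and ?i = "idt X (apex X R\<^sub>1)"
  let ?n = "paste ?m (c \<cdot> ?l) \<nu>" and ?h = "hom_cell X ?l ?i"
  let ?s = "vcomp X (hom_cell X j (radj R\<^sub>1)) (sharp R\<^sub>1)"
  let ?T = "vcomp X (hom_contra X ?m (c \<cdot> ?l) \<nu> c) (act X c ?l ?i)"
  let ?M = "mul (apex X R\<^sub>2) ?n (vcomp X (lid_map c) ?h)"
  have "vcomp X (hom_cell X (c \<cdot> ?l) (c \<cdot> ?i)) (act X c ?l ?i) = vcomp X (lid_map c) ?h"
    by (rule act_simps(6)) (simp_all add: s t)
  then have act: "act X c ?l ?i \<in> Cell X" "lft X (act X c ?l ?i) = idt X (src X j)" "cdom X (act X c ?l ?i) = [hom X ?l ?i]"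
    "ccod X (act X c ?l ?i) = hom X (c \<cdot> ?l) c" "rgt X (act X c ?l ?i) = ?i"
    "vcomp X (hom_cell X (c \<cdot> ?l) c) (act X c ?l ?i) = vcomp X (lid_map c) ?h"
    by (simp_all add: s t)
  have con: "hom_contra X ?m (c \<cdot> ?l) \<nu> c = bcomp (hom_mult X ?m (c \<cdot> ?l) c) \<nu> (cid X (hom X (c \<cdot> ?l) c))"
    by (simp add: s t hom_contra_def bcomp_def)
  have con_simps: "hom_contra X ?m (c \<cdot> ?l) \<nu> c \<in> Cell X" "lft X (hom_contra X ?m (c \<cdot> ?l) \<nu> c) = idt X (src X j)"
    "cdom X (hom_contra X ?m (c \<cdot> ?l) \<nu> c) = [hom X (c \<cdot> ?l) c]" "ccod X (hom_contra X ?m (c \<cdot> ?l) \<nu> c) = hom X ?m c"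
    "rgt X (hom_contra X ?m (c \<cdot> ?l) \<nu> c) = ?i"
    unfolding con by (simp_all add: s t)
  have hcon: "vcomp X (hom_cell X ?m c) (hom_contra X ?m (c \<cdot> ?l) \<nu> c) = mul (apex X R\<^sub>2) ?n (hom_cell X (c \<cdot> ?l) c)"
    unfolding con using hom_mult_bcomp[of ?m "c \<cdot> ?l" c \<nu> "cid X (hom X (c \<cdot> ?l) c)"] by (simp add: s t paste_def)
  have "vcomp X (hom_cell X ?m c) ?T = vcomp X (vcomp X (hom_cell X ?m c) (hom_contra X ?m (c \<cdot> ?l) \<nu> c)) (act X c ?l ?i)"
    by (rule vcomp_assoc[symmetric]) (simp_all add: s t act con_simps)
  also have "\<dots> = mul (apex X R\<^sub>2) (ccomp X ?n (idt X (src X j)) []) (vcomp X (hom_cell X (c \<cdot> ?l) c) (act X c ?l ?i))"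
    unfolding hcon using mul_vcomp_nullary_left[of "apex X R\<^sub>2" ?n "hom_cell X (c \<cdot> ?l) c" "act X c ?l ?i"] by (simp add: s t act)
  also have "\<dots> = ?M"
    by (simp add: s t act)
  finally have T: "vcomp X (hom_cell X ?m c) ?T = ?M" .
  \<comment> \<open>By the equation \<open>radj R\<^sub>1 = radj R\<^sub>2 \<cdot> c\<close> both
    sides of the defining equation end in the same hom, so one hom cell pastes both.\<close>
  have "vcomp X (hom_cell X j (radj R\<^sub>1)) (vcomp X (sharp_at X j R\<^sub>2 c) ?T) = transp j R\<^sub>2 (lft X ?T) (vcomp X (hom_cell X ?m c) ?T)"
    unfolding D by (rule sharp_at_transp[OF B]) (simp_all add: s t act con_simps)
  then have sT: "vcomp X (hom_cell X j (radj R\<^sub>1)) (vcomp X (sharp_at X j R\<^sub>2 c) ?T) = transp j R\<^sub>2 (idt X (src X j)) ?M"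
    unfolding T by (simp add: s t act con_simps)
  have "sharp R\<^sub>1 = vcomp X (sharp_at X j R\<^sub>2 c) ?T \<longleftrightarrow> ?s = transp j R\<^sub>2 (idt X (src X j)) ?M"
  proof
    assume *: "?s = transp j R\<^sub>2 (idt X (src X j)) ?M"
    show "sharp R\<^sub>1 = vcomp X (sharp_at X j R\<^sub>2 c) ?T"
      by (rule hom_cancel[of j "radj R\<^sub>1"]) (use * sT s t D act con_simps in simp_all)
  qed (use sT in simp)
  also have "\<dots> \<longleftrightarrow> ?F"
  proof (intro iffI allI impI)
    fix u \<phi>
    assume *: "?s = transp j R\<^sub>2 (idt X (src X j)) ?M"
    assume "\<phi> \<in> Cell X \<and> ccod X \<phi> = lid X (apex X R\<^sub>1) \<and> u \<in> Mor X \<and> tgt X u = src X j \<and> lft X \<phi> = ?l \<cdot> u"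
    then have phi: "\<phi> \<in> Cell X" "ccod X \<phi> = lid X (apex X R\<^sub>1)" "u \<in> Mor X" "tgt X u = src X j" "lft X \<phi> = ?l \<cdot> u"
      by auto
    let ?f = "cart_fac X ?h u \<phi> (rgt X \<phi>)"
    have f: "?f \<in> Cell X" "lft X ?f = u" "ccod X ?f = hom X ?l ?i" "vcomp X ?h ?f = \<phi>"
      by (simp_all add: s phi)
    have "transp j R\<^sub>1 u \<phi> = vcomp X (transp j R\<^sub>2 (idt X (src X j)) ?M) ?f"
      unfolding transp_def[of j R\<^sub>1] * ..
    also have "\<dots> = transp j R\<^sub>2 u (vcomp X ?M ?f)"
      using transp_vcomp[OF B, of ?M "idt X (src X j)" ?f] by (simp add: s t f phi)
    also have "vcomp X ?M ?f = mul (apex X R\<^sub>2) (ccomp X ?n u []) (vcomp X (lid_map c) \<phi>)"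
      using mul_vcomp_nullary_left[of "apex X R\<^sub>2" ?n "vcomp X (lid_map c) ?h" ?f] by (simp add: s t f phi)
    finally show "transp j R\<^sub>1 u \<phi> = transp j R\<^sub>2 u (mul (apex X R\<^sub>2) (ccomp X ?n u []) (vcomp X (lid_map c) \<phi>))" .
  next
    assume F: ?F
    \<comment> \<open>The factorisation of \<open>?h\<close> through itself is an identity cell, so
      its transpose is the pasted \<open>sharp R\<^sub>1\<close>.\<close>
    have "?s = transp j R\<^sub>1 (idt X (src X j)) ?h"
      using transp_hom_cell[OF A, of "cid X (hom X ?l ?i)"] vcomp_cid[of ?s "hom X ?l ?i"] by (simp add: s)
    also have "\<dots> = transp j R\<^sub>2 (idt X (src X j)) ?M"
      using F[rule_format, of ?h "idt X (src X j)"] by (simp add: s t)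
    finally show "?s = transp j R\<^sub>2 (idt X (src X j)) ?M" .
  qed
  finally show ?thesis
    using A B C D E by (simp add: left_mor_def)
qed

text \<open>The same reduction to a universal cell. Here \<open>\<rho>\<close> is attached to the
  codomain D(j,r), so it appears outside the transposition and follows the right side of
  \<open>\<phi>\<close>.\<close>

lemma right_mor_iff:
  "right_mor X j R\<^sub>1 R\<^sub>2 (c, \<rho>) \<longleftrightarrow>
    rel_adj X j R\<^sub>1 \<and> rel_adj X j R\<^sub>2 \<and> arrow X c (apex X R\<^sub>1) (apex X R\<^sub>2) \<and> c \<cdot> ladj R\<^sub>1 = ladj R\<^sub>2 \<and>
    tcell X \<rho> (radj R\<^sub>1) (radj R\<^sub>2 \<cdot> c) \<and>
    (\<forall>u \<phi>. \<phi> \<in> Cell X \<and> ccod X \<phi> = lid X (apex X R\<^sub>1) \<and> u \<in> Mor X \<and> tgt X u = src X j \<and>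
        lft X \<phi> = ladj R\<^sub>1 \<cdot> u \<longrightarrow>
      mul (tgt X j) (transp j R\<^sub>1 u \<phi>) (ccomp X (paste (radj R\<^sub>1) (radj R\<^sub>2 \<cdot> c) \<rho>) (rgt X \<phi>) []) =
      transp j R\<^sub>2 u (vcomp X (lid_map c) \<phi>))"
  (is "_ \<longleftrightarrow> ?A \<and> ?B \<and> ?C \<and> ?D \<and> ?E \<and> ?F")
proof (cases "?A \<and> ?B \<and> ?C \<and> ?D \<and> ?E")
  case False
  then show ?thesis by (auto simp: right_mor_def)
next
  case True
  then have A: ?A and B: ?B and C: ?C and D: ?D and E: ?E by auto
  note s = rel_adj_simps[OF A] sharp_at_simps[OF B, of c]
  note t = rel_adj_simps[OF B] C[unfolded arrow_def] tcell_simps[OF E] paste_simps[OF E]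
  let ?l = "ladj R\<^sub>1" and ?m = "ladj R\<^sub>2" and ?i = "idt X (apex X R\<^sub>1)"
  let ?r = "radj R\<^sub>1" and ?q = "radj R\<^sub>2 \<cdot> c"
  let ?n = "paste ?r ?q \<rho>" and ?h = "hom_cell X ?l ?i"
  let ?s = "vcomp X (hom_cell X j ?r) (sharp R\<^sub>1)"
  let ?M = "vcomp X (lid_map c) ?h" and ?co = "hom_co X j ?r ?q \<rho>"
  have "vcomp X (hom_cell X (c \<cdot> ?l) (c \<cdot> ?i)) (act X c ?l ?i) = ?M"
    by (rule act_simps(6)) (simp_all add: s t)
  then have act: "act X c ?l ?i \<in> Cell X" "lft X (act X c ?l ?i) = idt X (src X j)" "cdom X (act X c ?l ?i) = [hom X ?l ?i]"
    "ccod X (act X c ?l ?i) = hom X ?m c" "rgt X (act X c ?l ?i) = ?i"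
    "vcomp X (hom_cell X ?m c) (act X c ?l ?i) = ?M"
    by (simp_all add: s t D)
  have co: "?co = bcomp (hom_mult X j ?r ?q) (cid X (hom X j ?r)) \<rho>"
    by (simp add: s t hom_co_def bcomp_def)
  have co_simps: "?co \<in> Cell X" "lft X ?co = idt X (src X j)" "cdom X ?co = [hom X j ?r]" "ccod X ?co = hom X j ?q"
    "rgt X ?co = ?i"
    unfolding co by (simp_all add: s t)
  have hco: "vcomp X (hom_cell X j ?q) ?co = mul (tgt X j) (hom_cell X j ?r) ?n"
    unfolding co using hom_mult_bcomp[of j ?r ?q "cid X (hom X j ?r)" \<rho>] by (simp add: s t paste_def)
  have "vcomp X (hom_cell X j ?q) (vcomp X ?co (sharp R\<^sub>1)) = vcomp X (vcomp X (hom_cell X j ?q) ?co) (sharp R\<^sub>1)"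
    by (rule vcomp_assoc[symmetric]) (simp_all add: s t co_simps)
  also have "\<dots> = mul (tgt X j) ?s ?n"
    unfolding hco using mul_vcomp_nullary_right[of "tgt X j" "hom_cell X j ?r" ?n "sharp R\<^sub>1"] by (simp add: s t)
  finally have L: "vcomp X (hom_cell X j ?q) (vcomp X ?co (sharp R\<^sub>1)) = mul (tgt X j) ?s ?n" .
  have R: "vcomp X (hom_cell X j ?q) (vcomp X (sharp_at X j R\<^sub>2 c) (act X c ?l ?i)) = transp j R\<^sub>2 (idt X (src X j)) ?M"
    using sharp_at_transp[OF B, of c "act X c ?l ?i"] by (simp add: s t act)
  have "vcomp X ?co (sharp R\<^sub>1) = vcomp X (sharp_at X j R\<^sub>2 c) (act X c ?l ?i) \<longleftrightarrow>
      mul (tgt X j) ?s ?n = transp j R\<^sub>2 (idt X (src X j)) ?M"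
  proof
    assume *: "mul (tgt X j) ?s ?n = transp j R\<^sub>2 (idt X (src X j)) ?M"
    show "vcomp X ?co (sharp R\<^sub>1) = vcomp X (sharp_at X j R\<^sub>2 c) (act X c ?l ?i)"
      by (rule hom_cancel[of j ?q]) (use * L R s t act co_simps in simp_all)
  next
    assume *: "vcomp X ?co (sharp R\<^sub>1) = vcomp X (sharp_at X j R\<^sub>2 c) (act X c ?l ?i)"
    show "mul (tgt X j) ?s ?n = transp j R\<^sub>2 (idt X (src X j)) ?M"
      by (rule L[unfolded * R, symmetric])
  qed
  also have "\<dots> \<longleftrightarrow> ?F"
  proof (intro iffI allI impI)
    fix u \<phi>
    assume *: "mul (tgt X j) ?s ?n = transp j R\<^sub>2 (idt X (src X j)) ?M"
    assume "\<phi> \<in> Cell X \<and> ccod X \<phi> = lid X (apex X R\<^sub>1) \<and> u \<in> Mor X \<and> tgt X u = src X j \<and> lft X \<phi> = ?l \<cdot> u"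
    then have phi: "\<phi> \<in> Cell X" "ccod X \<phi> = lid X (apex X R\<^sub>1)" "u \<in> Mor X" "tgt X u = src X j" "lft X \<phi> = ?l \<cdot> u"
      by auto
    let ?f = "cart_fac X ?h u \<phi> (rgt X \<phi>)"
    have f: "?f \<in> Cell X" "lft X ?f = u" "ccod X ?f = hom X ?l ?i" "rgt X ?f = rgt X \<phi>" "vcomp X ?h ?f = \<phi>"
      by (simp_all add: s phi)
    have "mul (tgt X j) (transp j R\<^sub>1 u \<phi>) (ccomp X ?n (rgt X \<phi>) []) = vcomp X (mul (tgt X j) ?s ?n) ?f"
      unfolding transp_def[of j R\<^sub>1] using mul_vcomp_nullary_right[of "tgt X j" ?s ?n ?f] by (simp add: s t f(1-4))
    also have "\<dots> = transp j R\<^sub>2 u (vcomp X ?M ?f)"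
      unfolding * using transp_vcomp[OF B, of ?M "idt X (src X j)" ?f] by (simp add: s t f(1-4) phi D)
    also have "vcomp X ?M ?f = vcomp X (lid_map c) \<phi>"
      by (simp add: s t f phi)
    finally show "mul (tgt X j) (transp j R\<^sub>1 u \<phi>) (ccomp X ?n (rgt X \<phi>) []) = transp j R\<^sub>2 u (vcomp X (lid_map c) \<phi>)" .
  next
    assume F: ?F
    have "?s = transp j R\<^sub>1 (idt X (src X j)) ?h"
      using transp_hom_cell[OF A, of "cid X (hom X ?l ?i)"] vcomp_cid[of ?s "hom X ?l ?i"] by (simp add: s)
    then show "mul (tgt X j) ?s ?n = transp j R\<^sub>2 (idt X (src X j)) ?M"
      using F[rule_format, of ?h "idt X (src X j)"] by (simp add: s t)
  qed
  finally show ?thesis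
    using A B C D E by (simp add: right_mor_def)
qed

end


section \<open>The categories of relative adjunctions\<close>

context virtual_equipment
begin

section \<open>Identities and composites of morphisms\<close>

lemma left_morD:
  assumes "left_mor X j R\<^sub>1 R\<^sub>2 (c, \<nu>)"
  shows "rel_adj X j R\<^sub>1" "rel_adj X j R\<^sub>2" "c \<in> Mor X" "src X c = apex X R\<^sub>1" "tgt X c = apex X R\<^sub>2"
    "radj R\<^sub>1 = radj R\<^sub>2 \<cdot> c" "tcell X \<nu> (ladj R\<^sub>2) (c \<cdot> ladj R\<^sub>1)"
  using assms by (auto simp: left_mor_def arrow_def)

lemma left_mor_transp:
  assumes "left_mor X j R\<^sub>1 R\<^sub>2 (c, \<nu>)" "\<phi> \<in> Cell X" "ccod X \<phi> = lid X (apex X R\<^sub>1)" "u \<in> Mor X"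
    "tgt X u = src X j" "lft X \<phi> = ladj R\<^sub>1 \<cdot> u"
  shows "transp j R\<^sub>1 u \<phi> = transp j R\<^sub>2 u (mul (apex X R\<^sub>2)
    (ccomp X (paste (ladj R\<^sub>2) (c \<cdot> ladj R\<^sub>1) \<nu>) u []) (vcomp X (lid_map c) \<phi>))"
  using assms unfolding left_mor_iff by blast

lemma right_morD:
  assumes "right_mor X j R\<^sub>1 R\<^sub>2 (c, \<rho>)"
  shows "rel_adj X j R\<^sub>1" "rel_adj X j R\<^sub>2" "c \<in> Mor X" "src X c = apex X R\<^sub>1" "tgt X c = apex X R\<^sub>2"
    "c \<cdot> ladj R\<^sub>1 = ladj R\<^sub>2" "tcell X \<rho> (radj R\<^sub>1) (radj R\<^sub>2 \<cdot> c)"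
  using assms by (auto simp: right_mor_def arrow_def)

lemma right_mor_transp:
  assumes "right_mor X j R\<^sub>1 R\<^sub>2 (c, \<rho>)" "\<phi> \<in> Cell X" "ccod X \<phi> = lid X (apex X R\<^sub>1)" "u \<in> Mor X"
    "tgt X u = src X j" "lft X \<phi> = ladj R\<^sub>1 \<cdot> u"
  shows "mul (tgt X j) (transp j R\<^sub>1 u \<phi>) (ccomp X (paste (radj R\<^sub>1) (radj R\<^sub>2 \<cdot> c) \<rho>) (rgt X \<phi>) []) =
      transp j R\<^sub>2 u (vcomp X (lid_map c) \<phi>)"
  using assms unfolding right_mor_iff by blast

text \<open>Repeats the 2-cell in the composition of \<open>RAdj_L\<close> with the bracketing used
  there, so that \<open>RAdj_L_simps\<close> is a mere unfolding. The right-nested endpoints enter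
  in \<open>left_comp_tcell\<close>.\<close>

definition left_comp where
  "left_comp R\<^sub>1 R\<^sub>2 R\<^sub>3 c' \<nu>' c \<nu> =
    tcomp X (ladj R\<^sub>3) (c' \<cdot> ladj R\<^sub>2) (c' \<cdot> c \<cdot> ladj R\<^sub>1) (whisker_left X c' (ladj R\<^sub>2) (c \<cdot> ladj R\<^sub>1) \<nu>) \<nu>'"

definition right_comp where
  "right_comp R\<^sub>1 R\<^sub>2 R\<^sub>3 c' \<rho>' c \<rho> =
    tcomp X (radj R\<^sub>1) (radj R\<^sub>2 \<cdot> c) (radj R\<^sub>3 \<cdot> c' \<cdot> c) (whisker_right X (radj R\<^sub>2) (radj R\<^sub>3 \<cdot> c') \<rho>' c) \<rho>"

lemma left_comp_tcell:
  assumes "left_mor X j R\<^sub>1 R\<^sub>2 (c, \<nu>)" "left_mor X j R\<^sub>2 R\<^sub>3 (c', \<nu>')"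
  shows "tcell X (left_comp R\<^sub>1 R\<^sub>2 R\<^sub>3 c' \<nu>' c \<nu>) (ladj R\<^sub>3) (c' \<cdot> (c \<cdot> ladj R\<^sub>1))"
    and "paste (ladj R\<^sub>3) (c' \<cdot> (c \<cdot> ladj R\<^sub>1)) (left_comp R\<^sub>1 R\<^sub>2 R\<^sub>3 c' \<nu>' c \<nu>) =
      mul (apex X R\<^sub>3) (paste (ladj R\<^sub>3) (c' \<cdot> ladj R\<^sub>2) \<nu>')
        (vcomp X (lid_map c') (paste (ladj R\<^sub>2) (c \<cdot> ladj R\<^sub>1) \<nu>))"
proof -
  note f = left_morD[OF assms(1)] left_morD[OF assms(2)]
  note s = f(3-5,10-12) rel_adj_simps(1-6)[OF f(1)] rel_adj_simps(1-6)[OF f(2)] rel_adj_simps(1-6)[OF f(9)]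
  have w: "tgt X (ladj R\<^sub>2) = src X c'"
    by (simp add: s)
  have e: "c' \<cdot> c \<cdot> ladj R\<^sub>1 = c' \<cdot> (c \<cdot> ladj R\<^sub>1)"
    by (simp add: s)
  note w = tcell_whisker_left[OF f(7) f(10) w]
  show "tcell X (left_comp R\<^sub>1 R\<^sub>2 R\<^sub>3 c' \<nu>' c \<nu>) (ladj R\<^sub>3) (c' \<cdot> (c \<cdot> ladj R\<^sub>1))"
    unfolding left_comp_def e by (rule tcell_tcomp(1)[OF f(14) w(1)])
  show "paste (ladj R\<^sub>3) (c' \<cdot> (c \<cdot> ladj R\<^sub>1)) (left_comp R\<^sub>1 R\<^sub>2 R\<^sub>3 c' \<nu>' c \<nu>) =
      mul (apex X R\<^sub>3) (paste (ladj R\<^sub>3) (c' \<cdot> ladj R\<^sub>2) \<nu>')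
        (vcomp X (lid_map c') (paste (ladj R\<^sub>2) (c \<cdot> ladj R\<^sub>1) \<nu>))"
    unfolding left_comp_def e tcell_tcomp(2)[OF f(14) w(1)] w(2) ..
qed

lemma right_comp_tcell:
  assumes "right_mor X j R\<^sub>1 R\<^sub>2 (c, \<rho>)" "right_mor X j R\<^sub>2 R\<^sub>3 (c', \<rho>')"
  shows "tcell X (right_comp R\<^sub>1 R\<^sub>2 R\<^sub>3 c' \<rho>' c \<rho>) (radj R\<^sub>1) (radj R\<^sub>3 \<cdot> (c' \<cdot> c))"
    and "paste (radj R\<^sub>1) (radj R\<^sub>3 \<cdot> (c' \<cdot> c)) (right_comp R\<^sub>1 R\<^sub>2 R\<^sub>3 c' \<rho>' c \<rho>) =
      mul (tgt X j) (paste (radj R\<^sub>1) (radj R\<^sub>2 \<cdot> c) \<rho>)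
        (ccomp X (paste (radj R\<^sub>2) (radj R\<^sub>3 \<cdot> c') \<rho>') c [])"
proof -
  note f = right_morD[OF assms(1)] right_morD[OF assms(2)]
  note s = f(3-5,10-12) rel_adj_simps(1-6)[OF f(1)] rel_adj_simps(1-6)[OF f(2)] rel_adj_simps(1-6)[OF f(9)]
  have w: "tgt X c = src X (radj R\<^sub>2)"
    by (simp add: s)
  have e: "radj R\<^sub>3 \<cdot> c' \<cdot> c = radj R\<^sub>3 \<cdot> (c' \<cdot> c)"
    by (simp add: s)
  note w = tcell_whisker_right[OF f(14) f(3) w, unfolded e]
  show "tcell X (right_comp R\<^sub>1 R\<^sub>2 R\<^sub>3 c' \<rho>' c \<rho>) (radj R\<^sub>1) (radj R\<^sub>3 \<cdot> (c' \<cdot> c))"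
    unfolding right_comp_def e by (rule tcell_tcomp(1)[OF f(7) w(1)])
  show "paste (radj R\<^sub>1) (radj R\<^sub>3 \<cdot> (c' \<cdot> c)) (right_comp R\<^sub>1 R\<^sub>2 R\<^sub>3 c' \<rho>' c \<rho>) =
      mul (tgt X j) (paste (radj R\<^sub>1) (radj R\<^sub>2 \<cdot> c) \<rho>)
        (ccomp X (paste (radj R\<^sub>2) (radj R\<^sub>3 \<cdot> c') \<rho>') c [])"
    unfolding right_comp_def e tcell_tcomp(2)[OF f(7) w(1)] w(2) by (simp add: s)
qed

lemma left_mor_idt:
  assumes "rel_adj X j R"
  shows "left_mor X j R R (idt X (apex X R), cap X (ladj R))"
proof -
  note s = rel_adj_simps(1-6)[OF assms]
  show ?thesis
    unfolding left_mor_iff by (auto simp: s assms arrow_def tcell_cap paste_cap)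
qed

lemma right_mor_idt:
  assumes "rel_adj X j R"
  shows "right_mor X j R R (idt X (apex X R), cap X (radj R))"
proof -
  note s = rel_adj_simps(1-6)[OF assms]
  show ?thesis
    unfolding right_mor_iff
    using mul_unit_right[OF _ transp_simps(1,4,5)[OF assms]]
    by (auto simp: s assms arrow_def tcell_cap paste_cap)
qed

text \<open>The criterion for the first morphism turns \<open>\<phi>\<close> into a new cell with
  the same \<open>u\<close>, to which the criterion for the second is applied.\<close>

lemma left_mor_comp:
  assumes "left_mor X j R\<^sub>1 R\<^sub>2 (c, \<nu>)" "left_mor X j R\<^sub>2 R\<^sub>3 (c', \<nu>')"
  shows "left_mor X j R\<^sub>1 R\<^sub>3 (c' \<cdot> c, left_comp R\<^sub>1 R\<^sub>2 R\<^sub>3 c' \<nu>' c \<nu>)"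
  unfolding left_mor_iff
proof (intro conjI allI impI)
  note f = left_morD[OF assms(1)] left_morD[OF assms(2)]
  note s = f(3-5,10-12) rel_adj_simps(1-6)[OF f(1)] rel_adj_simps(1-6)[OF f(2)] rel_adj_simps(1-6)[OF f(9)]
  have e: "c' \<cdot> c \<cdot> ladj R\<^sub>1 = c' \<cdot> (c \<cdot> ladj R\<^sub>1)"
    by (simp add: s)
  show "rel_adj X j R\<^sub>1" "rel_adj X j R\<^sub>3"
    using f by blast+
  show "arrow X (c' \<cdot> c) (apex X R\<^sub>1) (apex X R\<^sub>3)"
    by (simp add: s arrow_def)
  show "radj R\<^sub>1 = radj R\<^sub>3 \<cdot> (c' \<cdot> c)"
    unfolding f(6,13) by (rule cmp_assoc_right) (simp_all add: s)
  show "tcell X (left_comp R\<^sub>1 R\<^sub>2 R\<^sub>3 c' \<nu>' c \<nu>) (ladj R\<^sub>3) (c' \<cdot> c \<cdot> ladj R\<^sub>1)"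
    unfolding e by (rule left_comp_tcell(1)[OF assms])
  fix u \<phi>
  assume "\<phi> \<in> Cell X \<and> ccod X \<phi> = lid X (apex X R\<^sub>1) \<and> u \<in> Mor X \<and> tgt X u = src X j \<and> lft X \<phi> = ladj R\<^sub>1 \<cdot> u"
  then have phi: "\<phi> \<in> Cell X" "ccod X \<phi> = lid X (apex X R\<^sub>1)" "u \<in> Mor X" "tgt X u = src X j" "lft X \<phi> = ladj R\<^sub>1 \<cdot> u"
    by auto
  let ?n = "paste (ladj R\<^sub>2) (c \<cdot> ladj R\<^sub>1) \<nu>" and ?m = "paste (ladj R\<^sub>3) (c' \<cdot> ladj R\<^sub>2) \<nu>'"
  note p = paste_simps[OF f(7)] paste_simps[OF f(14)]
  let ?\<psi> = "mul (apex X R\<^sub>2) (ccomp X ?n u []) (vcomp X (lid_map c) \<phi>)"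
  have "transp j R\<^sub>1 u \<phi> = transp j R\<^sub>2 u ?\<psi>"
    by (rule left_mor_transp[OF assms(1) phi])
  also have "\<dots> = transp j R\<^sub>3 u (mul (apex X R\<^sub>3) (ccomp X ?m u []) (vcomp X (lid_map c') ?\<psi>))"
    by (rule left_mor_transp[OF assms(2)]) (simp_all add: s p phi)
  \<comment> \<open>The second tight-cell acts on both factors of the intermediate cell; the part
    containing \<open>?n\<close> then joins \<open>?m\<close> to form the pasted composite
    2-cell.\<close>
  also have "vcomp X (lid_map c') ?\<psi> =
      mul (apex X R\<^sub>3) (vcomp X (lid_map c') (ccomp X ?n u [])) (vcomp X (lid_map (c' \<cdot> c)) \<phi>)"
    using lid_map_mul[of c' "apex X R\<^sub>2" "ccomp X ?n u []" "vcomp X (lid_map c) \<phi>"]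
    by (simp add: s p phi lid_map_cmp)
  also have "mul (apex X R\<^sub>3) (ccomp X ?m u []) \<dots> = mul (apex X R\<^sub>3)
      (ccomp X (mul (apex X R\<^sub>3) ?m (vcomp X (lid_map c') ?n)) u []) (vcomp X (lid_map (c' \<cdot> c)) \<phi>)"
    by (simp add: s p phi)
  finally show "transp j R\<^sub>1 u \<phi> = transp j R\<^sub>3 u (mul (apex X R\<^sub>3)
      (ccomp X (paste (ladj R\<^sub>3) (c' \<cdot> c \<cdot> ladj R\<^sub>1) (left_comp R\<^sub>1 R\<^sub>2 R\<^sub>3 c' \<nu>' c \<nu>)) u [])
      (vcomp X (lid_map (c' \<cdot> c)) \<phi>))"
    unfolding e left_comp_tcell(2)[OF assms] .
qed

lemma right_mor_comp:
  assumes "right_mor X j R\<^sub>1 R\<^sub>2 (c, \<rho>)" "right_mor X j R\<^sub>2 R\<^sub>3 (c', \<rho>')"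
  shows "right_mor X j R\<^sub>1 R\<^sub>3 (c' \<cdot> c, right_comp R\<^sub>1 R\<^sub>2 R\<^sub>3 c' \<rho>' c \<rho>)"
  unfolding right_mor_iff
proof (intro conjI allI impI)
  note f = right_morD[OF assms(1)] right_morD[OF assms(2)]
  note s = f(3-5,10-12) rel_adj_simps(1-6)[OF f(1)] rel_adj_simps(1-6)[OF f(2)] rel_adj_simps(1-6)[OF f(9)]
  have e: "c' \<cdot> c \<cdot> ladj R\<^sub>1 = c' \<cdot> (c \<cdot> ladj R\<^sub>1)"
    by (simp add: s)
  show "rel_adj X j R\<^sub>1" "rel_adj X j R\<^sub>3"
    using f by blast+
  show "arrow X (c' \<cdot> c) (apex X R\<^sub>1) (apex X R\<^sub>3)"
    by (simp add: s arrow_def)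
  show "c' \<cdot> c \<cdot> ladj R\<^sub>1 = ladj R\<^sub>3"
    unfolding e f(6,13) ..
  show "tcell X (right_comp R\<^sub>1 R\<^sub>2 R\<^sub>3 c' \<rho>' c \<rho>) (radj R\<^sub>1) (radj R\<^sub>3 \<cdot> (c' \<cdot> c))"
    by (rule right_comp_tcell(1)[OF assms])
  fix u \<phi>
  assume "\<phi> \<in> Cell X \<and> ccod X \<phi> = lid X (apex X R\<^sub>1) \<and> u \<in> Mor X \<and> tgt X u = src X j \<and> lft X \<phi> = ladj R\<^sub>1 \<cdot> u"
  then have phi: "\<phi> \<in> Cell X" "ccod X \<phi> = lid X (apex X R\<^sub>1)" "u \<in> Mor X" "tgt X u = src X j" "lft X \<phi> = ladj R\<^sub>1 \<cdot> u"
    by auto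
  let ?n = "paste (radj R\<^sub>1) (radj R\<^sub>2 \<cdot> c) \<rho>" and ?m = "paste (radj R\<^sub>2) (radj R\<^sub>3 \<cdot> c') \<rho>'"
  note p = paste_simps[OF f(7)] paste_simps[OF f(14)] transp_simps[OF f(1) phi]
  have g: "tgt X (rgt X \<phi>) = src X c"
    by (simp add: s phi)
  have h: "c \<cdot> (ladj R\<^sub>1 \<cdot> u) = ladj R\<^sub>2 \<cdot> u"
    using cmp_assoc_right[of u "ladj R\<^sub>1" c] by (simp add: s phi f(6))
  have "transp j R\<^sub>3 u (vcomp X (lid_map (c' \<cdot> c)) \<phi>) = transp j R\<^sub>3 u (vcomp X (lid_map c') (vcomp X (lid_map c) \<phi>))"
    by (simp add: s phi lid_map_cmp)
  \<comment> \<open>The second criterion is used at the image of \<open>\<phi>\<close> under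
    \<open>c\<close>. Its right side is \<open>c \<cdot> rgt X \<phi>\<close>, which is the origin
    of the whiskering along \<open>c\<close> in the composite 2-cell.\<close>
  also have "\<dots> = mul (tgt X j) (transp j R\<^sub>2 u (vcomp X (lid_map c) \<phi>))
      (ccomp X ?m (rgt X (vcomp X (lid_map c) \<phi>)) [])"
    by (rule right_mor_transp[OF assms(2), symmetric]) (simp_all add: s phi h)
  also have "rgt X (vcomp X (lid_map c) \<phi>) = c \<cdot> rgt X \<phi>"
    by (simp add: s phi)
  also have "transp j R\<^sub>2 u (vcomp X (lid_map c) \<phi>) = mul (tgt X j) (transp j R\<^sub>1 u \<phi>) (ccomp X ?n (rgt X \<phi>) [])"
    by (rule right_mor_transp[OF assms(1) phi, symmetric])
  also have "mul (tgt X j) \<dots> (ccomp X ?m (c \<cdot> rgt X \<phi>) []) =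
      mul (tgt X j) (transp j R\<^sub>1 u \<phi>) (ccomp X (mul (tgt X j) ?n (ccomp X ?m c [])) (rgt X \<phi>) [])"
    by (simp add: s p phi)
  finally show "mul (tgt X j) (transp j R\<^sub>1 u \<phi>)
      (ccomp X (paste (radj R\<^sub>1) (radj R\<^sub>3 \<cdot> (c' \<cdot> c)) (right_comp R\<^sub>1 R\<^sub>2 R\<^sub>3 c' \<rho>' c \<rho>)) (rgt X \<phi>) []) =
      transp j R\<^sub>3 u (vcomp X (lid_map (c' \<cdot> c)) \<phi>)"
    unfolding right_comp_tcell(2)[OF assms] ..
qed

section \<open>The category laws\<close>

lemma RAdj_L_simps:
  "Ob (RAdj_L X j) = {R. rel_adj X j R}"
  "src (RAdj_L X j) (R\<^sub>1, m, R\<^sub>2) = R\<^sub>1" "tgt (RAdj_L X j) (R\<^sub>1, m, R\<^sub>2) = R\<^sub>2"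
  "(R\<^sub>1, m, R\<^sub>2) \<in> Mor (RAdj_L X j) \<longleftrightarrow> left_mor X j R\<^sub>1 R\<^sub>2 m"
  "idt (RAdj_L X j) R = (R, (idt X (apex X R), cap X (ladj R)), R)"
  "cmp (RAdj_L X j) (R\<^sub>2, (c', \<nu>'), R\<^sub>3) (R\<^sub>1, (c, \<nu>), R\<^sub>2') = (R\<^sub>1, (c' \<cdot> c, left_comp R\<^sub>1 R\<^sub>2 R\<^sub>3 c' \<nu>' c \<nu>), R\<^sub>3)"
  by (simp_all add: RAdj_L_def left_comp_def)

lemma RAdj_R_simps:
  "Ob (RAdj_R X j) = {R. rel_adj X j R}"
  "src (RAdj_R X j) (R\<^sub>1, m, R\<^sub>2) = R\<^sub>1" "tgt (RAdj_R X j) (R\<^sub>1, m, R\<^sub>2) = R\<^sub>2"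
  "(R\<^sub>1, m, R\<^sub>2) \<in> Mor (RAdj_R X j) \<longleftrightarrow> right_mor X j R\<^sub>1 R\<^sub>2 m"
  "idt (RAdj_R X j) R = (R, (idt X (apex X R), cap X (radj R)), R)"
  "cmp (RAdj_R X j) (R\<^sub>2, (c', \<rho>'), R\<^sub>3) (R\<^sub>1, (c, \<rho>), R\<^sub>2') = (R\<^sub>1, (c' \<cdot> c, right_comp R\<^sub>1 R\<^sub>2 R\<^sub>3 c' \<rho>' c \<rho>), R\<^sub>3)"
  by (simp_all add: RAdj_R_def right_comp_def)

lemma RAdj_L_arrowE:
  assumes "arrow (RAdj_L X j) f R\<^sub>1 R\<^sub>2"
  obtains c \<nu> where "f = (R\<^sub>1, (c, \<nu>), R\<^sub>2)" "left_mor X j R\<^sub>1 R\<^sub>2 (c, \<nu>)"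
  using assms by (cases f) (auto simp: arrow_def RAdj_L_simps)

lemma RAdj_R_arrowE:
  assumes "arrow (RAdj_R X j) f R\<^sub>1 R\<^sub>2"
  obtains c \<rho> where "f = (R\<^sub>1, (c, \<rho>), R\<^sub>2)" "right_mor X j R\<^sub>1 R\<^sub>2 (c, \<rho>)"
  using assms by (cases f) (auto simp: arrow_def RAdj_R_simps)

text \<open>The tight-cell components obey the laws because tight-cells form a category. The 2-cell
  components are compared after pasting, where the laws become those of \<open>mul\<close>, together
  with functoriality of \<open>lid_map\<close> and its compatibility with
  \<open>mul\<close>.\<close>

lemma category_RAdj_L: "category (RAdj_L X j)"
proof
  show "src (RAdj_L X j) f \<in> Ob (RAdj_L X j)" "tgt (RAdj_L X j) f \<in> Ob (RAdj_L X j)"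
    if "f \<in> Mor (RAdj_L X j)" for f
    using that by (cases f; auto simp: RAdj_L_simps dest: left_morD)+
  show "arrow (RAdj_L X j) (idt (RAdj_L X j) R) R R" if "R \<in> Ob (RAdj_L X j)" for R
    using that by (simp add: arrow_def RAdj_L_simps left_mor_idt)
next
  fix f g R\<^sub>1 R\<^sub>2 R\<^sub>3
  assume "arrow (RAdj_L X j) f R\<^sub>1 R\<^sub>2" "arrow (RAdj_L X j) g R\<^sub>2 R\<^sub>3"
  then show "arrow (RAdj_L X j) (cmp (RAdj_L X j) g f) R\<^sub>1 R\<^sub>3"
    by (elim RAdj_L_arrowE) (simp add: arrow_def RAdj_L_simps left_mor_comp)
next
  fix f R\<^sub>1 R\<^sub>2
  assume "arrow (RAdj_L X j) f R\<^sub>1 R\<^sub>2"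
  then obtain c \<nu> where f: "f = (R\<^sub>1, (c, \<nu>), R\<^sub>2)" and m: "left_mor X j R\<^sub>1 R\<^sub>2 (c, \<nu>)"
    by (rule RAdj_L_arrowE)
  note d = left_morD[OF m]
  note i1 = left_mor_idt[OF d(1)] and i2 = left_mor_idt[OF d(2)]
  note s = d(3-5) rel_adj_simps(1-6)[OF d(1)] rel_adj_simps(1-6)[OF d(2)] paste_simps[OF d(7)]
  have "left_comp R\<^sub>1 R\<^sub>2 R\<^sub>2 (idt X (apex X R\<^sub>2)) (cap X (ladj R\<^sub>2)) c \<nu> = \<nu>"
    by (rule paste_cancel[OF _ d(7)]) (use left_comp_tcell[OF m i2] in \<open>simp_all add: s paste_cap\<close>)
  then show "cmp (RAdj_L X j) (idt (RAdj_L X j) R\<^sub>2) f = f"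
    by (simp add: f RAdj_L_simps s)
  have "left_comp R\<^sub>1 R\<^sub>1 R\<^sub>2 c \<nu> (idt X (apex X R\<^sub>1)) (cap X (ladj R\<^sub>1)) = \<nu>"
    by (rule paste_cancel[OF _ d(7)]) (use left_comp_tcell[OF i1 m] in \<open>simp_all add: s paste_cap\<close>)
  then show "cmp (RAdj_L X j) f (idt (RAdj_L X j) R\<^sub>1) = f"
    by (simp add: f RAdj_L_simps s)
next
  fix f g h R\<^sub>1 R\<^sub>2 R\<^sub>3 R\<^sub>4
  assume "arrow (RAdj_L X j) f R\<^sub>1 R\<^sub>2" "arrow (RAdj_L X j) g R\<^sub>2 R\<^sub>3" "arrow (RAdj_L X j) h R\<^sub>3 R\<^sub>4"
  then obtain c \<nu> c' \<nu>' c'' \<nu>'' where f: "f = (R\<^sub>1, (c, \<nu>), R\<^sub>2)" "g = (R\<^sub>2, (c', \<nu>'), R\<^sub>3)" "h = (R\<^sub>3, (c'', \<nu>''), R\<^sub>4)"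
    and m: "left_mor X j R\<^sub>1 R\<^sub>2 (c, \<nu>)" "left_mor X j R\<^sub>2 R\<^sub>3 (c', \<nu>')" "left_mor X j R\<^sub>3 R\<^sub>4 (c'', \<nu>'')"
    by (metis RAdj_L_arrowE)
  note d = left_morD[OF m(1)] left_morD[OF m(2)] left_morD[OF m(3)]
  note s = d(3-5,10-12,17-19) rel_adj_simps(1-6)[OF d(1)] rel_adj_simps(1-6)[OF d(2)]
    rel_adj_simps(1-6)[OF d(9)] rel_adj_simps(1-6)[OF d(16)]
    paste_simps[OF d(7)] paste_simps[OF d(14)] paste_simps[OF d(21)]
  note t = left_comp_tcell[OF m(1,2)] left_comp_tcell[OF m(2,3)]
    left_comp_tcell[OF left_mor_comp[OF m(1,2)] m(3)] left_comp_tcell[OF m(1) left_mor_comp[OF m(2,3)]]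
  have "left_comp R\<^sub>1 R\<^sub>3 R\<^sub>4 c'' \<nu>'' (c' \<cdot> c) (left_comp R\<^sub>1 R\<^sub>2 R\<^sub>3 c' \<nu>' c \<nu>) =
      left_comp R\<^sub>1 R\<^sub>2 R\<^sub>4 (c'' \<cdot> c') (left_comp R\<^sub>2 R\<^sub>3 R\<^sub>4 c'' \<nu>'' c' \<nu>') c \<nu>"
    by (rule paste_cancel[of _ "ladj R\<^sub>4" "c'' \<cdot> (c' \<cdot> (c \<cdot> ladj R\<^sub>1))"])
      (use t in \<open>simp_all add: s lid_map_mul lid_map_cmp\<close>)
  then show "cmp (RAdj_L X j) h (cmp (RAdj_L X j) g f) = cmp (RAdj_L X j) (cmp (RAdj_L X j) h g) f"
    by (simp add: f RAdj_L_simps s)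
qed

lemma category_RAdj_R: "category (RAdj_R X j)"
proof
  show "src (RAdj_R X j) f \<in> Ob (RAdj_R X j)" "tgt (RAdj_R X j) f \<in> Ob (RAdj_R X j)"
    if "f \<in> Mor (RAdj_R X j)" for f
    using that by (cases f; auto simp: RAdj_R_simps dest: right_morD)+
  show "arrow (RAdj_R X j) (idt (RAdj_R X j) R) R R" if "R \<in> Ob (RAdj_R X j)" for R
    using that by (simp add: arrow_def RAdj_R_simps right_mor_idt)
next
  fix f g R\<^sub>1 R\<^sub>2 R\<^sub>3
  assume "arrow (RAdj_R X j) f R\<^sub>1 R\<^sub>2" "arrow (RAdj_R X j) g R\<^sub>2 R\<^sub>3"
  then show "arrow (RAdj_R X j) (cmp (RAdj_R X j) g f) R\<^sub>1 R\<^sub>3"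
    by (elim RAdj_R_arrowE) (simp add: arrow_def RAdj_R_simps right_mor_comp)
next
  fix f R\<^sub>1 R\<^sub>2
  assume "arrow (RAdj_R X j) f R\<^sub>1 R\<^sub>2"
  then obtain c \<rho> where f: "f = (R\<^sub>1, (c, \<rho>), R\<^sub>2)" and m: "right_mor X j R\<^sub>1 R\<^sub>2 (c, \<rho>)"
    by (rule RAdj_R_arrowE)
  note d = right_morD[OF m]
  note i1 = right_mor_idt[OF d(1)] and i2 = right_mor_idt[OF d(2)]
  note s = d(3-5) rel_adj_simps(1-6)[OF d(1)] rel_adj_simps(1-6)[OF d(2)] paste_simps[OF d(7)]
  have "right_comp R\<^sub>1 R\<^sub>2 R\<^sub>2 (idt X (apex X R\<^sub>2)) (cap X (radj R\<^sub>2)) c \<rho> = \<rho>"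
    by (rule paste_cancel[OF _ d(7)]) (use right_comp_tcell[OF m i2] in \<open>simp_all add: s paste_cap\<close>)
  then show "cmp (RAdj_R X j) (idt (RAdj_R X j) R\<^sub>2) f = f"
    by (simp add: f RAdj_R_simps s)
  have "right_comp R\<^sub>1 R\<^sub>1 R\<^sub>2 c \<rho> (idt X (apex X R\<^sub>1)) (cap X (radj R\<^sub>1)) = \<rho>"
    by (rule paste_cancel[OF _ d(7)]) (use right_comp_tcell[OF i1 m] in \<open>simp_all add: s paste_cap\<close>)
  then show "cmp (RAdj_R X j) f (idt (RAdj_R X j) R\<^sub>1) = f"
    by (simp add: f RAdj_R_simps s)
next
  fix f g h R\<^sub>1 R\<^sub>2 R\<^sub>3 R\<^sub>4
  assume "arrow (RAdj_R X j) f R\<^sub>1 R\<^sub>2" "arrow (RAdj_R X j) g R\<^sub>2 R\<^sub>3" "arrow (RAdj_R X j) h R\<^sub>3 R\<^sub>4"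
  then obtain c \<rho> c' \<rho>' c'' \<rho>'' where f: "f = (R\<^sub>1, (c, \<rho>), R\<^sub>2)" "g = (R\<^sub>2, (c', \<rho>'), R\<^sub>3)" "h = (R\<^sub>3, (c'', \<rho>''), R\<^sub>4)"
    and m: "right_mor X j R\<^sub>1 R\<^sub>2 (c, \<rho>)" "right_mor X j R\<^sub>2 R\<^sub>3 (c', \<rho>')" "right_mor X j R\<^sub>3 R\<^sub>4 (c'', \<rho>'')"
    by (metis RAdj_R_arrowE)
  note d = right_morD[OF m(1)] right_morD[OF m(2)] right_morD[OF m(3)]
  note s = d(3-5,10-12,17-19) rel_adj_simps(1-6)[OF d(1)] rel_adj_simps(1-6)[OF d(2)]
    rel_adj_simps(1-6)[OF d(9)] rel_adj_simps(1-6)[OF d(16)]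
    paste_simps[OF d(7)] paste_simps[OF d(14)] paste_simps[OF d(21)]
  note t = right_comp_tcell[OF m(1,2)] right_comp_tcell[OF m(2,3)]
    right_comp_tcell[OF right_mor_comp[OF m(1,2)] m(3)] right_comp_tcell[OF m(1) right_mor_comp[OF m(2,3)]]
  have "right_comp R\<^sub>1 R\<^sub>3 R\<^sub>4 c'' \<rho>'' (c' \<cdot> c) (right_comp R\<^sub>1 R\<^sub>2 R\<^sub>3 c' \<rho>' c \<rho>) =
      right_comp R\<^sub>1 R\<^sub>2 R\<^sub>4 (c'' \<cdot> c') (right_comp R\<^sub>2 R\<^sub>3 R\<^sub>4 c'' \<rho>'' c' \<rho>') c \<rho>"
    by (rule paste_cancel[of _ "radj R\<^sub>1" "radj R\<^sub>4 \<cdot> (c'' \<cdot> (c' \<cdot> c))"])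
      (use t in \<open>simp_all add: s\<close>)
  then show "cmp (RAdj_R X j) h (cmp (RAdj_R X j) g f) = cmp (RAdj_R X j) (cmp (RAdj_R X j) h g) f"
    by (simp add: f RAdj_R_simps s)
qed

end


section \<open>Precomposition of the root\<close>

text \<open>Collects what stays fixed while the relative adjunction with root \<open>j\<close>
  varies, so that \<open>lift\<close> is a function of the latter alone.\<close>

locale root_precomposition = virtual_equipment X
  for X :: "('o, 't, 'l, 'c) vdc" (structure) +
  fixes j l' j' :: 't and R' :: "('t, 'c) relative_adjunction"
  assumes l'_mor: "l' \<in> Mor X" "tgt X l' = src X j"
    and R'_adj: "rel_adj X j' R'" and j_mor: "j \<in> Mor X" and R'_ladj: "ladj R' = j \<cdot> l'"
begin

lemma R'_simps:
  "j' \<in> Mor X" "src X j' = src X l'" "radj R' \<in> Mor X" "src X (radj R') = tgt X j" "tgt X (radj R') = tgt X j'"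
  "apex X R' = tgt X j"
  using rel_adj_simps[OF R'_adj] l'_mor j_mor by (simp_all add: R'_ladj)

lemmas base_simps = l'_mor j_mor R'_simps

text \<open>The transposition \<open>C(\<ell>\<ell>',1) \<cong> D(j\<ell>',r) \<cong> E(j',r'r)\<close>.\<close>

definition lift :: "('t, 'c) relative_adjunction \<Rightarrow> ('t, 'c) relative_adjunction" where
  "lift R = \<lparr> ladj = ladj R \<cdot> l', radj = radj R' \<cdot> radj R,
     sharp = vcomp X (sharp_at X j' R' (radj R))
       (hom_restrict X (ladj R) (idt X (apex X R)) j (radj R) (sharp R) l' (idt X (apex X R))),
     flat = vcomp X (hom_restrict X j (radj R) (ladj R) (idt X (apex X R)) (flat R) l' (idt X (apex X R)))
       (hom_restrict X j' (radj R') (ladj R') (idt X (apex X R')) (flat R') (idt X (src X j')) (radj R)) \<rparr>"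

lemma lift_simps [simp]:
  "ladj (lift R) = ladj R \<cdot> l'" "radj (lift R) = radj R' \<cdot> radj R"
  by (simp_all add: lift_def)

lemma apex_lift: "rel_adj X j R \<Longrightarrow> apex X (lift R) = apex X R"
  using rel_adj_simps(1-6)[of j R] by (simp add: base_simps)

lemma lift_rel_adj:
  assumes "rel_adj X j R"
  shows "rel_adj X j' (lift R)"
proof -
  note s = rel_adj_simps[OF assms] base_simps
  note s' = rel_adj_simps[OF R'_adj, unfolded R'_ladj] sharp_at_simps[OF R'_adj, of "radj R", unfolded R'_ladj]
  let ?i = "idt X (apex X R)"
  \<comment> \<open>\<open>K\<close> is the isomorphism C(\<ell>\<ell>',1) \<Rightarrow>
    D(j\<ell>',r) and \<open>N\<close> the isomorphism D(j\<ell>',r) \<Rightarrow> E(j',r'r), with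
    inverses \<open>K'\<close> and \<open>N'\<close>. They meet because \<open>ladj R'\<close> is
    \<open>j \<cdot> l'\<close>.\<close>
  define K where "K = hom_restrict X (ladj R) ?i j (radj R) (sharp R) l' ?i"
  define K' where "K' = hom_restrict X j (radj R) (ladj R) ?i (flat R) l' ?i"
  define N where "N = sharp_at X j' R' (radj R)"
  define N' where "N' = hom_restrict X j' (radj R') (ladj R') (idt X (apex X R')) (flat R') (idt X (src X j')) (radj R)"
  let ?p = "hom X (ladj R \<cdot> l') ?i" and ?q = "hom X (j \<cdot> l') (radj R)" and ?o = "hom X j' (radj R' \<cdot> radj R)"
  have K: "K \<in> Cell X" "lft X K = idt X (src X l')" "rgt X K = ?i" "cdom X K = [?p]" "ccod X K = ?q"
    "K' \<in> Cell X" "lft X K' = idt X (src X l')" "rgt X K' = ?i" "cdom X K' = [?q]" "ccod X K' = ?p"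
    unfolding K_def K'_def by (simp_all add: s)
  have N: "N \<in> Cell X" "lft X N = idt X (src X l')" "rgt X N = ?i" "cdom X N = [?q]" "ccod X N = ?o"
    "N' \<in> Cell X" "lft X N' = idt X (src X l')" "rgt X N' = ?i" "cdom X N' = [?o]" "ccod X N' = ?q"
    unfolding N_def N'_def R'_ladj by (simp_all add: s s')
  have "vcomp X K' K = cid X (hom X (ladj R \<cdot> l') (?i \<cdot> ?i))"
    unfolding K_def K'_def by (rule hom_restrict_inverse) (simp_all add: s)
  then have K'K: "vcomp X K' K = cid X ?p"
    by (simp add: s)
  have "vcomp X K K' = cid X (hom X (j \<cdot> l') (radj R \<cdot> ?i))"
    unfolding K_def K'_def by (rule hom_restrict_inverse) (simp_all add: s)
  then have KK': "vcomp X K K' = cid X ?q"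
    by (simp add: s)
  have "vcomp X N' N = cid X (hom X (ladj R' \<cdot> idt X (src X j')) (idt X (apex X R') \<cdot> radj R))"
    unfolding N_def N'_def sharp_at_def by (rule hom_restrict_inverse) (simp_all add: s s' R'_ladj)
  then have N'N: "vcomp X N' N = cid X ?q"
    by (simp add: s R'_ladj)
  have "vcomp X N N' = cid X (hom X (j' \<cdot> idt X (src X j')) (radj R' \<cdot> radj R))"
    unfolding N_def N'_def sharp_at_def by (rule hom_restrict_inverse) (simp_all add: s s' R'_ladj)
  then have NN': "vcomp X N N' = cid X ?o"
    by (simp add: s)
  have fs: "vcomp X (vcomp X K' N') (vcomp X N K) = cid X ?p"
  proof -
    have "vcomp X (vcomp X K' N') (vcomp X N K) = vcomp X K' (vcomp X (vcomp X N' N) K)"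
      by (simp add: K N)
    then show ?thesis
      by (simp add: N'N K K'K)
  qed
  have sf: "vcomp X (vcomp X N K) (vcomp X K' N') = cid X ?o"
  proof -
    have "vcomp X (vcomp X N K) (vcomp X K' N') = vcomp X N (vcomp X (vcomp X K K') N')"
      by (simp add: K N)
    then show ?thesis
      by (simp add: NN' N KK')
  qed
  have sharp: "sharp (lift R) = vcomp X N K" and flat: "flat (lift R) = vcomp X K' N'"
    by (simp_all add: lift_def K_def K'_def N_def N'_def)
  show ?thesis
    unfolding rel_adj_def Let_def sharp flat
    \<comment> \<open>\<open>fs\<close> and \<open>sf\<close> are stated for composites of
      composites; reassociating the goal would keep them from matching.\<close>
    by (intro exI[of _ "src X l'"] exI[of _ "apex X R"] exI[of _ "tgt X j'"])
      (simp add: arrow_def cell_def s K N fs sf del: vcomp_assoc)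
qed

text \<open>The tight-cell \<open>l'\<close> is absorbed by the parameter: \<open>R'\<close> sees
  \<open>u\<close>, its left adjoint being \<open>j \<cdot> l'\<close>, while \<open>R\<close> sees
  \<open>l' \<cdot> u\<close>.\<close>

lemma lift_transp:
  assumes "rel_adj X j R" "\<phi> \<in> Cell X" "ccod X \<phi> = lid X (apex X R)" "u \<in> Mor X" "tgt X u = src X l'"
    "lft X \<phi> = ladj R \<cdot> (l' \<cdot> u)"
  shows "transp j' (lift R) u \<phi> = transp j' R' u (transp j R (l' \<cdot> u) \<phi>)"
proof -
  note s = rel_adj_simps[OF assms(1)] base_simps assms(2-)
  note s' = rel_adj_simps[OF R'_adj, unfolded R'_ladj] sharp_at_simps[OF R'_adj, of "radj R", unfolded R'_ladj]
  let ?i = "idt X (apex X R)"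
  define K where "K = hom_restrict X (ladj R) ?i j (radj R) (sharp R) l' ?i"
  define N where "N = sharp_at X j' R' (radj R)"
  define \<kappa> where "\<kappa> = hom_restr_cell X (ladj R) ?i l' ?i"
  let ?p = "hom X (ladj R \<cdot> l') ?i" and ?q = "hom X (j \<cdot> l') (radj R)" and ?o = "hom X j' (radj R' \<cdot> radj R)"
  let ?f = "cart_fac X (hom_cell X (ladj R \<cdot> l') ?i) u \<phi> (rgt X \<phi>)"
  have K: "K \<in> Cell X" "lft X K = idt X (src X l')" "cdom X K = [?p]" "ccod X K = ?q"
    unfolding K_def by (simp_all add: s)
  have N: "N \<in> Cell X" "cdom X N = [?q]" "ccod X N = ?o"
    unfolding N_def by (simp_all add: s s')
  have \<kappa>: "\<kappa> \<in> Cell X" "lft X \<kappa> = l'" "cdom X \<kappa> = [?p]" "ccod X \<kappa> = hom X (ladj R) ?i"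
    unfolding \<kappa>_def by (simp_all add: s)
  have f: "?f \<in> Cell X" "lft X ?f = u" "ccod X ?f = ?p" "vcomp X (hom_cell X (ladj R \<cdot> l') ?i) ?f = \<phi>"
    by (simp_all add: s)
  have "vcomp X (hom_cell X (j \<cdot> l') (radj R \<cdot> ?i)) K = vcomp X (hom_cell X j (radj R)) (vcomp X (sharp R) \<kappa>)"
    unfolding K_def \<kappa>_def by (rule hom_restrict_hom_cell) (simp_all add: s)
  then have hK: "vcomp X (hom_cell X (j \<cdot> l') (radj R)) K = vcomp X (hom_cell X j (radj R)) (vcomp X (sharp R) \<kappa>)"
    by (simp add: s)
  have h\<kappa>: "vcomp X (hom_cell X (ladj R) ?i) (vcomp X \<kappa> ?f) = \<phi>"
    using hom_restr_cell_vcomp[of "ladj R" ?i l' ?i ?f] by (simp add: s \<kappa>_def)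
  have "transp j' (lift R) u \<phi> = vcomp X (vcomp X (hom_cell X j' (radj R' \<cdot> radj R)) (vcomp X N K)) ?f"
    by (simp add: transp_def apex_lift[OF assms(1)] lift_def flip: K_def N_def) (simp add: s)
  also have "\<dots> = vcomp X (hom_cell X j' (radj R' \<cdot> radj R)) (vcomp X N (vcomp X K ?f))"
    by (simp add: s K N f(1-3))
  also have "\<dots> = transp j' R' (lft X (vcomp X K ?f)) (vcomp X (hom_cell X (ladj R') (radj R)) (vcomp X K ?f))"
    unfolding N_def by (rule sharp_at_transp[OF R'_adj]) (simp_all add: s K f(1-3) R'_ladj)
  also have "lft X (vcomp X K ?f) = u"
    by (simp add: s K f(1-3))
  also have "vcomp X (hom_cell X (ladj R') (radj R)) (vcomp X K ?f) = vcomp X (vcomp X (hom_cell X (j \<cdot> l') (radj R)) K) ?f"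
    unfolding R'_ladj by (rule vcomp_assoc[symmetric]) (simp_all add: s K f(1-3))
  also have "\<dots> = vcomp X (vcomp X (hom_cell X j (radj R)) (sharp R)) (vcomp X \<kappa> ?f)"
    unfolding hK by (simp add: s \<kappa> f(1-3))
  also have "\<dots> = transp j R (lft X (vcomp X \<kappa> ?f)) (vcomp X (hom_cell X (ladj R) ?i) (vcomp X \<kappa> ?f))"
    by (rule transp_hom_cell[OF assms(1), symmetric]) (simp_all add: \<kappa> f(1-3))
  also have "lft X (vcomp X \<kappa> ?f) = l' \<cdot> u"
    by (simp add: \<kappa> f(1-3))
  finally show ?thesis
    unfolding h\<kappa> .
qed

section \<open>Action on morphisms and the unit\<close>

text \<open>The criterion for the lifts at \<open>u\<close> is the original one at
  \<open>l' \<cdot> u\<close>, transposed once more along \<open>R'\<close>; whiskering along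
  \<open>l'\<close> and then \<open>u\<close> is whiskering along the composite.\<close>

lemma lift_left_mor:
  assumes "left_mor X j R\<^sub>1 R\<^sub>2 (c, \<nu>)"
  shows "left_mor X j' (lift R\<^sub>1) (lift R\<^sub>2) (c, whisker_right X (ladj R\<^sub>2) (c \<cdot> ladj R\<^sub>1) \<nu> l')"
proof -
  note d = left_morD[OF assms]
  note s = d(3-5) rel_adj_simps(1-6)[OF d(1)] rel_adj_simps(1-6)[OF d(2)] base_simps paste_simps[OF d(7)]
  have l': "tgt X l' = src X (ladj R\<^sub>2)"
    by (simp add: s)
  have e: "c \<cdot> ladj R\<^sub>1 \<cdot> l' = c \<cdot> (ladj R\<^sub>1 \<cdot> l')"
    by (simp add: s)
  note w = tcell_whisker_right[OF d(7) l'_mor(1) l', unfolded e]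
  show ?thesis
    unfolding left_mor_iff lift_simps w(2)
  proof (intro conjI allI impI w(1) lift_rel_adj d(1,2))
    show "arrow X c (tgt X (ladj R\<^sub>1 \<cdot> l')) (tgt X (ladj R\<^sub>2 \<cdot> l'))"
      by (simp add: s arrow_def)
    show "radj R' \<cdot> radj R\<^sub>1 = radj R' \<cdot> radj R\<^sub>2 \<cdot> c"
      unfolding d(6) by (simp add: s)
    fix u \<phi>
    assume "\<phi> \<in> Cell X \<and> ccod X \<phi> = lid X (tgt X (ladj R\<^sub>1 \<cdot> l')) \<and> u \<in> Mor X \<and> tgt X u = src X j' \<and>
      lft X \<phi> = ladj R\<^sub>1 \<cdot> l' \<cdot> u"
    then have phi: "\<phi> \<in> Cell X" "ccod X \<phi> = lid X (apex X R\<^sub>1)" "u \<in> Mor X" "tgt X u = src X l'"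
      "lft X \<phi> = ladj R\<^sub>1 \<cdot> (l' \<cdot> u)"
      by (auto simp: s)
    let ?n = "paste (ladj R\<^sub>2) (c \<cdot> ladj R\<^sub>1) \<nu>"
    let ?\<psi> = "mul (apex X R\<^sub>2) (ccomp X ?n (l' \<cdot> u) []) (vcomp X (lid_map c) \<phi>)"
    have "transp j' (lift R\<^sub>1) u \<phi> = transp j' R' u (transp j R\<^sub>1 (l' \<cdot> u) \<phi>)"
      by (rule lift_transp[OF d(1) phi])
    also have "transp j R\<^sub>1 (l' \<cdot> u) \<phi> = transp j R\<^sub>2 (l' \<cdot> u) ?\<psi>"
      by (rule left_mor_transp[OF assms]) (simp_all add: s phi)
    also have "transp j' R' u \<dots> = transp j' (lift R\<^sub>2) u ?\<psi>"
      by (rule lift_transp[OF d(2), symmetric]) (simp_all add: s phi)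
    finally show "transp j' (lift R\<^sub>1) u \<phi> = transp j' (lift R\<^sub>2) u
        (mul (tgt X (ladj R\<^sub>2 \<cdot> l')) (ccomp X (ccomp X ?n l' []) u []) (vcomp X (lid_map c) \<phi>))"
      by (simp add: s phi)
  qed
qed

lemma lift_right_mor:
  assumes "right_mor X j R\<^sub>1 R\<^sub>2 (c, \<rho>)"
  shows "right_mor X j' (lift R\<^sub>1) (lift R\<^sub>2) (c, whisker_left X (radj R') (radj R\<^sub>1) (radj R\<^sub>2 \<cdot> c) \<rho>)"
proof -
  note d = right_morD[OF assms]
  note s = d(3-5) rel_adj_simps(1-6)[OF d(1)] rel_adj_simps(1-6)[OF d(2)] base_simps paste_simps[OF d(7)]
  have r: "tgt X (radj R\<^sub>1) = src X (radj R')"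
    by (simp add: s)
  have e: "radj R' \<cdot> radj R\<^sub>2 \<cdot> c = radj R' \<cdot> (radj R\<^sub>2 \<cdot> c)"
    by (simp add: s)
  note w = tcell_whisker_left[OF d(7) R'_simps(3) r]
  show ?thesis
    unfolding right_mor_iff lift_simps e w(2)
  proof (intro conjI allI impI w(1) lift_rel_adj d(1,2))
    show "arrow X c (tgt X (ladj R\<^sub>1 \<cdot> l')) (tgt X (ladj R\<^sub>2 \<cdot> l'))"
      by (simp add: s arrow_def)
    show "c \<cdot> (ladj R\<^sub>1 \<cdot> l') = ladj R\<^sub>2 \<cdot> l'"
      using cmp_assoc_right[of l' "ladj R\<^sub>1" c] by (simp add: s d(6))
    fix u \<phi>
    assume "\<phi> \<in> Cell X \<and> ccod X \<phi> = lid X (tgt X (ladj R\<^sub>1 \<cdot> l')) \<and> u \<in> Mor X \<and> tgt X u = src X j' \<and>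
      lft X \<phi> = ladj R\<^sub>1 \<cdot> l' \<cdot> u"
    then have phi: "\<phi> \<in> Cell X" "ccod X \<phi> = lid X (apex X R\<^sub>1)" "u \<in> Mor X" "tgt X u = src X l'"
      "lft X \<phi> = ladj R\<^sub>1 \<cdot> (l' \<cdot> u)"
      by (auto simp: s)
    have lu: "l' \<cdot> u \<in> Mor X" "tgt X (l' \<cdot> u) = src X j"
      by (simp_all add: s phi)
    note p = transp_simps[OF d(1) phi(1,2) lu phi(5)]
    have h: "c \<cdot> (ladj R\<^sub>1 \<cdot> (l' \<cdot> u)) = ladj R\<^sub>2 \<cdot> (l' \<cdot> u)"
      using cmp_assoc_right[of "l' \<cdot> u" "ladj R\<^sub>1" c] by (simp add: s phi d(6))
    let ?n = "paste (radj R\<^sub>1) (radj R\<^sub>2 \<cdot> c) \<rho>" and ?T = "transp j R\<^sub>1 (l' \<cdot> u) \<phi>"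
    have "transp j' (lift R\<^sub>2) u (vcomp X (lid_map c) \<phi>) =
        transp j' R' u (transp j R\<^sub>2 (l' \<cdot> u) (vcomp X (lid_map c) \<phi>))"
      by (rule lift_transp[OF d(2)]) (simp_all add: s phi h)
    also have "transp j R\<^sub>2 (l' \<cdot> u) (vcomp X (lid_map c) \<phi>) = mul (tgt X j) ?T (ccomp X ?n (rgt X \<phi>) [])"
      by (rule right_mor_transp[OF assms phi(1,2) lu phi(5), symmetric])
    \<comment> \<open>The second transposition has to pass over the factor coming from
      \<open>\<rho>\<close>. Naturality turns this factor into its image under
      \<open>radj R'\<close>, which is the 2-cell assigned to the lifted morphism.\<close>
    also have "transp j' R' u \<dots> = mul (tgt X j') (transp j' R' u ?T)
        (vcomp X (lid_map (radj R')) (ccomp X ?n (rgt X \<phi>) []))"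
      using transp_mul[OF R'_adj, of ?T u "ccomp X ?n (rgt X \<phi>) []"] by (simp add: s p phi R'_ladj)
    also have "transp j' R' u ?T = transp j' (lift R\<^sub>1) u \<phi>"
      by (rule lift_transp[OF d(1) phi, symmetric])
    also have "vcomp X (lid_map (radj R')) (ccomp X ?n (rgt X \<phi>) []) =
        ccomp X (vcomp X (lid_map (radj R')) ?n) (rgt X \<phi>) []"
      by (simp add: s phi)
    finally show "mul (tgt X j') (transp j' (lift R\<^sub>1) u \<phi>)
        (ccomp X (vcomp X (lid_map (radj R')) ?n) (rgt X \<phi>) []) =
        transp j' (lift R\<^sub>2) u (vcomp X (lid_map c) \<phi>)"
      by (rule sym)
  qed
qed

lemma unit_left_mor:
  assumes "rel_adj X j R"
  shows "left_mor X j' (lift R) R' (radj R, whisker_right X j (radj R \<cdot> ladj R) (unit X j R) l')"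
proof -
  note t = unit_tcell[OF assms]
  note s = rel_adj_simps(1-6)[OF assms] base_simps paste_simps[OF t(1)]
  have e: "radj R \<cdot> ladj R \<cdot> l' = radj R \<cdot> (ladj R \<cdot> l')"
    by (simp add: s)
  note w = tcell_whisker_right[OF t(1) l'_mor, unfolded e]
  let ?e = "\<lambda>f. ccomp X (lid_cell X (apex X R)) f []"
  show ?thesis
    unfolding left_mor_iff lift_simps R'_ladj w(2)
  proof (intro conjI allI impI w(1) lift_rel_adj R'_adj assms refl)
    show "arrow X (radj R) (tgt X (ladj R \<cdot> l')) (tgt X (j \<cdot> l'))"
      by (simp add: s arrow_def)
    fix u \<phi>
    assume "\<phi> \<in> Cell X \<and> ccod X \<phi> = lid X (tgt X (ladj R \<cdot> l')) \<and> u \<in> Mor X \<and> tgt X u = src X j' \<and>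
      lft X \<phi> = ladj R \<cdot> l' \<cdot> u"
    then have phi: "\<phi> \<in> Cell X" "ccod X \<phi> = lid X (apex X R)" "u \<in> Mor X" "tgt X u = src X l'"
      "lft X \<phi> = ladj R \<cdot> (l' \<cdot> u)"
      by (auto simp: s)
    have "ccomp X (ccomp X (paste j (radj R \<cdot> ladj R) (unit X j R)) l' []) u [] =
        ccomp X (paste j (radj R \<cdot> ladj R) (unit X j R)) (l' \<cdot> u) []"
      by (simp add: s phi)
    \<comment> \<open>The unit of \<open>R\<close> is the transpose of an identity 2-cell, so its
      whiskering is the transpose of the identity on
      \<open>ladj R \<cdot> (l' \<cdot> u)\<close>.\<close>
    also have "\<dots> = transp j R (l' \<cdot> u) (?e (ladj R \<cdot> (l' \<cdot> u)))"
      unfolding t(2) using transp_whisker[OF assms, of "?e (ladj R)" "idt X (src X j)" "l' \<cdot> u"]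
      by (simp add: s phi)
    finally have n: "ccomp X (ccomp X (paste j (radj R \<cdot> ladj R) (unit X j R)) l' []) u [] =
        transp j R (l' \<cdot> u) (?e (ladj R \<cdot> (l' \<cdot> u)))" .
    \<comment> \<open>Naturality moves \<open>\<phi>\<close> inside the transposition, where the
      identity 2-cell is absorbed.\<close>
    have "mul (tgt X j) (transp j R (l' \<cdot> u) (?e (ladj R \<cdot> (l' \<cdot> u)))) (vcomp X (lid_map (radj R)) \<phi>) =
        transp j R (l' \<cdot> u) (mul (apex X R) (?e (ladj R \<cdot> (l' \<cdot> u))) \<phi>)"
      by (rule transp_mul[OF assms, symmetric]) (simp_all add: s phi)
    also have "\<dots> = transp j R (l' \<cdot> u) \<phi>"
      by (simp add: s phi)
    finally have m: "mul (tgt X j) (transp j R (l' \<cdot> u) (?e (ladj R \<cdot> (l' \<cdot> u)))) (vcomp X (lid_map (radj R)) \<phi>) =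
        transp j R (l' \<cdot> u) \<phi>" .
    have "tgt X (j \<cdot> l') = tgt X j"
      by (simp add: s)
    then show "transp j' (lift R) u \<phi> = transp j' R' u (mul (tgt X (j \<cdot> l'))
        (ccomp X (ccomp X (paste j (radj R \<cdot> ladj R) (unit X j R)) l' []) u []) (vcomp X (lid_map (radj R)) \<phi>))"
      unfolding n by (simp only: m lift_transp[OF assms phi])
  qed
qed

section \<open>Functoriality\<close>

text \<open>The tight-cell of a morphism is kept, so functoriality concerns the 2-cells only: after
  pasting it says that precomposition with \<open>l'\<close> preserves units and
  \<open>mul\<close>.\<close>

lemma lift_functor_L:
  "cat_functor (RAdj_L X j) (RAdj_L X j') lift
    (\<lambda>(R\<^sub>1, (c, \<nu>), R\<^sub>2). (lift R\<^sub>1, (c, whisker_right X (ladj R\<^sub>2) (c \<cdot> ladj R\<^sub>1) \<nu> l'), lift R\<^sub>2))"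
  (is "cat_functor ?S ?T _ ?F")
proof -
  interpret S: category ?S by (rule category_RAdj_L)
  interpret T: category ?T by (rule category_RAdj_L)
  show ?thesis
  proof
    show "lift R \<in> Ob ?T" if "R \<in> Ob ?S" for R
      using that lift_rel_adj by (simp add: RAdj_L_simps)
    show "arrow ?T (?F f) (lift R\<^sub>1) (lift R\<^sub>2)" if "arrow ?S f R\<^sub>1 R\<^sub>2" for f R\<^sub>1 R\<^sub>2
      using that by (rule RAdj_L_arrowE) (simp add: arrow_def RAdj_L_simps lift_left_mor)
  next
    fix R
    assume "R \<in> Ob ?S"
    then have R: "rel_adj X j R"
      by (simp add: RAdj_L_simps)
    note s = rel_adj_simps(1-6)[OF R] base_simps
    have l': "tgt X l' = src X (ladj R)"
      by (simp add: s)
    have "whisker_right X (ladj R) (ladj R) (cap X (ladj R)) l' = cap X (ladj R \<cdot> l')"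
      by (rule paste_cancel[OF tcell_whisker_right(1)[OF tcell_cap l'_mor(1) l'] tcell_cap])
        (simp_all add: s paste_cap tcell_whisker_right(2)[OF tcell_cap l'_mor(1) l'])
    then show "?F (idt ?S R) = idt ?T (lift R)"
      by (simp add: RAdj_L_simps s)
  next
    fix f g R\<^sub>1 R\<^sub>2 R\<^sub>3
    assume "arrow ?S f R\<^sub>1 R\<^sub>2" "arrow ?S g R\<^sub>2 R\<^sub>3"
    then obtain c \<nu> c' \<nu>' where f: "f = (R\<^sub>1, (c, \<nu>), R\<^sub>2)" "g = (R\<^sub>2, (c', \<nu>'), R\<^sub>3)"
      and m: "left_mor X j R\<^sub>1 R\<^sub>2 (c, \<nu>)" "left_mor X j R\<^sub>2 R\<^sub>3 (c', \<nu>')"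
      by (metis RAdj_L_arrowE)
    note d = left_morD[OF m(1)] left_morD[OF m(2)]
    note s = d(3-5,10-12) rel_adj_simps(1-6)[OF d(1)] rel_adj_simps(1-6)[OF d(2)] rel_adj_simps(1-6)[OF d(9)]
      base_simps paste_simps[OF d(7)] paste_simps[OF d(14)]
    note t = left_comp_tcell[OF m] left_comp_tcell[OF lift_left_mor[OF m(1)] lift_left_mor[OF m(2)]]
    have l': "tgt X l' = src X (ladj R\<^sub>2)" "tgt X l' = src X (ladj R\<^sub>3)"
      by (simp_all add: s)
    note w = tcell_whisker_right[OF d(7) l'_mor(1) l'(1)] tcell_whisker_right[OF d(14) l'_mor(1) l'(2)]
      tcell_whisker_right[OF t(1) l'_mor(1) l'(2)]
    have "whisker_right X (ladj R\<^sub>3) (c' \<cdot> (c \<cdot> ladj R\<^sub>1)) (left_comp R\<^sub>1 R\<^sub>2 R\<^sub>3 c' \<nu>' c \<nu>) l' =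
        left_comp (lift R\<^sub>1) (lift R\<^sub>2) (lift R\<^sub>3)
          c' (whisker_right X (ladj R\<^sub>3) (c' \<cdot> ladj R\<^sub>2) \<nu>' l') c (whisker_right X (ladj R\<^sub>2) (c \<cdot> ladj R\<^sub>1) \<nu> l')"
      by (rule paste_cancel[of _ "ladj R\<^sub>3 \<cdot> l'" "c' \<cdot> (c \<cdot> (ladj R\<^sub>1 \<cdot> l'))"])
        (use t w in \<open>simp_all add: s\<close>)
    then show "?F (cmp ?S g f) = cmp ?T (?F g) (?F f)"
      by (simp add: f RAdj_L_simps s)
  qed
qed

text \<open>Here the 2-cells are whiskered by \<open>radj R'\<close>, and their composites are
  preserved because \<open>lid_map\<close> respects \<open>mul\<close>.\<close>

lemma lift_functor_R:
  "cat_functor (RAdj_R X j) (RAdj_R X j') lift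
    (\<lambda>(R\<^sub>1, (c, \<rho>), R\<^sub>2). (lift R\<^sub>1, (c, whisker_left X (radj R') (radj R\<^sub>1) (radj R\<^sub>2 \<cdot> c) \<rho>), lift R\<^sub>2))"
  (is "cat_functor ?S ?T _ ?F")
proof -
  interpret S: category ?S by (rule category_RAdj_R)
  interpret T: category ?T by (rule category_RAdj_R)
  show ?thesis
  proof
    show "lift R \<in> Ob ?T" if "R \<in> Ob ?S" for R
      using that lift_rel_adj by (simp add: RAdj_R_simps)
    show "arrow ?T (?F f) (lift R\<^sub>1) (lift R\<^sub>2)" if "arrow ?S f R\<^sub>1 R\<^sub>2" for f R\<^sub>1 R\<^sub>2
      using that by (rule RAdj_R_arrowE) (simp add: arrow_def RAdj_R_simps lift_right_mor)
  next
    fix R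
    assume "R \<in> Ob ?S"
    then have R: "rel_adj X j R"
      by (simp add: RAdj_R_simps)
    note s = rel_adj_simps(1-6)[OF R] base_simps
    have r: "tgt X (radj R) = src X (radj R')"
      by (simp add: s)
    have "whisker_left X (radj R') (radj R) (radj R) (cap X (radj R)) = cap X (radj R' \<cdot> radj R)"
      by (rule paste_cancel[OF tcell_whisker_left(1)[OF tcell_cap R'_simps(3) r] tcell_cap])
        (simp_all add: s paste_cap tcell_whisker_left(2)[OF tcell_cap R'_simps(3) r])
    then show "?F (idt ?S R) = idt ?T (lift R)"
      by (simp add: RAdj_R_simps s)
  next
    fix f g R\<^sub>1 R\<^sub>2 R\<^sub>3
    assume "arrow ?S f R\<^sub>1 R\<^sub>2" "arrow ?S g R\<^sub>2 R\<^sub>3"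
    then obtain c \<rho> c' \<rho>' where f: "f = (R\<^sub>1, (c, \<rho>), R\<^sub>2)" "g = (R\<^sub>2, (c', \<rho>'), R\<^sub>3)"
      and m: "right_mor X j R\<^sub>1 R\<^sub>2 (c, \<rho>)" "right_mor X j R\<^sub>2 R\<^sub>3 (c', \<rho>')"
      by (metis RAdj_R_arrowE)
    note d = right_morD[OF m(1)] right_morD[OF m(2)]
    note s = d(3-5,10-12) rel_adj_simps(1-6)[OF d(1)] rel_adj_simps(1-6)[OF d(2)] rel_adj_simps(1-6)[OF d(9)]
      base_simps paste_simps[OF d(7)] paste_simps[OF d(14)]
    note t = right_comp_tcell[OF m] right_comp_tcell[OF lift_right_mor[OF m(1)] lift_right_mor[OF m(2)]]
    have r: "tgt X (radj R\<^sub>1) = src X (radj R')" "tgt X (radj R\<^sub>2) = src X (radj R')"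
      by (simp_all add: s)
    note w = tcell_whisker_left[OF d(7) R'_simps(3) r(1)] tcell_whisker_left[OF d(14) R'_simps(3) r(2)]
      tcell_whisker_left[OF t(1) R'_simps(3) r(1)]
    have "whisker_left X (radj R') (radj R\<^sub>1) (radj R\<^sub>3 \<cdot> (c' \<cdot> c)) (right_comp R\<^sub>1 R\<^sub>2 R\<^sub>3 c' \<rho>' c \<rho>) =
        right_comp (lift R\<^sub>1) (lift R\<^sub>2) (lift R\<^sub>3)
          c' (whisker_left X (radj R') (radj R\<^sub>2) (radj R\<^sub>3 \<cdot> c') \<rho>')
          c (whisker_left X (radj R') (radj R\<^sub>1) (radj R\<^sub>2 \<cdot> c) \<rho>)"
      by (rule paste_cancel[of _ "radj R' \<cdot> radj R\<^sub>1" "radj R' \<cdot> (radj R\<^sub>3 \<cdot> (c' \<cdot> c))"])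
        (use t w in \<open>simp_all add: s lid_map_mul\<close>)
    then show "?F (cmp ?S g f) = cmp ?T (?F g) (?F f)"
      by (simp add: f RAdj_R_simps s)
  qed
qed

end

theorem corollary5p34:
  fixes X :: "('o, 't, 'l, 'c) vdc"
    and j l' j' r' :: 't
    and A B D E :: 'o
    and R' :: "('t, 'c) relative_adjunction"
  assumes "virtual_equipment X"
    and "arrow X j B D"
    and "arrow X l' A B" and "arrow X j' A E" and "arrow X r' D E"
    and "rel_adj X j' R'" and "ladj R' = j \<cdot>\<^bsub>X\<^esub> l'" and "radj R' = r'"
  shows "\<exists>G.
    (\<forall>R C l r.
       arrow X l B C \<and> arrow X r C D \<and>
       rel_adj X j R \<and> ladj R = l \<and> radj R = r \<longrightarrow>
         rel_adj X j' (G R) \<and> ladj (G R) = l \<cdot>\<^bsub>X\<^esub> l' \<and> radj (G R) = r' \<cdot>\<^bsub>X\<^esub> r \<and>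
         left_mor X j' (G R) R' (r, whisker_right X j (r \<cdot>\<^bsub>X\<^esub> l) (unit X j R) l')) \<and>
    (\<exists>F. cat_functor (RAdj_L X j) (RAdj_L X j') G F) \<and>
    (\<exists>F. cat_functor (RAdj_R X j) (RAdj_R X j') G F)"
proof -
  interpret virtual_equipment X
    by (rule assms(1))
  interpret root_precomposition X j l' j' R'
    using assms by unfold_locales (auto simp: arrow_def)
  show ?thesis
    using lift_rel_adj unit_left_mor lift_functor_L lift_functor_R assms(8)
    \<comment> \<open>The one object map \<open>lift\<close> serves both functors; only their maps
      on morphisms differ.\<close>
    by (intro exI[of _ lift] conjI) auto
qed

end
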